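(* Let $H_1,H_2,K_1,K_2$ be Hilbert spaces and let $\mathcal{X}\subseteq B(H_1,H_2)$, $\mathcal{Y}\subseteq B(K_1,K_2)$ be $w^*$-closed subspaces acting nondegenerately. Suppose that $\mathcal{X}$ and $\mathcal{Y}$ are TRO-equivalent. Then there exist a cardinal $J$ and unitary operators $U_i\in B(H_i\otimes\ell^2_J,K_i\otimes\ell^2_J)$, $i=1,2$, such that $$\mathcal{Y}\bar\otimes M_J=U_2(\mathcal{X}\bar\otimes M_J)U_1^*.$$ In particular, $\mathcal{X}$ and $\mathcal{Y}$ are stably isomorphic.
   Context: A subspace $X\subseteq B(H,K)$ acts nondegenerately if $\overline{[XH]}=K$ and $\overline{[X^*K]}=H$ (closed linear spans). A ternary ring of operators (TRO) is a subspace $\mathcal{M}\subseteq B(H,K)$ with $\mathcal{M}\mathcal{M}^*\mathcal{M}\subseteq\mathcal{M}$. $[\,\cdot\,]^{-w^*}$ denotes $w^*$-closed linear span. Two $w^*$-closed subspaces $\mathcal{X}\subseteq B(H_1,H_2)$, $\mathcal{Y}\subseteq B(K_1,K_2)$ are TRO-equivalent if there exist TROs $\mathcal{M}_1\subseteq B(H_1,K_1)$ and $\mathcal{M}_2\subseteq B(H_2,K_2)$ with $\mathcal{Y}=[\mathcal{M}_2\mathcal{X}\mathcal{M}_1^*]^{-w^*}$ and $\mathcal{X}=[\mathcal{M}_2^*\mathcal{Y}\mathcal{M}_1]^{-w^*}$. For a cardinal $J$, $\ell^2_J$ is the Hilbert space of square-summable families indexed by $J$, and $M_J$ is identified with $B(\ell^2_J)$.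 $\bar\otimes$ is the normal spatial tensor product: for a $w^*$-closed $\mathcal{X}\subseteq B(H_1,H_2)$, $\mathcal{X}\bar\otimes M_J$ is the $w^*$-closed linear span in $B(H_1\otimes\ell^2_J,H_2\otimes\ell^2_J)$ of the operators $x\otimes a$, $x\in\mathcal{X}$, $a\in M_J$. Two dual operator spaces $\mathcal{X},\mathcal{Y}$ are stably isomorphic if there is a cardinal $J$ such that $\mathcal{X}\bar\otimes M_J\cong\mathcal{Y}\bar\otimes M_J$ via a completely isometric $w^*$-homeomorphic linear isomorphism. *)

theory Defs
  imports "HOL-Analysis.Analysis"
begin

section \<open>Complex Hilbert spaces\<close>

class complex_vector = ab_group_add +
  fixes scaleC :: "complex \<Rightarrow> 'a \<Rightarrow> 'a"  (infixr \<open>*\<^sub>C\<close> 75)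
  assumes scaleC_add_right: "a *\<^sub>C (x + y) = a *\<^sub>C x + a *\<^sub>C y"
    and scaleC_add_left: "(a + b) *\<^sub>C x = a *\<^sub>C x + b *\<^sub>C x"
    and scaleC_scaleC: "a *\<^sub>C (b *\<^sub>C x) = (a * b) *\<^sub>C x"
    and scaleC_one: "1 *\<^sub>C x = x"

global_interpretation complex_vector:
  vector_space "scaleC :: complex \<Rightarrow> 'a \<Rightarrow> 'a :: complex_vector"
  defines csubspace = complex_vector.subspace
    and cspan = complex_vector.span
  by unfold_locales
    (simp_all add: scaleC_add_right scaleC_add_left scaleC_scaleC scaleC_one)

text \<open>The norm and the topology are those of the underlying real Hilbert space, whose inner
  product is the real part of the complex one. The complex inner product is linear in the
  second argument. The zero space is allowed.\<close>

class chilbert_space = complex_vector + real_inner + complete_space +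
  fixes cinner :: "'a \<Rightarrow> 'a \<Rightarrow> complex"
  assumes scaleR_scaleC: "r *\<^sub>R x = complex_of_real r *\<^sub>C x"
    and cinner_commute: "cinner x y = cnj (cinner y x)"
    and cinner_add_right: "cinner x (y + z) = cinner x y + cinner x z"
    and cinner_scaleC_right: "cinner x (a *\<^sub>C y) = a * cinner x y"
    and inner_eq_Re_cinner: "inner x y = Re (cinner x y)"

lemma cinner_self: "cinner x x = complex_of_real ((norm x)\<^sup>2)"
proof -
  have "Im (cinner x x) = 0"
    using arg_cong[OF cinner_commute[of x x], of Im] by simp
  moreover have "Re (cinner x x) = (norm x)\<^sup>2"
    by (simp add: inner_eq_Re_cinner[symmetric] power2_norm_eq_inner)
  ultimately show ?thesis
    by (simp add: complex_eq_iff)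
qed

lemma norm_scaleC: "norm (a *\<^sub>C x) = cmod a * norm (x :: 'a :: chilbert_space)"
proof -
  have "cinner (a *\<^sub>C x) (a *\<^sub>C x) = a * cnj a * cinner x x"
    by (metis (no_types, lifting) cinner_commute cinner_scaleC_right complex_cnj_mult
        mult.assoc)
  also have "\<dots> = complex_of_real ((cmod a * norm x)\<^sup>2)"
    by (simp add: cinner_self power_mult_distrib flip: complex_norm_square)
  finally have "(norm (a *\<^sub>C x))\<^sup>2 = (cmod a * norm x)\<^sup>2"
    unfolding cinner_self of_real_eq_iff .
  then show ?thesis
    by (simp add: power2_eq_iff_nonneg)
qed

lemma cinner_bound: "cmod (cinner x y) \<le> norm x * norm (y :: 'a :: chilbert_space)"
proof (cases "cinner x y = 0")
  case False
  define u where "u = cnj (cinner x y) / complex_of_real (cmod (cinner x y))"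
  have u: "cmod u = 1"
    using False by (simp add: u_def norm_divide)
  have "cinner x (u *\<^sub>C y) = complex_of_real (cmod (cinner x y))"
    using False
    by (simp add: u_def cinner_scaleC_right complex_norm_square[symmetric] power2_eq_square
        field_simps)
  then have "cmod (cinner x y) = inner x (u *\<^sub>C y)"
    by (simp add: inner_eq_Re_cinner)
  also have "\<dots> \<le> norm x * norm (u *\<^sub>C y)"
    by (rule norm_cauchy_schwarz)
  finally show ?thesis
    by (simp add: norm_scaleC u)
qed simp

instantiation complex :: chilbert_space
begin

definition scaleC_complex :: "complex \<Rightarrow> complex \<Rightarrow> complex"
  where "scaleC_complex a x = a * x"

definition cinner_complex :: "complex \<Rightarrow> complex \<Rightarrow> complex"
  where "cinner_complex x y = cnj x * y"

instance
  by standard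
    (simp_all add: scaleC_complex_def cinner_complex_def inner_complex_def algebra_simps
      scaleR_conv_of_real)

end


section \<open>Bounded operators\<close>

typedef (overloaded) ('a::chilbert_space, 'b::chilbert_space) cblinfun =
  "{f :: 'a \<Rightarrow> 'b. bounded_linear f \<and> (\<forall>c x. f (c *\<^sub>C x) = c *\<^sub>C f x)}"
  morphisms cblinfun_apply Cblinfun
  by (rule exI[of _ "\<lambda>_. 0"]) (simp add: complex_vector.scale_zero_right)

notation cblinfun_apply (infixr \<open>*\<^sub>V\<close> 70)

setup_lifting type_definition_cblinfun

lemma bounded_linear_scaleC: "bounded_linear (\<lambda>x :: 'a :: chilbert_space. c *\<^sub>C x)"
  by (rule bounded_linear_intro[where K = "cmod c"])
    (simp_all add: scaleC_add_right scaleR_scaleC scaleC_scaleC mult.commute norm_scaleC)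

instantiation cblinfun :: (chilbert_space, chilbert_space) complex_vector
begin

lift_definition zero_cblinfun :: "('a, 'b) cblinfun" is "\<lambda>_. 0"
  by (simp add: complex_vector.scale_zero_right)

lift_definition plus_cblinfun ::
  "('a, 'b) cblinfun \<Rightarrow> ('a, 'b) cblinfun \<Rightarrow> ('a, 'b) cblinfun" is "\<lambda>f g x. f x + g x"
  by (simp add: bounded_linear_add scaleC_add_right)

lift_definition uminus_cblinfun :: "('a, 'b) cblinfun \<Rightarrow> ('a, 'b) cblinfun" is "\<lambda>f x. - f x"
  by (simp add: bounded_linear_minus complex_vector.scale_minus_right)

lift_definition minus_cblinfun ::
  "('a, 'b) cblinfun \<Rightarrow> ('a, 'b) cblinfun \<Rightarrow> ('a, 'b) cblinfun" is "\<lambda>f g x. f x - g x"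
  by (simp add: bounded_linear_sub complex_vector.scale_right_diff_distrib)

lift_definition scaleC_cblinfun ::
  "complex \<Rightarrow> ('a, 'b) cblinfun \<Rightarrow> ('a, 'b) cblinfun" is "\<lambda>c f x. c *\<^sub>C f x"
  by (simp add: bounded_linear_compose[OF bounded_linear_scaleC] scaleC_scaleC mult.commute)

instance
  by standard
    (transfer; simp add: fun_eq_iff scaleC_add_right scaleC_add_left scaleC_scaleC scaleC_one)+

end

lift_definition cblinfun_compose ::
  "('b::chilbert_space, 'c::chilbert_space) cblinfun \<Rightarrow> ('a::chilbert_space, 'b) cblinfun
    \<Rightarrow> ('a, 'c) cblinfun"  (infixl \<open>o\<^sub>C\<^sub>L\<close> 67)
  is "\<lambda>f g x. f (g x)"
  by (simp add: bounded_linear_compose)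

definition adj ::
  "('a::chilbert_space, 'b::chilbert_space) cblinfun \<Rightarrow> ('b, 'a) cblinfun"
  where "adj T = (THE S. \<forall>x y. cinner (S *\<^sub>V y) x = cinner y (T *\<^sub>V x))"

definition nondegenerate :: "('a::chilbert_space, 'b::chilbert_space) cblinfun set \<Rightarrow> bool"
  where "nondegenerate X \<longleftrightarrow>
    closure (cspan {T *\<^sub>V h | T h. T \<in> X}) = UNIV \<and>
    closure (cspan {adj T *\<^sub>V k | T k. T \<in> X}) = UNIV"

text \<open>The operators between the closed subspaces \<open>S\<close> and \<open>T\<close>. An operator from \<open>S\<close> to \<open>T\<close> is
  identified with its extension by zero on the orthogonal complement of \<open>S\<close>; this respects
  norms, adjoints, products and the w*-topology.\<close>

definition ops_between ::
  "'a::chilbert_space set \<Rightarrow> 'b::chilbert_space set \<Rightarrow> ('a, 'b) cblinfun set"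
  where "ops_between S T =
    {A. range (cblinfun_apply A) \<subseteq> T \<and> (\<forall>x. (\<forall>y\<in>S. cinner y x = 0) \<longrightarrow> A *\<^sub>V x = 0)}"

definition unitary_between ::
  "'a::chilbert_space set \<Rightarrow> 'b::chilbert_space set \<Rightarrow> ('a, 'b) cblinfun \<Rightarrow> bool"
  where "unitary_between S T U \<longleftrightarrow>
    U \<in> ops_between S T \<and>
    (\<forall>x\<in>S. adj U *\<^sub>V (U *\<^sub>V x) = x) \<and> (\<forall>y\<in>T. U *\<^sub>V (adj U *\<^sub>V y) = y)"


section \<open>The w*-topology\<close>

text \<open>The predual of \<open>B(H,K)\<close> is the space of trace class operators from \<open>K\<close> to \<open>H\<close>. These are
  exactly the sums of the rank one operators \<open>k \<mapsto> cinner (y n) k *\<^sub>C x n\<close> for square summable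
  sequences \<open>x\<close> in \<open>H\<close> and \<open>y\<close> in \<open>K\<close>, and the trace pairing of such a sum with \<open>T\<close> is the
  series below.\<close>

definition normal_functionals ::
  "(('a::chilbert_space, 'b::chilbert_space) cblinfun \<Rightarrow> complex) set"
  where "normal_functionals =
    {(\<lambda>T. \<Sum>n. cinner (y n) (T *\<^sub>V x n)) | (x :: nat \<Rightarrow> 'a) (y :: nat \<Rightarrow> 'b).
      summable (\<lambda>n. (norm (x n))\<^sup>2) \<and> summable (\<lambda>n. (norm (y n))\<^sup>2)}"

definition weak_star :: "('a::chilbert_space, 'b::chilbert_space) cblinfun topology"
  where "weak_star =
    topology_generated_by {\<omega> -` G | \<omega> G. \<omega> \<in> normal_functionals \<and> open G}"

definition wspan ::
  "('a::chilbert_space, 'b::chilbert_space) cblinfun set \<Rightarrow> ('a, 'b) cblinfun set"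
  where "wspan S = weak_star closure_of cspan S"


section \<open>TRO-equivalence\<close>

definition TRO :: "('a::chilbert_space, 'b::chilbert_space) cblinfun set \<Rightarrow> bool"
  where "TRO M \<longleftrightarrow>
    csubspace M \<and> (\<forall>a\<in>M. \<forall>b\<in>M. \<forall>c\<in>M. a o\<^sub>C\<^sub>L adj b o\<^sub>C\<^sub>L c \<in> M)"

definition TRO_equivalent ::
  "('h1::chilbert_space, 'h2::chilbert_space) cblinfun set
    \<Rightarrow> ('k1::chilbert_space, 'k2::chilbert_space) cblinfun set \<Rightarrow> bool"
  where "TRO_equivalent X Y \<longleftrightarrow>
    (\<exists>(M1 :: ('h1, 'k1) cblinfun set) (M2 :: ('h2, 'k2) cblinfun set).
      TRO M1 \<and> TRO M2 \<and>
      Y = wspan {m2 o\<^sub>C\<^sub>L x o\<^sub>C\<^sub>L adj m1 | m2 x m1. m2 \<in> M2 \<and> x \<in> X \<and> m1 \<in> M1} \<and>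
      X = wspan {adj m2 o\<^sub>C\<^sub>L y o\<^sub>C\<^sub>L m1 | m2 y m1. m2 \<in> M2 \<and> y \<in> Y \<and> m1 \<in> M1})"


section \<open>The Hilbert space of square summable families\<close>

typedef (overloaded) ('j, 'a::chilbert_space) ell2 =
  "{f :: 'j \<Rightarrow> 'a. (\<lambda>j. (norm (f j))\<^sup>2) summable_on UNIV}"
  morphisms ell2_nth Abs_ell2
  by (rule exI[of _ "\<lambda>_. 0"]) simp

setup_lifting type_definition_ell2

lemma ell2_add_aux:
  fixes f g :: "'j \<Rightarrow> 'a::chilbert_space"
  assumes "(\<lambda>j. (norm (f j))\<^sup>2) summable_on UNIV" "(\<lambda>j. (norm (g j))\<^sup>2) summable_on UNIV"
  shows "(\<lambda>j. (norm (f j + g j))\<^sup>2) summable_on UNIV"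
proof (rule summable_on_comparison_test)
  show "(\<lambda>j. 2 * (norm (f j))\<^sup>2 + 2 * (norm (g j))\<^sup>2) summable_on UNIV"
    by (intro summable_on_add summable_on_cmult_right assms)
  fix j
  have "(norm (f j + g j))\<^sup>2 \<le> (norm (f j) + norm (g j))\<^sup>2"
    by (intro power_mono norm_triangle_ineq norm_ge_zero)
  also have "\<dots> \<le> 2 * (norm (f j))\<^sup>2 + 2 * (norm (g j))\<^sup>2"
    using sum_squares_bound[of "norm (f j)" "norm (g j)"] by (simp add: power2_sum)
  finally show "(norm (f j + g j))\<^sup>2 \<le> 2 * (norm (f j))\<^sup>2 + 2 * (norm (g j))\<^sup>2" .
qed simp

lemma ell2_scale_aux:
  fixes f :: "'j \<Rightarrow> 'a::chilbert_space"
  assumes "(\<lambda>j. (norm (f j))\<^sup>2) summable_on UNIV"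
  shows "(\<lambda>j. (norm (c *\<^sub>C f j))\<^sup>2) summable_on UNIV"
  using assms by (simp add: norm_scaleC power_mult_distrib summable_on_cmult_right)

lemma ell2_cinner_aux:
  fixes f g :: "'j \<Rightarrow> 'a::chilbert_space"
  assumes "(\<lambda>j. (norm (f j))\<^sup>2) summable_on UNIV" "(\<lambda>j. (norm (g j))\<^sup>2) summable_on UNIV"
  shows "(\<lambda>j. cinner (f j) (g j)) summable_on UNIV"
proof -
  have "(\<lambda>j. norm (cinner (f j) (g j))) summable_on UNIV"
  proof (rule summable_on_comparison_test)
    show "(\<lambda>j. (norm (f j))\<^sup>2 + (norm (g j))\<^sup>2) summable_on UNIV"
      by (intro summable_on_add assms)
    fix j
    show "norm (cinner (f j) (g j)) \<le> (norm (f j))\<^sup>2 + (norm (g j))\<^sup>2"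
      using cinner_bound[of "f j" "g j"] sum_squares_bound[of "norm (f j)" "norm (g j)"]
        mult_nonneg_nonneg[OF norm_ge_zero[of "f j"] norm_ge_zero[of "g j"]]
      by linarith
  qed simp
  then show ?thesis
    by (rule abs_summable_summable)
qed

instantiation ell2 :: (type, chilbert_space) complex_vector
begin

lift_definition zero_ell2 :: "('a, 'b) ell2" is "\<lambda>_. 0"
  by simp

lift_definition plus_ell2 :: "('a, 'b) ell2 \<Rightarrow> ('a, 'b) ell2 \<Rightarrow> ('a, 'b) ell2"
  is "\<lambda>f g j. f j + g j"
  by (simp add: ell2_add_aux)

lift_definition uminus_ell2 :: "('a, 'b) ell2 \<Rightarrow> ('a, 'b) ell2" is "\<lambda>f j. - f j"
  by simp

lift_definition minus_ell2 :: "('a, 'b) ell2 \<Rightarrow> ('a, 'b) ell2 \<Rightarrow> ('a, 'b) ell2"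
  is "\<lambda>f g j. f j - g j"
  subgoal for f g using ell2_add_aux[of f "\<lambda>j. - g j"] by simp
  done

lift_definition scaleC_ell2 :: "complex \<Rightarrow> ('a, 'b) ell2 \<Rightarrow> ('a, 'b) ell2"
  is "\<lambda>c f j. c *\<^sub>C f j"
  by (simp add: ell2_scale_aux)

instance
  by standard
    (transfer; simp add: fun_eq_iff scaleC_add_right scaleC_add_left scaleC_scaleC scaleC_one)+

end

lemma ell2_nth_simps:
  "ell2_nth 0 j = 0"
  "ell2_nth (f + g) j = ell2_nth f j + ell2_nth g j"
  "ell2_nth (f - g) j = ell2_nth f j - ell2_nth g j"
  "ell2_nth (- f) j = - ell2_nth f j"
  "ell2_nth (c *\<^sub>C f) j = c *\<^sub>C ell2_nth f j"
  by (transfer; simp)+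

lemma ell2_nth_summable: "(\<lambda>j. (norm (ell2_nth f j))\<^sup>2) summable_on UNIV"
  using ell2_nth[of f] by simp

lemma ell2_eqI: "(\<And>j. ell2_nth f j = ell2_nth g j) \<Longrightarrow> f = g"
  by (metis ell2_nth_inject ext)

instantiation ell2 :: (type, chilbert_space) real_inner
begin

definition scaleR_ell2 :: "real \<Rightarrow> ('a, 'b) ell2 \<Rightarrow> ('a, 'b) ell2"
  where "scaleR_ell2 r f = complex_of_real r *\<^sub>C f"

definition inner_ell2 :: "('a, 'b) ell2 \<Rightarrow> ('a, 'b) ell2 \<Rightarrow> real"
  where "inner_ell2 f g = (\<Sum>\<^sub>\<infinity>j. inner (ell2_nth f j) (ell2_nth g j))"

definition norm_ell2 :: "('a, 'b) ell2 \<Rightarrow> real"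
  where "norm_ell2 f = sqrt (inner f f)"

definition sgn_ell2 :: "('a, 'b) ell2 \<Rightarrow> ('a, 'b) ell2"
  where "sgn_ell2 f = inverse (norm f) *\<^sub>R f"

definition dist_ell2 :: "('a, 'b) ell2 \<Rightarrow> ('a, 'b) ell2 \<Rightarrow> real"
  where "dist_ell2 f g = norm (f - g)"

definition uniformity_ell2 :: "(('a, 'b) ell2 \<times> ('a, 'b) ell2) filter"
  where "uniformity_ell2 = (INF e\<in>{0<..}. principal {(f, g). dist f g < e})"

definition open_ell2 :: "('a, 'b) ell2 set \<Rightarrow> bool"
  where "open_ell2 U \<longleftrightarrow> (\<forall>f\<in>U. \<forall>\<^sub>F (f', g) in uniformity. f' = f \<longrightarrow> g \<in> U)"

lemma ell2_inner_summable:
  fixes f g :: "('a, 'b) ell2"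
  shows "(\<lambda>j. inner (ell2_nth f j) (ell2_nth g j)) summable_on UNIV"
  using summable_on_Re[OF ell2_cinner_aux[OF ell2_nth_summable ell2_nth_summable]]
  by (simp add: inner_eq_Re_cinner)

instance
proof
  fix r s :: real and f g h :: "('a, 'b) ell2"
  show "r *\<^sub>R (f + g) = r *\<^sub>R f + r *\<^sub>R g" "(r + s) *\<^sub>R f = r *\<^sub>R f + s *\<^sub>R f"
    "r *\<^sub>R s *\<^sub>R f = (r * s) *\<^sub>R f" "1 *\<^sub>R f = f"
    by (simp_all add: scaleR_ell2_def scaleC_add_right scaleC_add_left scaleC_scaleC scaleC_one)
  show "inner f g = inner g f"
    by (simp add: inner_ell2_def inner_commute)
  show "inner (f + g) h = inner f h + inner g h"
    by (simp add: inner_ell2_def ell2_nth_simps inner_add_left infsum_add ell2_inner_summable)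
  show "inner (r *\<^sub>R f) g = r * inner f g"
    by (simp add: inner_ell2_def ell2_nth_simps scaleR_ell2_def infsum_cmult_right'
        flip: scaleR_scaleC)
  show "0 \<le> inner f f"
    by (simp add: inner_ell2_def infsum_nonneg)
  show "inner f f = 0 \<longleftrightarrow> f = 0"
  proof
    assume f: "inner f f = 0"
    have "inner (ell2_nth f j) (ell2_nth f j) = 0" for j
      by (rule nonneg_infsum_le_0D[OF _ ell2_inner_summable])
        (use f in \<open>simp_all add: inner_ell2_def\<close>)
    then show "f = 0"
      by (intro ell2_eqI) (simp add: ell2_nth_simps)
  qed (simp add: inner_ell2_def ell2_nth_simps)
qed (simp_all add: norm_ell2_def sgn_ell2_def dist_ell2_def uniformity_ell2_def open_ell2_def)

end

lemma ell2_norm_power2: "(norm f)\<^sup>2 = (\<Sum>\<^sub>\<infinity>j. (norm (ell2_nth f j))\<^sup>2)"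
  by (simp add: power2_norm_eq_inner inner_ell2_def)

lemma ell2_sum_le: "finite S \<Longrightarrow> (\<Sum>j\<in>S. (norm (ell2_nth f j))\<^sup>2) \<le> (norm f)\<^sup>2"
  unfolding ell2_norm_power2
  by (rule finite_sum_le_infsum[OF ell2_nth_summable]) auto

lemma ell2_nth_norm_le: "norm (ell2_nth f j) \<le> norm f"
  using ell2_sum_le[of "{j}" f] by (simp add: power2_le_iff_abs_le)

instantiation ell2 :: (type, chilbert_space) chilbert_space
begin

definition cinner_ell2 :: "('a, 'b) ell2 \<Rightarrow> ('a, 'b) ell2 \<Rightarrow> complex"
  where "cinner_ell2 f g = (\<Sum>\<^sub>\<infinity>j. cinner (ell2_nth f j) (ell2_nth g j))"

lemma ell2_cinner_summable:
  fixes f g :: "('a, 'b) ell2"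
  shows "(\<lambda>j. cinner (ell2_nth f j) (ell2_nth g j)) summable_on UNIV"
  by (rule ell2_cinner_aux[OF ell2_nth_summable ell2_nth_summable])

instance
proof
  fix r :: real and a :: complex and f g h :: "('a, 'b) ell2"
  show "r *\<^sub>R f = complex_of_real r *\<^sub>C f"
    by (simp add: scaleR_ell2_def)
  show "cinner f g = cnj (cinner g f)"
    unfolding cinner_ell2_def infsum_cnj[symmetric]
    by (rule infsum_cong) (rule cinner_commute)
  show "cinner f (g + h) = cinner f g + cinner f h"
    by (simp add: cinner_ell2_def ell2_nth_simps cinner_add_right infsum_add
        ell2_cinner_summable)
  show "cinner f (a *\<^sub>C g) = a * cinner f g"
    by (simp add: cinner_ell2_def ell2_nth_simps cinner_scaleC_right infsum_cmult_right')
  show "inner f g = Re (cinner f g)"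
    by (simp add: cinner_ell2_def inner_ell2_def inner_eq_Re_cinner infsum_Re
        ell2_cinner_summable)
next
  fix F :: "nat \<Rightarrow> ('a, 'b) ell2"
  assume F: "Cauchy F"
  have "Cauchy (\<lambda>n. ell2_nth (F n) j)" for j
  proof (rule metric_CauchyI)
    fix e :: real
    assume "0 < e"
    then obtain N where N: "\<And>m n. m \<ge> N \<Longrightarrow> n \<ge> N \<Longrightarrow> dist (F m) (F n) < e"
      using metric_CauchyD[OF F] by blast
    have "dist (ell2_nth (F m) j) (ell2_nth (F n) j) \<le> dist (F m) (F n)" for m n
      using ell2_nth_norm_le[of "F m - F n" j] by (simp add: dist_norm ell2_nth_simps)
    with N show "\<exists>N. \<forall>m\<ge>N. \<forall>n\<ge>N. dist (ell2_nth (F m) j) (ell2_nth (F n) j) < e"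
      by (meson le_less_trans)
  qed
  then have "\<exists>l. (\<lambda>n. ell2_nth (F n) j) \<longlonglongrightarrow> l" for j
    using Cauchy_convergent convergent_def by blast
  then obtain L where L: "\<And>j. (\<lambda>n. ell2_nth (F n) j) \<longlonglongrightarrow> L j"
    by metis
  have bound: "\<exists>N. \<forall>n\<ge>N. \<forall>S. finite S \<longrightarrow> (\<Sum>j\<in>S. (norm (ell2_nth (F n) j - L j))\<^sup>2) \<le> e\<^sup>2"
    if e: "0 < e" for e
  proof -
    obtain N where N: "\<And>m n. m \<ge> N \<Longrightarrow> n \<ge> N \<Longrightarrow> dist (F m) (F n) < e"
      using metric_CauchyD[OF F e] by blast
    have "(\<Sum>j\<in>S. (norm (ell2_nth (F n) j - L j))\<^sup>2) \<le> e\<^sup>2" if "n \<ge> N" "finite S" for n S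
    proof (rule LIMSEQ_le_const2)
      show "(\<lambda>m. \<Sum>j\<in>S. (norm (ell2_nth (F n) j - ell2_nth (F m) j))\<^sup>2)
        \<longlonglongrightarrow> (\<Sum>j\<in>S. (norm (ell2_nth (F n) j - L j))\<^sup>2)"
        by (intro tendsto_intros L)
      have "(\<Sum>j\<in>S. (norm (ell2_nth (F n) j - ell2_nth (F m) j))\<^sup>2) \<le> e\<^sup>2" if "m \<ge> N" for m
      proof -
        have "(\<Sum>j\<in>S. (norm (ell2_nth (F n) j - ell2_nth (F m) j))\<^sup>2) \<le> (norm (F n - F m))\<^sup>2"
          using ell2_sum_le[OF \<open>finite S\<close>, of "F n - F m"] by (simp add: ell2_nth_simps)
        also have "\<dots> \<le> e\<^sup>2"
          using N[OF \<open>n \<ge> N\<close> \<open>m \<ge> N\<close>] by (intro power_mono) (auto simp: dist_norm)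
        finally show ?thesis .
      qed
      then show "\<exists>N. \<forall>m\<ge>N. (\<Sum>j\<in>S. (norm (ell2_nth (F n) j - ell2_nth (F m) j))\<^sup>2) \<le> e\<^sup>2"
        by blast
    qed
    then show ?thesis by blast
  qed
  have diff: "(\<lambda>j. (norm (ell2_nth (F n) j - L j))\<^sup>2) summable_on UNIV"
    if "\<And>S. finite S \<Longrightarrow> (\<Sum>j\<in>S. (norm (ell2_nth (F n) j - L j))\<^sup>2) \<le> B" for n B
    by (rule nonneg_bdd_above_summable_on) (use that in \<open>auto intro!: bdd_aboveI[where M = B]\<close>)
  obtain N where N: "\<And>S. finite S \<Longrightarrow> (\<Sum>j\<in>S. (norm (ell2_nth (F N) j - L j))\<^sup>2) \<le> 1\<^sup>2"
    using bound[of 1] by auto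
  have "(\<lambda>j. (norm (ell2_nth (F N) j + - (ell2_nth (F N) j - L j)))\<^sup>2) summable_on UNIV"
  proof (rule ell2_add_aux[OF ell2_nth_summable])
    show "(\<lambda>j. (norm (- (ell2_nth (F N) j - L j)))\<^sup>2) summable_on UNIV"
      using diff[OF N] by (simp only: norm_minus_cancel)
  qed
  then have "(\<lambda>j. (norm (L j))\<^sup>2) summable_on UNIV"
    by simp
  then have Lnth: "ell2_nth (Abs_ell2 L) = L"
    by (simp add: Abs_ell2_inverse)
  have "F \<longlonglongrightarrow> Abs_ell2 L"
  proof (rule metric_LIMSEQ_I)
    fix e :: real
    assume "0 < e"
    then obtain N where
      N: "\<And>n S. n \<ge> N \<Longrightarrow> finite S \<Longrightarrow> (\<Sum>j\<in>S. (norm (ell2_nth (F n) j - L j))\<^sup>2) \<le> (e / 2)\<^sup>2"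
      using bound[of "e / 2"] by auto
    have "dist (F n) (Abs_ell2 L) < e" if "n \<ge> N" for n
    proof -
      have "(norm (F n - Abs_ell2 L))\<^sup>2 = (\<Sum>\<^sub>\<infinity>j. (norm (ell2_nth (F n) j - L j))\<^sup>2)"
        by (simp add: ell2_norm_power2 ell2_nth_simps Lnth)
      also have "\<dots> \<le> (e / 2)\<^sup>2"
        by (rule infsum_le_finite_sums[OF diff[OF N[OF that]] N[OF that]])
      finally have "norm (F n - Abs_ell2 L) \<le> e / 2"
        using \<open>0 < e\<close> by (simp add: power2_le_iff_abs_le)
      then show ?thesis
        using \<open>0 < e\<close> by (simp add: dist_norm)
    qed
    then show "\<exists>N. \<forall>n\<ge>N. dist (F n) (Abs_ell2 L) < e"
      by blast
  qed
  then show "convergent F"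
    by (rule convergentI)
qed

end


section \<open>Tensor products with matrix algebras\<close>

text \<open>\<open>H \<otimes> \<ell>\<^sup>2\<^sub>J\<close> is modelled by the square summable families in \<open>H\<close> indexed by \<open>J\<close>, with
  \<open>h \<otimes> \<eta>\<close> the family of the \<open>\<eta>\<^sub>j h\<close>. The index set \<open>J\<close> is a subset of a type, and families over
  \<open>J\<close> are families over the whole type that vanish outside \<open>J\<close>. For \<open>H = \<complex>\<close> this is
  \<open>\<ell>\<^sup>2\<^sub>J\<close> itself.\<close>

definition ell2_on :: "'j set \<Rightarrow> ('j, 'a::chilbert_space) ell2 set"
  where "ell2_on J = {\<xi>. \<forall>j. j \<notin> J \<longrightarrow> ell2_nth \<xi> j = 0}"

lift_definition tensor_vec :: "'a::chilbert_space \<Rightarrow> ('j, complex) ell2 \<Rightarrow> ('j, 'a) ell2"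
  is "\<lambda>h \<eta> j. \<eta> j *\<^sub>C h"
  by (simp add: norm_scaleC power_mult_distrib summable_on_cmult_left)

definition tensor_op ::
  "('a::chilbert_space, 'b::chilbert_space) cblinfun
    \<Rightarrow> (('j, complex) ell2, ('j, complex) ell2) cblinfun
    \<Rightarrow> (('j, 'a) ell2, ('j, 'b) ell2) cblinfun"
  where "tensor_op x a =
    (THE T. \<forall>h \<eta>. T *\<^sub>V tensor_vec h \<eta> = tensor_vec (x *\<^sub>V h) (a *\<^sub>V \<eta>))"

definition matrix_ops :: "'j set \<Rightarrow> (('j, complex) ell2, ('j, complex) ell2) cblinfun set"
  where "matrix_ops J = ops_between (ell2_on J) (ell2_on J)"

definition tensor_M ::
  "('a::chilbert_space, 'b::chilbert_space) cblinfun set \<Rightarrow> 'j set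
    \<Rightarrow> (('j, 'a) ell2, ('j, 'b) ell2) cblinfun set"
  where "tensor_M X J = wspan {tensor_op x a | x a. x \<in> X \<and> a \<in> matrix_ops J}"


section \<open>Stable isomorphism\<close>

text \<open>The norm of an \<open>n\<close> by \<open>n\<close> matrix of operators from \<open>H\<close> to \<open>K\<close>, as an operator from the
  \<open>n\<close>-fold direct sum of \<open>H\<close> to that of \<open>K\<close>.\<close>

definition mat_norm ::
  "nat \<Rightarrow> (nat \<Rightarrow> nat \<Rightarrow> ('a::chilbert_space, 'b::chilbert_space) cblinfun) \<Rightarrow> real"
  where "mat_norm n A =
    Sup {sqrt (\<Sum>i<n. (norm (\<Sum>j<n. A i j *\<^sub>V v j))\<^sup>2) | v. (\<Sum>j<n. (norm (v j))\<^sup>2) \<le> 1}"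

definition completely_isometric_on ::
  "('a::chilbert_space, 'b::chilbert_space) cblinfun set
    \<Rightarrow> (('a, 'b) cblinfun \<Rightarrow> ('c::chilbert_space, 'd::chilbert_space) cblinfun) \<Rightarrow> bool"
  where "completely_isometric_on V \<phi> \<longleftrightarrow>
    (\<forall>n A. (\<forall>i<n. \<forall>j<n. A i j \<in> V) \<longrightarrow> mat_norm n (\<lambda>i j. \<phi> (A i j)) = mat_norm n A)"

definition dual_operator_space_iso ::
  "('a::chilbert_space, 'b::chilbert_space) cblinfun set
    \<Rightarrow> ('c::chilbert_space, 'd::chilbert_space) cblinfun set
    \<Rightarrow> (('a, 'b) cblinfun \<Rightarrow> ('c, 'd) cblinfun) \<Rightarrow> bool"
  where "dual_operator_space_iso V W \<phi> \<longleftrightarrow>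
    (\<forall>x\<in>V. \<forall>y\<in>V. \<phi> (x + y) = \<phi> x + \<phi> y) \<and>
    (\<forall>c. \<forall>x\<in>V. \<phi> (c *\<^sub>C x) = c *\<^sub>C \<phi> x) \<and>
    completely_isometric_on V \<phi> \<and>
    homeomorphic_map (subtopology weak_star V) (subtopology weak_star W) \<phi>"

text \<open>HOL cannot quantify over all cardinals inside a formula, so the cardinals \<open>J\<close> are
  represented by the subsets of an infinite type into which all four Hilbert spaces embed.
  Existence of such a \<open>J\<close> is at least as strong as existence of an arbitrary cardinal. The
  empty index set is excluded: it would make every tensor product with \<open>M\<^sub>J\<close> zero.\<close>

type_synonym ('h1, 'h2, 'k1, 'k2) index = "'h1 + 'h2 + 'k1 + 'k2 + nat"

definition stably_isomorphic ::
  "('h1::chilbert_space, 'h2::chilbert_space) cblinfun set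
    \<Rightarrow> ('k1::chilbert_space, 'k2::chilbert_space) cblinfun set \<Rightarrow> bool"
  where "stably_isomorphic X Y \<longleftrightarrow>
    (\<exists>J :: ('h1, 'h2, 'k1, 'k2) index set. J \<noteq> {} \<and>
      (\<exists>\<phi>. dual_operator_space_iso (tensor_M X J) (tensor_M Y J) \<phi>))"

end

(*
  The entries of operators on amplifications H (x) l2(J) behave like matrices: z lies in the tensor
  product of X with M_J iff all its entries lie in X. It therefore suffices to find unitaries U_i all of
  whose entries lie in the w*-closure N_i of the TRO M_i.

  Let N be such a closure. Nondegeneracy and Zorn's lemma give families (a_i), (b_i) in N and N* with
  sum a_i* a_i = 1 and sum b_i* b_i = 1; they are the entries of isometries V and C between the
  amplifications, where V preserves and C raises a grading of J. The grading forces T = (C* + V) / 2 to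
  be injective with dense range, so that its polar part is unitary. That polar part is the strong limit
  of the iteration a |-> (3 a - a a* a) / 2, which stays inside the operators with entries in N.
*)
theory Submission
  imports Defs
begin

text \<open>A w*-closed TRO need not contain a unitary, and partitions of unity only yield
  isometries, one in each direction. Comparing projections in the style of Schroeder and Bernstein
  would need a linking algebra and its projections. Here the grading takes over that role: a kernel
  vector of \<open>V + adj C\<close> would be reproduced by a map that strictly shifts the degree,
  which is impossible because degrees are bounded below. The tools are restricted to what the
  ternary structure offers: linear combinations, w*-limits and triple products. An absolute value or
  a square root lives outside N, whereas the cubic iteration is built from the triple product alone.
  Its convergence rests on one fact, the positivity of products of commuting positive operators,
  which is used in place of a functional calculus. Operator products are treated as w*-continuous in
  each factor separately, so every passage to a closure is made one factor at a time.\<close>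

instance chilbert_space \<subseteq> banach ..

section \<open>Sesquilinearity of the inner product\<close>

lemma cinner_add_left: "cinner (x + y) z = cinner x z + cinner y (z :: 'a :: chilbert_space)"
  by (simp add: cinner_commute[of _ z] cinner_add_right)

lemma cinner_scaleC_left: "cinner (a *\<^sub>C x) y = cnj a * cinner x (y :: 'a :: chilbert_space)"
  by (simp add: cinner_commute[of _ y] cinner_scaleC_right)

lemma cinner_zero [simp]: "cinner x 0 = 0" "cinner 0 (x :: 'a :: chilbert_space) = 0"
  using cinner_add_right[of x 0 0] cinner_add_left[of 0 0 x] by simp_all

lemma cinner_minus:
  "cinner x (- y) = - cinner x y" "cinner (- x) y = - cinner x (y :: 'a :: chilbert_space)"
  using cinner_add_right[of x y "-y"] cinner_add_left[of x "-x" y]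
  by (simp_all add: add_eq_0_iff)

lemma cinner_diff:
  "cinner x (y - z) = cinner x y - cinner x z"
  "cinner (x - y) z = cinner x z - cinner y (z :: 'a :: chilbert_space)"
  using cinner_add_right[of x y "-z"] cinner_add_left[of x "-y" z] by (simp_all add: cinner_minus)

lemma cinner_eqI: "(\<And>z. cinner x z = cinner y z) \<Longrightarrow> x = (y :: 'a :: chilbert_space)"
  using cinner_diff(2)[of x y "x - y"] by (simp add: cinner_self)

lemma cinner_self_Re: "Re (cinner x x) = (norm (x :: 'a :: chilbert_space))\<^sup>2"
  by (simp add: cinner_self)

lemma bounded_linear_cinner_right: "bounded_linear (cinner (x :: 'a :: chilbert_space))"
proof (rule bounded_linear_intro[where K = "norm x"])
  fix y
  show "norm (cinner x y) \<le> norm y * norm x"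
    using cinner_bound[of x y] by (simp only: mult.commute)
qed (simp_all add: cinner_add_right scaleR_scaleC cinner_scaleC_right scaleC_complex_def)

lemma cinner_swap_Im: "Im (cinner x y) = - Re (cinner x (\<i> *\<^sub>C (y :: 'a :: chilbert_space)))"
  by (simp add: cinner_scaleC_right)

lemma cinner_sum_right:
  "cinner x (\<Sum>i\<in>F. f i) = (\<Sum>i\<in>F. cinner x (f i :: 'a :: chilbert_space))"
  by (induction F rule: infinite_finite_induct) (simp_all add: cinner_add_right)

section \<open>Adjoints\<close>

text \<open>The representing vector is the minimiser of |x|^2 - 2 f x. The parallelogram law makes a
  minimising sequence Cauchy, and completeness supplies the limit.\<close>

lemma riesz_real:
  fixes f :: "'a :: {real_inner, complete_space} \<Rightarrow> real"
  assumes "bounded_linear f"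
  obtains y where "\<And>x. f x = inner y x"
proof -
  interpret f: bounded_linear f by fact
  obtain K where K: "\<And>x. norm (f x) \<le> norm x * K"
    using f.bounded by blast
  define g where "g x = inner x x - 2 * f x" for x
  have lower: "- K\<^sup>2 \<le> g x" for x
  proof -
    have "0 \<le> (norm x - K)\<^sup>2" by simp
    then show ?thesis
      using K[of x] unfolding g_def power2_norm_eq_inner[symmetric]
      by (simp add: power2_diff abs_le_iff algebra_simps)
  qed
  define d where "d = Inf (range g)"
  have bdd: "bdd_below (range g)"
    using lower by (auto intro!: bdd_belowI[where m = "- K\<^sup>2"])
  have d_le: "d \<le> g x" for x
    unfolding d_def by (rule cInf_lower[OF _ bdd]) simp
  have par: "(norm (x - y))\<^sup>2 \<le> 2 * g x + 2 * g y - 4 * d" for x y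
  proof -
    have "(norm (x - y))\<^sup>2 = 2 * g x + 2 * g y - 4 * g ((1 / 2) *\<^sub>R (x + y))"
      unfolding g_def power2_norm_eq_inner
      by (simp add: f.add f.scaleR inner_simps inner_commute algebra_simps)
    then show ?thesis using d_le[of "(1 / 2) *\<^sub>R (x + y)"] by linarith
  qed
  have "\<exists>x. g x < d + 1 / real (Suc n)" for n
  proof -
    have "Inf (range g) < d + 1 / real (Suc n)" by (simp add: d_def)
    then show ?thesis using cInf_less_iff[OF _ bdd] by auto
  qed
  then obtain X where X: "\<And>n. g (X n) < d + 1 / real (Suc n)"
    by metis
  have "Cauchy X"
  proof (rule metric_CauchyI)
    fix e :: real assume e: "0 < e"
    obtain N where N: "inverse (real (Suc N)) < e\<^sup>2 / 4"
      using reals_Archimedean[of "e\<^sup>2 / 4"] e by auto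
    have "dist (X m) (X n) < e" if "m \<ge> N" "n \<ge> N" for m n
    proof -
      have le: "1 / real (Suc k) \<le> inverse (real (Suc N))" if "k \<ge> N" for k
        using that by (simp add: field_simps)
      have "(norm (X m - X n))\<^sup>2 < e\<^sup>2"
        using par[of "X m" "X n"] X[of m] X[of n] le[OF that(1)] le[OF that(2)] N by linarith
      then show ?thesis
        using e by (simp add: dist_norm power2_less_imp_less)
    qed
    then show "\<exists>N. \<forall>m\<ge>N. \<forall>n\<ge>N. dist (X m) (X n) < e" by blast
  qed
  then obtain y where y: "X \<longlonglongrightarrow> y"
    using Cauchy_convergent convergent_def by blast
  have "(\<lambda>n. g (X n)) \<longlonglongrightarrow> g y"
    unfolding g_def by (intro tendsto_intros f.tendsto y)
  moreover have "(\<lambda>n. d + 1 / real (Suc n)) \<longlonglongrightarrow> d + 0"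
    by (intro tendsto_intros LIMSEQ_Suc[OF lim_1_over_n])
  ultimately have gy: "g y \<le> d"
    using LIMSEQ_le[of "\<lambda>n. g (X n)" "g y" "\<lambda>n. d + 1 / real (Suc n)" "d + 0"] X
    by (auto intro: less_imp_le)
  have "f x = inner y x" for x
  proof (rule ccontr)
    assume ne: "f x \<noteq> inner y x"
    define c where "c = inner y x - f x"
    have c: "c \<noteq> 0" using ne by (simp add: c_def)
    have "x \<noteq> 0" using ne by (auto simp: f.zero)
    then have x: "inner x x > 0" by simp
    \<comment> \<open>The minimiser of the quadratic polynomial t |-> g (y + t x), whose minimum
      lies strictly below g y when c is nonzero.\<close>
    define t where "t = - c / inner x x"
    have "g (y + t *\<^sub>R x) = g y + 2 * t * c + t * t * inner x x"
      unfolding g_def c_def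
      by (simp add: f.add f.scaleR inner_simps inner_commute algebra_simps)
    also have "\<dots> = g y - c\<^sup>2 / inner x x"
      unfolding t_def using x by (simp add: field_simps power2_eq_square)
    also have "\<dots> < g y" using c x by simp
    finally show False using d_le[of "y + t *\<^sub>R x"] gy by linarith
  qed
  then show thesis by (rule that)
qed

section \<open>Elementary calculus of bounded operators\<close>

lemma cblinfun_eqI: "(\<And>x. S *\<^sub>V x = T *\<^sub>V x) \<Longrightarrow> S = T"
  by (simp add: cblinfun_apply_inject[symmetric] ext)

lemma bounded_linear_cblinfun_apply: "bounded_linear (cblinfun_apply T)"
  using cblinfun_apply[of T] by simp

lemma cblinfun_apply_scaleC [simp]: "T *\<^sub>V (c *\<^sub>C x) = c *\<^sub>C (T *\<^sub>V x)"
  using cblinfun_apply[of T] by simp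

lemma cblinfun_apply_linear [simp]:
  "T *\<^sub>V (x + y) = T *\<^sub>V x + T *\<^sub>V y"
  "T *\<^sub>V (x - y) = T *\<^sub>V x - T *\<^sub>V y"
  "T *\<^sub>V (- x) = - (T *\<^sub>V x)"
  "T *\<^sub>V 0 = 0"
  "T *\<^sub>V (r *\<^sub>R x) = r *\<^sub>R (T *\<^sub>V x)"
  using bounded_linear_cblinfun_apply[of T]
  by (simp_all add: linear_simps)

lemma cblinfun_op_apply [simp]:
  "(S + T) *\<^sub>V x = S *\<^sub>V x + T *\<^sub>V x"
  "(S - T) *\<^sub>V x = S *\<^sub>V x - T *\<^sub>V x"
  "(- S) *\<^sub>V x = - (S *\<^sub>V x)"
  "0 *\<^sub>V x = 0"
  "(c *\<^sub>C S) *\<^sub>V x = c *\<^sub>C (S *\<^sub>V x)"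
  "(A o\<^sub>C\<^sub>L B) *\<^sub>V y = A *\<^sub>V (B *\<^sub>V y)"
  by (transfer; simp)+

lemma cblinfun_sum_apply [simp]: "(\<Sum>i\<in>F. S i) *\<^sub>V x = (\<Sum>i\<in>F. S i *\<^sub>V x)"
  by (induction F rule: infinite_finite_induct) auto

lemma cblinfun_apply_sum: "T *\<^sub>V (\<Sum>i\<in>F. f i) = (\<Sum>i\<in>F. T *\<^sub>V f i)"
  by (induction F rule: infinite_finite_induct) auto

lemma cblinfun_bound:
  fixes T :: "('a::chilbert_space, 'b::chilbert_space) cblinfun"
  obtains c where "0 < c" "\<And>x. norm (T *\<^sub>V x) \<le> c * norm x"
  using bounded_linear.pos_bounded[OF bounded_linear_cblinfun_apply[of T]]
  by (metis mult.commute)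

lemma compose_assoc: "(A o\<^sub>C\<^sub>L B) o\<^sub>C\<^sub>L C = A o\<^sub>C\<^sub>L (B o\<^sub>C\<^sub>L C)"
  by (rule cblinfun_eqI) simp

lemma Cblinfun_apply:
  assumes "\<And>x y. f (x + y) = f x + f y" "\<And>c x. f (c *\<^sub>C x) = c *\<^sub>C f x"
    and "\<And>x. norm (f x) \<le> norm x * K"
  shows "Cblinfun f *\<^sub>V x = f x"
proof -
  have "bounded_linear f"
    by (rule bounded_linear_intro[where K = K]) (simp_all add: assms scaleR_scaleC)
  then show ?thesis using assms(2) by (simp add: Cblinfun_inverse)
qed

text \<open>The Riesz theorem above is real and only matches real parts; applying it to \<i> x as
  well matches the imaginary parts. Linearity over the complex numbers then follows from uniqueness
  of the representing vectors.\<close>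

lemma adjoint_exists: "\<exists>S. \<forall>x y. cinner (S *\<^sub>V y) x = cinner y (T *\<^sub>V x)"
proof -
  obtain c where c: "0 < c" "\<And>x. norm (T *\<^sub>V x) \<le> c * norm x"
    using cblinfun_bound[of T] by metis
  have "\<exists>z. \<forall>x. inner y (T *\<^sub>V x) = inner z x" for y
    using riesz_real[OF bounded_linear_compose[OF bounded_linear_inner_right
          bounded_linear_cblinfun_apply[of T]], of y] by metis
  then obtain s where s: "\<And>x y. inner y (T *\<^sub>V x) = inner (s y) x" by metis
  have cs: "cinner (s y) x = cinner y (T *\<^sub>V x)" for x y
  proof (rule complex_eqI)
    show re: "Re (cinner (s y) x) = Re (cinner y (T *\<^sub>V x))" for x
      using s[of y x] by (simp add: inner_eq_Re_cinner)
    show "Im (cinner (s y) x) = Im (cinner y (T *\<^sub>V x))"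
      unfolding cinner_swap_Im using re[of "\<i> *\<^sub>C x"] by simp
  qed
  have "Cblinfun s *\<^sub>V y = s y" for y
  proof (rule Cblinfun_apply)
    show "s (x + y) = s x + s y" for x y
      by (rule cinner_eqI) (simp add: cs cinner_add_left)
    show "s (a *\<^sub>C x) = a *\<^sub>C s x" for a x
      by (rule cinner_eqI) (simp add: cs cinner_scaleC_left)
    fix x
    have "norm (s x) * norm (s x) = inner (s x) (s x)"
      by (metis power2_norm_eq_inner power2_eq_square)
    also have "\<dots> = inner x (T *\<^sub>V s x)"
      by (simp add: s)
    also have "\<dots> \<le> norm x * norm (T *\<^sub>V s x)" by (rule norm_cauchy_schwarz)
    also have "\<dots> \<le> norm x * (c * norm (s x))" by (intro mult_left_mono c) simp
    finally have "norm (s x) * norm (s x) \<le> norm (s x) * (norm x * c)" by (simp only: ac_simps)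
    then show "norm (s x) \<le> norm x * c"
      using c(1) by (cases "s x = 0") simp_all
  qed
  then show ?thesis using cs by (intro exI[of _ "Cblinfun s"]) simp
qed

lemma cinner_adj_left: "cinner (adj T *\<^sub>V y) x = cinner y (T *\<^sub>V x)"
proof -
  obtain S where S: "\<forall>x y. cinner (S *\<^sub>V y) x = cinner y (T *\<^sub>V x)"
    using adjoint_exists[of T] by blast
  have "adj T = S"
    unfolding adj_def
  proof (rule the_equality, rule S)
    fix S' assume "\<forall>x y. cinner (S' *\<^sub>V y) x = cinner y (T *\<^sub>V x)"
    with S show "S' = S" by - (rule cblinfun_eqI, rule cinner_eqI, simp)
  qed
  then show ?thesis using S by simp
qed

lemma cinner_adj_right: "cinner x (adj T *\<^sub>V y) = cinner (T *\<^sub>V x) y"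
  using cinner_adj_left[of T y x] by (simp add: cinner_commute[of x] cinner_commute[of _ y])

lemma inner_adj_left: "inner (adj T *\<^sub>V y) x = inner y (T *\<^sub>V x)"
  by (simp add: inner_eq_Re_cinner cinner_adj_left)

lemma inner_adj_right: "inner x (adj T *\<^sub>V y) = inner (T *\<^sub>V x) y"
  by (simp add: inner_eq_Re_cinner cinner_adj_right)

lemma adjI: "(\<And>x y. cinner (S *\<^sub>V y) x = cinner y (T *\<^sub>V x)) \<Longrightarrow> adj T = S"
  by (rule cblinfun_eqI, rule cinner_eqI, simp add: cinner_adj_left)

lemma adj_adj [simp]: "adj (adj T) = T"
  by (rule adjI) (simp add: cinner_adj_right)

lemma adj_compose [simp]: "adj (A o\<^sub>C\<^sub>L B) = adj B o\<^sub>C\<^sub>L adj A"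
  by (rule adjI) (simp add: cinner_adj_left)

lemma adj_plus [simp]: "adj (A + B) = adj A + adj B"
  by (rule adjI) (simp add: cinner_adj_left cinner_add_left cinner_add_right)

lemma adj_minus [simp]: "adj (A - B) = adj A - adj B"
  by (rule adjI) (simp add: cinner_adj_left cinner_diff)

lemma adj_scaleC [simp]: "adj (c *\<^sub>C A) = cnj c *\<^sub>C adj A"
  by (rule adjI) (simp add: cinner_adj_left cinner_scaleC_left cinner_scaleC_right)

lemma adj_zero [simp]: "adj 0 = 0"
  by (rule adjI) simp

lemma norm_adj_le:
  assumes "0 \<le> c" "\<And>x. norm (T *\<^sub>V x) \<le> c * norm x"
  shows "norm (adj T *\<^sub>V y) \<le> c * norm y"
proof (cases "adj T *\<^sub>V y = 0")
  case False
  have "norm (adj T *\<^sub>V y) * norm (adj T *\<^sub>V y) = inner (adj T *\<^sub>V y) (adj T *\<^sub>V y)"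
    by (metis power2_norm_eq_inner power2_eq_square)
  also have "\<dots> = inner y (T *\<^sub>V (adj T *\<^sub>V y))"
    by (rule inner_adj_left)
  also have "\<dots> \<le> norm y * norm (T *\<^sub>V (adj T *\<^sub>V y))" by (rule norm_cauchy_schwarz)
  also have "\<dots> \<le> norm y * (c * norm (adj T *\<^sub>V y))" by (intro mult_left_mono assms) simp
  finally show ?thesis using False by (simp add: mult.left_commute[of "norm y"])
qed (use assms(1) in simp)

section \<open>Polar decomposition of injective operators with dense range\<close>

text \<open>Stated for plain functions, because the positive factors of the polar iterates arise by
  recursion on functions. Symmetry is a separate clause since over the reals it does not follow from
  nonnegativity of the quadratic form.\<close>

definition pos_op :: "('a::real_inner \<Rightarrow> 'a) \<Rightarrow> bool"
  where "pos_op A \<longleftrightarrow> bounded_linear A \<and> (\<forall>x y. inner (A x) y = inner x (A y)) \<and>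
    (\<forall>x. 0 \<le> inner (A x) x)"

lemma pos_opD:
  assumes "pos_op A"
  shows "bounded_linear A" "inner (A x) y = inner x (A y)" "0 \<le> inner (A x) x"
  using assms by (auto simp: pos_op_def)

lemma pos_op_id: "pos_op (\<lambda>x. x)"
  by (simp add: pos_op_def bounded_linear_ident)

lemma pos_op_add: "pos_op A \<Longrightarrow> pos_op B \<Longrightarrow> pos_op (\<lambda>x. A x + B x)"
  unfolding pos_op_def by (auto intro: bounded_linear_add simp: inner_add_left inner_add_right)

lemma pos_op_scaleR: "pos_op A \<Longrightarrow> 0 \<le> c \<Longrightarrow> pos_op (\<lambda>x. c *\<^sub>R A x)"
  unfolding pos_op_def
  by (auto intro: bounded_linear_compose[OF bounded_linear_scaleR_right])

text \<open>S - S^2 = (1 - S) S (1 - S) + S (1 - S) S, and both summands are positive when 0 \<le> S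
  \<le> 1. The hypotheses reproduce themselves, which permits iteration.\<close>

lemma pos_op_sub_square:
  assumes S: "pos_op S" and le: "\<And>x. inner (S x) x \<le> inner x x"
  shows "pos_op (\<lambda>x. S x - S (S x))" "inner (S x - S (S x)) x \<le> inner x x"
proof -
  interpret S: bounded_linear S by (rule pos_opD(1)[OF S])
  have sym: "inner (S x) y = inner x (S y)" for x y by (rule pos_opD(2)[OF S])
  have "0 \<le> inner (S x - S (S x)) x" for x
  proof -
    have "inner (S x - S (S x)) x =
        inner (S (x - S x)) (x - S x) + (inner (S x) (S x) - inner (S (S x)) (S x))"
      by (simp add: S.diff inner_diff_left inner_diff_right sym)
    also have "\<dots> \<ge> 0"
      using pos_opD(3)[OF S, of "x - S x"] le[of "S x"] by linarith
    finally show ?thesis .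
  qed
  then show "pos_op (\<lambda>x. S x - S (S x))"
    unfolding pos_op_def
    by (auto simp: inner_diff_left inner_diff_right sym
        intro!: bounded_linear_sub S.bounded_linear_axioms
          bounded_linear_compose[OF S.bounded_linear_axioms])
  have "inner (S x - S (S x)) x = inner (S x) x - inner (S x) (S x)"
    by (simp add: inner_diff_left sym)
  then show "inner (S x - S (S x)) x \<le> inner x x"
    using le[of x] inner_ge_zero[of "S x"] by linarith
qed

text \<open>Riesz's argument: \<open>A\<close> is the strong sum of the squares of the iterates \<open>S n\<close>, each of which
  commutes with \<open>B\<close>.\<close>

lemma pos_op_compose_contraction:
  assumes A: "pos_op A" and le: "\<And>x. inner (A x) x \<le> inner x x" and B: "pos_op B"
    and comm: "\<And>x. A (B x) = B (A x)"
  shows "pos_op (\<lambda>x. A (B x))"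
proof -
  define S where "S n = ((\<lambda>T x. T x - T (T x)) ^^ n) A" for n
  have S0: "S 0 = A" and S_Suc: "S (Suc n) = (\<lambda>x. S n x - S n (S n x))" for n
    by (simp_all add: S_def)
  interpret B: bounded_linear B by (rule pos_opD(1)[OF B])
  have inv: "pos_op (S n) \<and> (\<forall>x. inner (S n x) x \<le> inner x x) \<and> (\<forall>x. S n (B x) = B (S n x))"
    for n
  proof (induction n)
    case 0
    then show ?case using A le comm by (simp add: S0)
  next
    case (Suc n)
    then show ?case using pos_op_sub_square[of "S n"] by (simp add: S_Suc B.diff)
  qed
  then have S: "pos_op (S n)" and SB: "S n (B x) = B (S n x)" for n x by auto
  have sym: "inner (S n x) y = inner x (S n y)" for n x y by (rule pos_opD(2)[OF S])
  \<comment> \<open>Telescoping of S (n+1) = S n - (S n)^2: the sum of the first n squares misses A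
    by exactly S n.\<close>
  have tele: "inner (A x) y = inner (S n x) y + (\<Sum>k<n. inner (S k x) (S k y))" for x y n
    by (induction n) (simp_all add: S0 S_Suc inner_diff_left sym)
  have "0 \<le> inner (A (B x)) x" for x
  proof -
    have "(\<Sum>k<n. (norm (S k x))\<^sup>2) \<le> inner (A x) x" for n
      using tele[of x x n] pos_opD(3)[OF S, of n x] by (simp add: power2_norm_eq_inner)
    then have "summable (\<lambda>k. (norm (S k x))\<^sup>2)"
      by (intro summableI_nonneg_bounded) auto
    then have "(\<lambda>k. sqrt ((norm (S k x))\<^sup>2)) \<longlonglongrightarrow> sqrt 0"
      by (intro tendsto_real_sqrt summable_LIMSEQ_zero)
    \<comment> \<open>The squared norms are summable, so the remainder S n vanishes strongly and
      drops out of the telescoped identity in the limit.\<close>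
    then have "(\<lambda>k. S k x) \<longlonglongrightarrow> 0"
      by (simp add: tendsto_norm_zero_iff)
    then have "(\<lambda>n. inner (B x) (S n x)) \<longlonglongrightarrow> inner (B x) 0"
      by (intro tendsto_inner tendsto_const)
    moreover have "inner (B x) (S n x) \<le> inner (A (B x)) x" for n
    proof -
      have "0 \<le> (\<Sum>k<n. inner (S k (B x)) (S k x))"
        by (intro sum_nonneg) (simp add: SB pos_opD(3)[OF B])
      then show ?thesis using tele[of "B x" x n] by (simp add: sym)
    qed
    ultimately show ?thesis
      using LIMSEQ_le_const2[of _ _ "inner (A (B x)) x"] by auto
  qed
  moreover have "bounded_linear (\<lambda>x. A (B x))"
    by (rule bounded_linear_compose[OF pos_opD(1)[OF A] pos_opD(1)[OF B]])
  moreover have "inner (A (B x)) y = inner x (A (B y))" for x y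
    by (simp add: comm pos_opD(2)[OF A] pos_opD(2)[OF B])
  ultimately show ?thesis by (simp add: pos_op_def)
qed

text \<open>Positivity is unaffected by a positive factor, so A is divided by a bound for its norm
  to reach the contractive case.\<close>

lemma pos_op_compose:
  assumes A: "pos_op A" and B: "pos_op B" and comm: "\<And>x. A (B x) = B (A x)"
  shows "pos_op (\<lambda>x. A (B x))"
proof -
  obtain K where K: "0 < K" "\<And>x. norm (A x) \<le> norm x * K"
    using bounded_linear.pos_bounded[OF pos_opD(1)[OF A]] by metis
  have "inner ((1 / K) *\<^sub>R A x) x \<le> inner x x" for x
  proof -
    have "inner (A x) x \<le> norm (A x) * norm x" by (rule norm_cauchy_schwarz)
    also have "\<dots> \<le> norm x * K * norm x" by (intro mult_right_mono K) simp
    also have "\<dots> = K * inner x x" by (simp add: power2_norm_eq_inner[symmetric] power2_eq_square)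
    finally show ?thesis using K(1) by (simp add: field_simps)
  qed
  moreover have "(1 / K) *\<^sub>R A (B x) = B ((1 / K) *\<^sub>R A x)" for x
    by (simp add: comm linear_simps[OF pos_opD(1)[OF B]])
  ultimately have "pos_op (\<lambda>x. (1 / K) *\<^sub>R A (B x))"
    using pos_op_compose_contraction[OF pos_op_scaleR[OF A, of "1 / K"] _ B] K(1) by simp
  from pos_op_scaleR[OF this, of K] have "pos_op (\<lambda>x. K *\<^sub>R (1 / K) *\<^sub>R A (B x))"
    using K(1) by simp
  then show ?thesis using K(1) by simp
qed

section \<open>Convergence of the polar iteration\<close>

definition contraction :: "('a::chilbert_space, 'b::chilbert_space) cblinfun \<Rightarrow> bool"
  where "contraction T \<longleftrightarrow> (\<forall>x. norm (T *\<^sub>V x) \<le> norm x)"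

lemma contraction_adj: "contraction T \<Longrightarrow> contraction (adj T)"
  using norm_adj_le[of 1 T] by (simp add: contraction_def)

text \<open>The Newton--Schulz iteration for the polar part. On singular values it acts as
  \<open>t \<mapsto> t (3 - t\<^sup>2) / 2\<close>, which drives every \<open>t \<in> (0, 1]\<close> to \<open>1\<close>.\<close>

definition polar_step ::
  "('a::chilbert_space, 'b::chilbert_space) cblinfun \<Rightarrow> ('a, 'b) cblinfun"
  where "polar_step a = a + (1 / 2) *\<^sub>C (a - a o\<^sub>C\<^sub>L adj a o\<^sub>C\<^sub>L a)"

lemma polar_step_apply:
  "polar_step a *\<^sub>V x = a *\<^sub>V x + (1 / 2) *\<^sub>R (a *\<^sub>V (x - adj a *\<^sub>V (a *\<^sub>V x)))"
  by (simp add: polar_step_def scaleR_scaleC)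

lemma adj_polar_step: "adj (polar_step a) = polar_step (adj a)"
  by (simp add: polar_step_def compose_assoc)

text \<open>With h = adj a a and y = x - h x, every norm is a quadratic form in h. The upper bound
  comes out as |x|^2 - 3/4 |y|^2, the lower one from h^2 \<le> h.\<close>

lemma norm_polar_step:
  assumes "contraction a"
  shows "norm (polar_step a *\<^sub>V x) \<le> norm x" "norm (a *\<^sub>V x) \<le> norm (polar_step a *\<^sub>V x)"
proof -
  define h where "h x = adj a *\<^sub>V (a *\<^sub>V x)" for x
  define y where "y = x - h x"
  have sym: "inner (a *\<^sub>V u) (a *\<^sub>V v) = inner (h u) v" for u v
    by (simp add: h_def inner_adj_left)
  have symx: "inner (h u) v = inner u (h v)" for u v
    by (simp add: h_def inner_adj_left inner_adj_right)
  have ps: "polar_step a *\<^sub>V x = a *\<^sub>V x + (1 / 2) *\<^sub>R (a *\<^sub>V y)"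
    by (simp only: polar_step_apply y_def h_def)
  have 1: "(norm (polar_step a *\<^sub>V x))\<^sup>2 = inner (h x) x + inner (h x) y + (norm (a *\<^sub>V y))\<^sup>2 / 4"
    unfolding ps power2_norm_eq_inner
    by (simp add: inner_add_left inner_add_right sym symx inner_commute algebra_simps)
  have y2: "(norm y)\<^sup>2 = inner x x - 2 * inner (h x) x + inner (h x) (h x)"
    unfolding power2_norm_eq_inner y_def by (simp add: inner_simps inner_commute)
  have hy: "inner (h x) y = inner (h x) x - inner (h x) (h x)"
    by (simp add: y_def inner_diff_right)
  have le: "(norm (a *\<^sub>V u))\<^sup>2 \<le> (norm u)\<^sup>2" for u
    using assms by (simp add: contraction_def power_mono)
  have "(norm (polar_step a *\<^sub>V x))\<^sup>2 \<le> (norm x)\<^sup>2"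
    using 1 y2 hy le[of y] zero_le_power2[of "norm y"] power2_norm_eq_inner[of x] by linarith
  then show "norm (polar_step a *\<^sub>V x) \<le> norm x"
    by (simp add: power2_le_iff_abs_le)
  have "norm (h x) \<le> norm (a *\<^sub>V x)"
    using contraction_adj[OF assms] by (simp add: contraction_def h_def)
  then have "inner (h x) (h x) \<le> inner (h x) x"
    by (simp add: power2_norm_eq_inner[symmetric] power_mono flip: sym)
  then have "(norm (a *\<^sub>V x))\<^sup>2 \<le> (norm (polar_step a *\<^sub>V x))\<^sup>2"
    using 1 hy power2_norm_eq_inner[of "a *\<^sub>V x"] sym[of x x] zero_le_power2[of "norm (a *\<^sub>V y)"]
    by linarith
  then show "norm (a *\<^sub>V x) \<le> norm (polar_step a *\<^sub>V x)"
    by (simp add: power2_le_iff_abs_le)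
qed

lemma contraction_polar_iter: "contraction a \<Longrightarrow> contraction ((polar_step ^^ n) a)"
  by (induction n) (auto simp: contraction_def norm_polar_step(1)[unfolded contraction_def])

lemma polar_iter_mono:
  assumes a: "contraction a" and "n \<le> m"
  shows "norm ((polar_step ^^ n) a *\<^sub>V x) \<le> norm ((polar_step ^^ m) a *\<^sub>V x)"
  using assms(2)
proof (induction m rule: dec_induct)
  case (step m)
  then show ?case
    using norm_polar_step(2)[OF contraction_polar_iter[OF a], of m x] by simp
qed simp

text \<open>The iterates are \<open>a g(a\<^sup>* a)\<close> for positive operators \<open>g(a\<^sup>* a)\<close> in the commutative algebra
  generated by \<open>a\<^sup>* a\<close>.\<close>

lemma polar_iter_factor:
  fixes a :: "('a::chilbert_space, 'b::chilbert_space) cblinfun"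
  assumes a: "contraction a"
  defines "h \<equiv> \<lambda>x. adj a *\<^sub>V (a *\<^sub>V x)"
  obtains G :: "nat \<Rightarrow> 'a \<Rightarrow> 'a" where
    "\<And>n x. (polar_step ^^ n) a *\<^sub>V x = a *\<^sub>V G n x" "\<And>n. pos_op (G n)"
    "\<And>n F x. bounded_linear F \<Longrightarrow> (\<And>x. F (h x) = h (F x)) \<Longrightarrow> F (G n x) = G n (F x)"
proof -
  \<comment> \<open>If b = a g is the current iterate, then adj b b = g h g, so b + b (1 - adj b b)
    / 2 is again a times an operator built from h; the recursion records that operator.\<close>
  define G where "G = rec_nat (\<lambda>x. x) (\<lambda>n g x. g x + (1 / 2) *\<^sub>R g (x - g (h (g x))))"
  have G0: "G 0 x = x" and G_Suc: "G (Suc n) x = G n x + (1 / 2) *\<^sub>R G n (x - G n (h (G n x)))"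
    for n x by (simp_all add: G_def)
  have h_lin: "bounded_linear h"
    unfolding h_def by (intro bounded_linear_compose[OF bounded_linear_cblinfun_apply]
        bounded_linear_cblinfun_apply)
  \<comment> \<open>The last clause places \<open>G n\<close> in the bicommutant of h. It supplies
    every commutation relation needed to multiply positive operators.\<close>
  have "((\<forall>x. (polar_step ^^ n) a *\<^sub>V x = a *\<^sub>V G n x) \<and> pos_op (G n)) \<and>
    (\<forall>F x. bounded_linear F \<longrightarrow> (\<forall>x. F (h x) = h (F x)) \<longrightarrow> F (G n x) = G n (F x))" for n
  proof (induction n)
    case 0
    have "G 0 = (\<lambda>x. x)" by (simp add: G0 fun_eq_iff)
    then show ?case using pos_op_id by simp
  next
    case (Suc n)
    define b where "b = (polar_step ^^ n) a"
    from Suc have b: "\<And>x. b *\<^sub>V x = a *\<^sub>V G n x" and pos: "pos_op (G n)"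
      and comm: "\<And>F x. bounded_linear F \<Longrightarrow> (\<And>x. F (h x) = h (F x)) \<Longrightarrow> F (G n x) = G n (F x)"
      unfolding b_def by blast+
    interpret G: bounded_linear "G n" by (rule pos_opD(1)[OF pos])
    have adj_b: "adj b *\<^sub>V y = G n (adj a *\<^sub>V y)" for y
    proof -
      have "inner (adj b *\<^sub>V y) x = inner (G n (adj a *\<^sub>V y)) x" for x
        by (simp add: inner_adj_left b pos_opD(2)[OF pos])
      then show ?thesis by (metis inner_eq_zero_iff inner_diff_left right_minus_eq)
    qed
    have H: "adj b *\<^sub>V (b *\<^sub>V x) = G n (h (G n x))" for x
      by (simp add: adj_b b h_def)
    have hG: "h (G n x) = G n (h x)" for x
      by (rule comm[OF h_lin]) simp
    have con: "contraction b"
      unfolding b_def by (rule contraction_polar_iter[OF a])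
    have posH: "pos_op (\<lambda>x. x - G n (h (G n x)))"
      unfolding pos_op_def H[symmetric]
    proof (intro conjI allI)
      show "bounded_linear (\<lambda>x. x - adj b *\<^sub>V b *\<^sub>V x)"
        by (intro bounded_linear_sub bounded_linear_ident bounded_linear_cblinfun_apply
            bounded_linear_compose[OF bounded_linear_cblinfun_apply])
      fix x y
      show "inner (x - adj b *\<^sub>V b *\<^sub>V x) y = inner x (y - adj b *\<^sub>V b *\<^sub>V y)"
        by (simp add: inner_diff_left inner_diff_right inner_adj_left inner_adj_right)
      have "(norm (b *\<^sub>V x))\<^sup>2 \<le> (norm x)\<^sup>2"
        using con by (simp add: contraction_def power_mono)
      then show "0 \<le> inner (x - adj b *\<^sub>V b *\<^sub>V x) x"
        by (simp add: inner_diff_left inner_adj_left power2_norm_eq_inner)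
    qed
    have "pos_op (\<lambda>x. G n (x - G n (h (G n x))))"
      by (rule pos_op_compose[OF pos posH]) (simp add: G.diff hG)
    then have "pos_op (G (Suc n))"
      unfolding G_Suc[abs_def] by (rule pos_op_add[OF pos pos_op_scaleR]) simp
    moreover have "(polar_step ^^ Suc n) a *\<^sub>V x = a *\<^sub>V G (Suc n) x" for x
      unfolding G_Suc using b[of x] b[of "x - G n (h (G n x))"] H[of x]
      by (simp add: b_def polar_step_apply)
    moreover have "F (G (Suc n) x) = G (Suc n) (F x)"
      if F: "bounded_linear F" "\<And>x. F (h x) = h (F x)" for F x
      by (simp add: G_Suc linear_simps[OF F(1)] comm[OF F] F(2))
    ultimately show ?case by blast
  qed
  then show thesis by (intro that) blast+
qed

text \<open>|v - u|^2 = |v|^2 - |u|^2 - 2 <u, v - u>, and the inner product is nonnegative: adj (A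
  n) (A (k+1) - A k) is half the product of the commuting positive operators \<open>G n\<close>, h,
  \<open>G k\<close> and 1 - H. This converts convergence of norms into convergence of
  vectors.\<close>

lemma polar_iter_diff:
  fixes a :: "('a::chilbert_space, 'b::chilbert_space) cblinfun"
  assumes a: "contraction a" and nm: "n \<le> m"
  shows "(norm ((polar_step ^^ m) a *\<^sub>V x - (polar_step ^^ n) a *\<^sub>V x))\<^sup>2
    \<le> (norm ((polar_step ^^ m) a *\<^sub>V x))\<^sup>2 - (norm ((polar_step ^^ n) a *\<^sub>V x))\<^sup>2"
proof -
  define h where "h x = adj a *\<^sub>V (a *\<^sub>V x)" for x
  obtain G :: "nat \<Rightarrow> 'a \<Rightarrow> 'a" where
    fac: "\<And>n x. (polar_step ^^ n) a *\<^sub>V x = a *\<^sub>V G n x" and pos: "\<And>n. pos_op (G n)"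
    and comm: "\<And>n F x. bounded_linear F \<Longrightarrow> (\<And>x. F (h x) = h (F x)) \<Longrightarrow> F (G n x) = G n (F x)"
    using polar_iter_factor[OF a, folded h_def] by metis
  define A where "A n = (polar_step ^^ n) a" for n
  have A: "A n *\<^sub>V x = a *\<^sub>V G n x" for n x by (simp add: A_def fac)
  have h: "pos_op h"
    unfolding pos_op_def h_def
    by (intro conjI allI bounded_linear_compose[OF bounded_linear_cblinfun_apply]
        bounded_linear_cblinfun_apply) (simp_all add: inner_adj_left inner_adj_right)
  have hG: "h (G n x) = G n (h x)" for n x
    by (rule comm[OF pos_opD(1)[OF h]]) simp
  have GG: "G k (G n x) = G n (G k x)" for k n x
    by (rule comm[OF pos_opD(1)[OF pos]]) (simp add: hG)
  have step: "0 \<le> inner (A n *\<^sub>V x) (A (Suc k) *\<^sub>V x - A k *\<^sub>V x)" for n k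
  proof -
    interpret G: bounded_linear "G k" by (rule pos_opD(1)[OF pos])
    define H where "H x = adj (A k) *\<^sub>V (A k *\<^sub>V x)" for x
    have H: "H x = G k (h (G k x))" for x
    proof -
      have "inner (H x) y = inner (G k (h (G k x))) y" for y
        by (simp add: H_def inner_adj_left A pos_opD(2)[OF pos] h_def)
      then show ?thesis by (metis inner_eq_zero_iff inner_diff_left right_minus_eq)
    qed
    have "contraction (A k)" unfolding A_def by (rule contraction_polar_iter[OF a])
    then have Hle: "(norm (A k *\<^sub>V x))\<^sup>2 \<le> (norm x)\<^sup>2" for x
      by (simp add: contraction_def power_mono)
    have pos1: "pos_op (\<lambda>x. x - H x)"
      unfolding pos_op_def H_def
      using Hle by (intro conjI allI bounded_linear_sub bounded_linear_ident
          bounded_linear_compose[OF bounded_linear_cblinfun_apply] bounded_linear_cblinfun_apply)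
        (simp_all add: inner_adj_left inner_adj_right inner_diff_left inner_diff_right
            power2_norm_eq_inner)
    have pos2: "pos_op (\<lambda>x. h (G n x))"
      using pos_op_compose[of h "G n"] h pos[of n] hG[of n] by simp
    have pos3: "pos_op (\<lambda>x. G k (h (G n x)))"
      using pos_op_compose[of "G k" "\<lambda>x. h (G n x)"] pos[of k] pos2 hG GG[of k n] by simp
    interpret Gn: bounded_linear "G n" by (rule pos_opD(1)[OF pos])
    interpret h: bounded_linear h by (rule pos_opD(1)[OF h])
    have "pos_op (\<lambda>x. G k (h (G n x)) - H (G k (h (G n x))))"
      using pos_op_compose[of "\<lambda>x. x - H x" "\<lambda>x. G k (h (G n x))"] pos1 pos3
      by (simp add: H hG GG[of k n] G.diff Gn.diff h.diff)
    from pos_opD(3)[OF this, of x]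
    have "0 \<le> inner (G k (h (G n x)) - H (G k (h (G n x)))) x" .
    also have "\<dots> = inner (G k (h (G n x))) (x - H x)"
      using pos_opD(2)[OF pos1, of "G k (h (G n x))" x] by simp
    also have "\<dots> = inner (A n *\<^sub>V x) (A k *\<^sub>V (x - H x))"
      by (simp only: A pos_opD(2)[OF pos] h_def inner_adj_left)
    also have "\<dots> = 2 * inner (A n *\<^sub>V x) (A (Suc k) *\<^sub>V x - A k *\<^sub>V x)"
    proof -
      have "A (Suc k) *\<^sub>V x - A k *\<^sub>V x = (1 / 2) *\<^sub>R (A k *\<^sub>V (x - H x))"
        by (simp add: A_def H_def polar_step_apply)
      then show ?thesis by simp
    qed
    finally show ?thesis by simp
  qed
  have "0 \<le> inner (A n *\<^sub>V x) (A m *\<^sub>V x - A n *\<^sub>V x)"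
    using nm
  proof (induction m rule: dec_induct)
    case (step k)
    then show ?case
      using \<open>\<And>n k. 0 \<le> inner (A n *\<^sub>V x) (A (Suc k) *\<^sub>V x - A k *\<^sub>V x)\<close>[of n k]
      by (simp add: inner_diff_right)
  qed simp
  then show ?thesis
    unfolding A_def[symmetric] power2_norm_eq_inner
    by (simp add: inner_diff_left inner_diff_right inner_commute)
qed

text \<open>At a fixed x the norms of the iterates increase and stay bounded, so they are Cauchy,
  and \<open>polar_iter_diff\<close> makes the vectors Cauchy. The last clause places the kernel of
  v inside that of a.\<close>

lemma polar_iter_converges:
  assumes a: "contraction a"
  obtains v where "\<And>x. (\<lambda>n. (polar_step ^^ n) a *\<^sub>V x) \<longlonglongrightarrow> v *\<^sub>V x" "contraction v"
    "\<And>x. norm (a *\<^sub>V x) \<le> norm (v *\<^sub>V x)"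
proof -
  define A where "A n = (polar_step ^^ n) a" for n
  have con: "norm (A n *\<^sub>V x) \<le> norm x" for n x
    using contraction_polar_iter[OF a] by (simp add: A_def contraction_def)
  have mono: "norm (A n *\<^sub>V x) \<le> norm (A m *\<^sub>V x)" if "n \<le> m" for n m x
    unfolding A_def by (rule polar_iter_mono[OF a that])
  have "\<exists>y. (\<lambda>n. A n *\<^sub>V x) \<longlonglongrightarrow> y" for x
  proof -
    have "incseq (\<lambda>n. (norm (A n *\<^sub>V x))\<^sup>2)"
      by (auto intro!: incseq_SucI power_mono mono)
    moreover have "(norm (A n *\<^sub>V x))\<^sup>2 \<le> (norm x)\<^sup>2" for n
      by (intro power_mono con) simp
    ultimately have "Cauchy (\<lambda>n. (norm (A n *\<^sub>V x))\<^sup>2)"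
      using incseq_convergent[of "\<lambda>n. (norm (A n *\<^sub>V x))\<^sup>2"] LIMSEQ_imp_Cauchy by metis
    then have C: "\<exists>N. \<forall>m\<ge>N. \<forall>n\<ge>N. dist ((norm (A m *\<^sub>V x))\<^sup>2) ((norm (A n *\<^sub>V x))\<^sup>2) < e"
      if "0 < e" for e
      using metric_CauchyD that by blast
    have "Cauchy (\<lambda>n. A n *\<^sub>V x)"
    proof (rule CauchyI')
      fix e :: real assume e: "0 < e"
      then obtain N where
        N: "\<And>m n. m \<ge> N \<Longrightarrow> n \<ge> N \<Longrightarrow> dist ((norm (A m *\<^sub>V x))\<^sup>2) ((norm (A n *\<^sub>V x))\<^sup>2) < e\<^sup>2"
        using C[of "e\<^sup>2"] by auto
      have "norm (A m *\<^sub>V x - A n *\<^sub>V x) < e" if "m \<ge> N" "n > m" for m n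
      proof -
        have "(norm (A n *\<^sub>V x - A m *\<^sub>V x))\<^sup>2 \<le> (norm (A n *\<^sub>V x))\<^sup>2 - (norm (A m *\<^sub>V x))\<^sup>2"
          using polar_iter_diff[OF a, of m n x] that by (simp add: A_def)
        also have "\<dots> < e\<^sup>2"
          using N[of n m] that by (simp add: dist_real_def)
        finally show ?thesis
          using e by (simp add: power2_less_imp_less norm_minus_commute)
      qed
      then show "\<exists>M. \<forall>m\<ge>M. \<forall>n>m. dist (A m *\<^sub>V x) (A n *\<^sub>V x) < e"
        unfolding dist_norm by blast
    qed
    then show ?thesis using Cauchy_convergent convergent_def by blast
  qed
  then obtain v where v: "\<And>x. (\<lambda>n. A n *\<^sub>V x) \<longlonglongrightarrow> v x" by metis
  have vle: "norm (v x) \<le> norm x" for x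
    by (rule Lim_bounded[OF tendsto_norm[OF v]]) (use con in auto)
  have app: "Cblinfun v *\<^sub>V x = v x" for x
  proof (rule Cblinfun_apply[where K = 1])
    fix x y c
    show "v (x + y) = v x + v y"
      by (rule LIMSEQ_unique[OF v]) (simp add: tendsto_add v)
    have "(\<lambda>n. c *\<^sub>C (A n *\<^sub>V x)) \<longlonglongrightarrow> c *\<^sub>C v x"
      by (rule bounded_linear.tendsto[OF bounded_linear_scaleC v])
    then show "v (c *\<^sub>C x) = c *\<^sub>C v x"
      by (intro LIMSEQ_unique[OF v]) simp
  qed (use vle in simp)
  show thesis
  proof (rule that[of "Cblinfun v"])
    show "contraction (Cblinfun v)" by (simp add: contraction_def app vle)
    fix x
    show "(\<lambda>n. (polar_step ^^ n) a *\<^sub>V x) \<longlonglongrightarrow> Cblinfun v *\<^sub>V x"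
      using v[of x] by (simp add: A_def app)
    have "norm (a *\<^sub>V x) \<le> norm (v x)"
      by (rule LIMSEQ_le_const[OF tendsto_norm[OF v]])
        (use mono[of 0 _ x] in \<open>auto simp: A_def\<close>)
    then show "norm (a *\<^sub>V x) \<le> norm (Cblinfun v *\<^sub>V x)" by (simp add: app)
  qed
qed

text \<open>In the limit the step formula becomes v = v (adj v) v, so v is a partial isometry;
  injectivity of a and of adj a removes the kernels of v and of adj v.\<close>

lemma polar_iter_limit_unitary:
  fixes a :: "('a::chilbert_space, 'b::chilbert_space) cblinfun"
  assumes a: "contraction a"
    and inj: "\<And>x. a *\<^sub>V x = 0 \<Longrightarrow> x = 0" "\<And>y. adj a *\<^sub>V y = 0 \<Longrightarrow> y = 0"
  obtains v where "\<And>x. (\<lambda>n. (polar_step ^^ n) a *\<^sub>V x) \<longlonglongrightarrow> v *\<^sub>V x"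
    "\<And>x. adj v *\<^sub>V (v *\<^sub>V x) = x" "\<And>y. v *\<^sub>V (adj v *\<^sub>V y) = y"
proof -
  define A where "A n = (polar_step ^^ n) a" for n
  have adjA: "adj (A n) = (polar_step ^^ n) (adj a)" for n
    unfolding A_def by (induction n) (simp_all add: adj_polar_step)
  obtain v where v: "\<And>x. (\<lambda>n. A n *\<^sub>V x) \<longlonglongrightarrow> v *\<^sub>V x" "contraction v"
    "\<And>x. norm (a *\<^sub>V x) \<le> norm (v *\<^sub>V x)"
    using polar_iter_converges[OF a, folded A_def] by metis
  \<comment> \<open>Strong convergence does not pass to adjoints in general, so the adjoint iterates
    get a limit of their own. They are the iterates of adj a, because \<open>polar_step\<close>
    commutes with \<open>adj\<close>.\<close>
  obtain w where w: "\<And>x. (\<lambda>n. adj (A n) *\<^sub>V x) \<longlonglongrightarrow> w *\<^sub>V x" "contraction w"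
    "\<And>x. norm (adj a *\<^sub>V x) \<le> norm (w *\<^sub>V x)"
    using polar_iter_converges[OF contraction_adj[OF a], folded adjA] by metis
  have vw: "adj v = w"
  proof (rule adjI)
    fix x y
    have "(\<lambda>n. cinner x (A n *\<^sub>V y)) \<longlonglongrightarrow> cinner x (v *\<^sub>V y)"
      by (rule bounded_linear.tendsto[OF bounded_linear_cinner_right v(1)])
    moreover have "(\<lambda>n. cinner x (A n *\<^sub>V y)) \<longlonglongrightarrow> cinner (w *\<^sub>V x) y"
    proof -
      have "(\<lambda>n. cnj (cinner y (adj (A n) *\<^sub>V x))) \<longlonglongrightarrow> cnj (cinner y (w *\<^sub>V x))"
        by (intro tendsto_cnj bounded_linear.tendsto[OF bounded_linear_cinner_right w(1)])
      moreover have "cnj (cinner y (adj (A n) *\<^sub>V x)) = cinner x (A n *\<^sub>V y)" for n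
        by (simp add: cinner_adj_right cinner_commute[of x])
      ultimately show ?thesis
        by (simp add: cinner_commute[of "w *\<^sub>V x"])
    qed
    ultimately show "cinner (w *\<^sub>V x) y = cinner x (v *\<^sub>V y)"
      using LIMSEQ_unique by metis
  qed
  have con: "norm (A n *\<^sub>V x) \<le> norm x" for n x
    using contraction_polar_iter[OF a] by (simp add: A_def contraction_def)
  have AA: "(\<lambda>n. A n *\<^sub>V (adj (A n) *\<^sub>V y)) \<longlonglongrightarrow> v *\<^sub>V (w *\<^sub>V y)" for y
  proof -
    have "(\<lambda>n. A n *\<^sub>V (adj (A n) *\<^sub>V y - w *\<^sub>V y)) \<longlonglongrightarrow> 0"
    proof (rule Lim_null_comparison)
      show "\<forall>\<^sub>F n in sequentially.
          norm (A n *\<^sub>V (adj (A n) *\<^sub>V y - w *\<^sub>V y)) \<le> norm (adj (A n) *\<^sub>V y - w *\<^sub>V y)"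
        using con by (intro always_eventually allI)
      show "(\<lambda>n. norm (adj (A n) *\<^sub>V y - w *\<^sub>V y)) \<longlonglongrightarrow> 0"
        using w(1)[of y] by (simp add: LIM_zero tendsto_norm_zero)
    qed
    from tendsto_add[OF this v(1)[of "w *\<^sub>V y"]] show ?thesis by simp
  qed
  have vwv: "v *\<^sub>V (w *\<^sub>V (v *\<^sub>V x)) = v *\<^sub>V x" for x
  proof -
    have "inner (v *\<^sub>V (w *\<^sub>V (v *\<^sub>V x))) y = inner (v *\<^sub>V x) y" for y
    proof -
      \<comment> \<open>Tested against y, the step formula involves the iterates only through A n x
        and A n (adj (A n)) y, whose limits are known, while the left-hand side tends to 0.\<close>
      have eq: "inner (2 *\<^sub>R (A (Suc n) *\<^sub>V x - A n *\<^sub>V x)) y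
          = inner (A n *\<^sub>V x) y - inner (A n *\<^sub>V x) (A n *\<^sub>V (adj (A n) *\<^sub>V y))" for n
      proof -
        have "2 *\<^sub>R (A (Suc n) *\<^sub>V x - A n *\<^sub>V x) = A n *\<^sub>V (x - adj (A n) *\<^sub>V (A n *\<^sub>V x))"
          by (simp add: A_def polar_step_apply)
        then show ?thesis
          by (simp add: inner_diff_left)
            (metis inner_adj_left inner_adj_right)
      qed
      have 1: "(\<lambda>n. inner (2 *\<^sub>R (A (Suc n) *\<^sub>V x - A n *\<^sub>V x)) y)
          \<longlonglongrightarrow> inner (2 *\<^sub>R (v *\<^sub>V x - v *\<^sub>V x)) y"
        by (intro tendsto_intros v(1) LIMSEQ_Suc[OF v(1)])
      have 2: "(\<lambda>n. inner (A n *\<^sub>V x) y - inner (A n *\<^sub>V x) (A n *\<^sub>V (adj (A n) *\<^sub>V y)))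
          \<longlonglongrightarrow> inner (v *\<^sub>V x) y - inner (v *\<^sub>V x) (v *\<^sub>V (w *\<^sub>V y))"
        by (intro tendsto_intros v(1) AA)
      have "inner (2 *\<^sub>R (v *\<^sub>V x - v *\<^sub>V x)) y
          = inner (v *\<^sub>V x) y - inner (v *\<^sub>V x) (v *\<^sub>V (w *\<^sub>V y))"
        by (rule LIMSEQ_unique[OF 1 2[folded eq]])
      then have "inner (v *\<^sub>V x) y = inner (v *\<^sub>V x) (v *\<^sub>V (w *\<^sub>V y))" by simp
      then show ?thesis
        by (simp add: vw[symmetric] inner_adj_left flip: inner_adj_right)
    qed
    then show ?thesis by (metis inner_eq_zero_iff inner_diff_left right_minus_eq)
  qed
  have wv: "w *\<^sub>V (v *\<^sub>V x) = x" for x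
  proof -
    have "v *\<^sub>V (w *\<^sub>V (v *\<^sub>V x) - x) = 0" by (simp add: vwv)
    then have "a *\<^sub>V (w *\<^sub>V (v *\<^sub>V x) - x) = 0" using v(3) by (metis norm_le_zero_iff norm_zero)
    then show ?thesis using inj(1) by fastforce
  qed
  have wvw: "w *\<^sub>V (v *\<^sub>V (w *\<^sub>V y)) = w *\<^sub>V y" for y by (simp add: wv)
  have "v *\<^sub>V (w *\<^sub>V y) = y" for y
  proof -
    have "w *\<^sub>V (v *\<^sub>V (w *\<^sub>V y) - y) = 0" by (simp add: wvw)
    then have "adj a *\<^sub>V (v *\<^sub>V (w *\<^sub>V y) - y) = 0" using w(3) by (metis norm_le_zero_iff norm_zero)
    then show ?thesis using inj(2) by fastforce
  qed
  then show thesis using that[of v] v(1) wv by (simp add: vw A_def)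
qed

section \<open>The w*-topology\<close>

lemma summable_norm_mult:
  assumes "summable (\<lambda>n. (norm (x n))\<^sup>2)" "summable (\<lambda>n. (norm (y n))\<^sup>2)"
  shows "summable (\<lambda>n. norm (x n) * norm (y n))"
proof (rule summable_comparison_test')
  show "summable (\<lambda>n. (norm (x n))\<^sup>2 + (norm (y n))\<^sup>2)"
    by (intro summable_add assms)
  fix n
  have "norm (norm (x n) * norm (y n)) = norm (x n) * norm (y n)" "0 \<le> norm (x n) * norm (y n)"
    by simp_all
  then show "norm (norm (x n) * norm (y n)) \<le> (norm (x n))\<^sup>2 + (norm (y n))\<^sup>2"
    using sum_squares_bound[of "norm (x n)" "norm (y n)"] by linarith
qed

lemma norm_cinner_apply_le:
  assumes "\<And>x. norm (T *\<^sub>V x) \<le> c * norm x"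
  shows "cmod (cinner y (T *\<^sub>V x)) \<le> c * (norm x * norm y)"
proof -
  have "cmod (cinner y (T *\<^sub>V x)) \<le> norm y * norm (T *\<^sub>V x)" by (rule cinner_bound)
  also have "\<dots> \<le> norm y * (c * norm x)" by (intro mult_left_mono assms) simp
  finally show ?thesis by (simp add: mult.left_commute mult.commute)
qed

lemma summable_cinner_apply:
  assumes "summable (\<lambda>n. (norm (x n))\<^sup>2)" "summable (\<lambda>n. (norm (y n))\<^sup>2)"
  shows "summable (\<lambda>n. cinner (y n) (T *\<^sub>V x n))"
proof -
  obtain c where c: "\<And>x. norm (T *\<^sub>V x) \<le> c * norm x"
    using cblinfun_bound[of T] by metis
  show ?thesis
  proof (rule summable_comparison_test')
    show "summable (\<lambda>n. c * (norm (x n) * norm (y n)))"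
      by (intro summable_mult summable_norm_mult assms)
  qed (rule norm_cinner_apply_le[OF c])
qed

lemma summable_norm_apply:
  assumes "summable (\<lambda>n. (norm (x n))\<^sup>2)"
  shows "summable (\<lambda>n. (norm (T *\<^sub>V x n))\<^sup>2)"
proof -
  obtain c where c: "\<And>x. norm (T *\<^sub>V x) \<le> c * norm x"
    using cblinfun_bound[of T] by metis
  show ?thesis
  proof (rule summable_comparison_test')
    show "summable (\<lambda>n. c\<^sup>2 * (norm (x n))\<^sup>2)"
      by (intro summable_mult assms)
    fix n
    show "norm ((norm (T *\<^sub>V x n))\<^sup>2) \<le> c\<^sup>2 * (norm (x n))\<^sup>2"
      using power_mono[OF c[of "x n"], of 2] by (simp add: power_mult_distrib)
  qed
qed

lemma normal_functional_repr:
  assumes "\<omega> \<in> normal_functionals"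
  shows "\<exists>x y. (\<forall>T. \<omega> T = (\<Sum>n. cinner (y n) (T *\<^sub>V x n))) \<and>
    summable (\<lambda>n. (norm (x n))\<^sup>2) \<and> summable (\<lambda>n. (norm (y n))\<^sup>2)"
  using assms unfolding normal_functionals_def by auto

lemma normal_functionalsI:
  assumes "\<And>T. \<omega> T = (\<Sum>n. cinner (y n) (T *\<^sub>V x n))"
    "summable (\<lambda>n. (norm (x n))\<^sup>2)" "summable (\<lambda>n. (norm (y n))\<^sup>2)"
  shows "\<omega> \<in> normal_functionals"
proof -
  have "\<omega> = (\<lambda>T. \<Sum>n. cinner (y n) (T *\<^sub>V x n))" using assms(1) by (rule ext)
  then show ?thesis using assms(2,3) unfolding normal_functionals_def by blast
qed

lemma vector_functional_normal: "(\<lambda>T. cinner y (T *\<^sub>V x)) \<in> normal_functionals"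
proof (rule normal_functionalsI)
  let ?x = "\<lambda>n::nat. if n = 0 then x else 0" and ?y = "\<lambda>n::nat. if n = 0 then y else 0"
  show "summable (\<lambda>n. (norm (?x n))\<^sup>2)" "summable (\<lambda>n. (norm (?y n))\<^sup>2)"
    by (rule summable_finite[of "{0}"]; simp)+
  show "cinner y (T *\<^sub>V x) = (\<Sum>n. cinner (?y n) (T *\<^sub>V ?x n))" for T
    by (subst suminf_finite[of "{0}"]) simp_all
qed

lemma normal_functional_compose:
  assumes "\<omega> \<in> normal_functionals"
  shows "(\<lambda>T. \<omega> (A o\<^sub>C\<^sub>L T o\<^sub>C\<^sub>L B)) \<in> normal_functionals"
proof -
  obtain x y where \<omega>: "\<And>T. \<omega> T = (\<Sum>n. cinner (y n) (T *\<^sub>V x n))"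
    and s: "summable (\<lambda>n. (norm (x n))\<^sup>2)" "summable (\<lambda>n. (norm (y n))\<^sup>2)"
    using normal_functional_repr[OF assms] by blast
  show ?thesis
    by (rule normal_functionalsI[where x = "\<lambda>n. B *\<^sub>V x n" and y = "\<lambda>n. adj A *\<^sub>V y n"])
      (simp_all add: \<omega> cinner_adj_left summable_norm_apply s)
qed

lemma normal_functional_adj:
  assumes "\<omega> \<in> normal_functionals"
  shows "\<exists>\<omega>'\<in>normal_functionals. \<forall>T. \<omega> (adj T) = cnj (\<omega>' T)"
proof -
  obtain x y where \<omega>: "\<And>T. \<omega> T = (\<Sum>n. cinner (y n) (T *\<^sub>V x n))"
    and s: "summable (\<lambda>n. (norm (x n))\<^sup>2)" "summable (\<lambda>n. (norm (y n))\<^sup>2)"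
    using normal_functional_repr[OF assms] by blast
  show ?thesis
  proof (intro bexI allI)
    fix T
    have "\<omega> (adj T) = (\<Sum>n. cnj (cinner (x n) (T *\<^sub>V y n)))"
      unfolding \<omega> cinner_adj_right by (subst cinner_commute) simp
    also have "\<dots> = cnj (\<Sum>n. cinner (x n) (T *\<^sub>V y n))"
      by (rule bounded_linear.suminf[OF bounded_linear_cnj summable_cinner_apply[OF s(2) s(1)],
            symmetric])
    finally show "\<omega> (adj T) = cnj (\<Sum>n. cinner (x n) (T *\<^sub>V y n))" .
  qed (rule normal_functionalsI[OF _ s(2) s(1)], simp)
qed

lemma normal_functional_add:
  assumes "\<omega> \<in> normal_functionals"
  shows "\<omega> (S + T) = \<omega> S + \<omega> T"
proof -
  obtain x y where \<omega>: "\<And>T. \<omega> T = (\<Sum>n. cinner (y n) (T *\<^sub>V x n))"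
    and s: "summable (\<lambda>n. (norm (x n))\<^sup>2)" "summable (\<lambda>n. (norm (y n))\<^sup>2)"
    using normal_functional_repr[OF assms] by blast
  show ?thesis
    unfolding \<omega> cblinfun_op_apply cinner_add_right
    by (rule suminf_add[symmetric, OF summable_cinner_apply summable_cinner_apply]; rule s)
qed

lemma topspace_weak_star [simp]:
  "topspace (weak_star :: ('a::chilbert_space, 'b::chilbert_space) cblinfun topology) = UNIV"
proof -
  let ?\<omega> = "\<lambda>T :: ('a, 'b) cblinfun. cinner 0 (T *\<^sub>V 0)"
  have "?\<omega> -` UNIV \<in> {\<omega> -` G | \<omega> G. \<omega> \<in> normal_functionals \<and> open G}"
    using vector_functional_normal[of 0 0]
    by (intro CollectI exI[of _ ?\<omega>] exI[of _ UNIV]) simp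
  then have "UNIV \<subseteq> \<Union> {\<omega> -` G | \<omega> G. \<omega> \<in> (normal_functionals ::
      (('a, 'b) cblinfun \<Rightarrow> complex) set) \<and> open G}"
    unfolding vimage_UNIV by (rule Union_upper)
  then show ?thesis
    unfolding weak_star_def topology_generated_by_topspace by blast
qed

lemma continuous_map_normal_functional:
  assumes "\<omega> \<in> normal_functionals"
  shows "continuous_map weak_star euclidean \<omega>"
  unfolding continuous_map_def
proof (intro conjI allI impI)
  fix U :: "complex set" assume "openin euclidean U"
  then have "openin weak_star (\<omega> -` U)"
    unfolding weak_star_def using assms by (intro topology_generated_by_Basis) auto
  then show "openin weak_star {x \<in> topspace weak_star. \<omega> x \<in> U}"
    by (simp add: vimage_def)
qed auto

lemma continuous_map_weak_starI:
  fixes \<phi> :: "'z \<Rightarrow> ('a::chilbert_space, 'b::chilbert_space) cblinfun"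
  assumes "\<And>\<omega>. \<omega> \<in> normal_functionals \<Longrightarrow> continuous_map Z euclidean (\<lambda>T. \<omega> (\<phi> T))"
  shows "continuous_map Z weak_star \<phi>"
  unfolding weak_star_def
proof (rule continuous_on_generated_topo)
  fix U :: "('a, 'b) cblinfun set"
  assume "U \<in> {\<omega> -` G | \<omega> G. \<omega> \<in> normal_functionals \<and> open G}"
  then obtain \<omega> :: "('a, 'b) cblinfun \<Rightarrow> complex" and G where U: "U = \<omega> -` G" "\<omega> \<in> normal_functionals" "open G" by blast
  then have "openin Z {T \<in> topspace Z. \<omega> (\<phi> T) \<in> G}"
    using openin_continuous_map_preimage[OF assms] by auto
  then show "openin Z (\<phi> -` U \<inter> topspace Z)"
    by (simp add: U(1) vimage_def Int_def conj_commute)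
next
  show "\<phi> ` topspace Z \<subseteq> \<Union> {\<omega> -` G | \<omega> G. \<omega> \<in> normal_functionals \<and> open G}"
    using topspace_weak_star[where 'a = 'a and 'b = 'b]
    unfolding weak_star_def topology_generated_by_topspace by (simp only: subset_UNIV)
qed

lemma continuous_map_compose_weak_star:
  "continuous_map weak_star weak_star (\<lambda>T. A o\<^sub>C\<^sub>L T o\<^sub>C\<^sub>L B)"
  by (intro continuous_map_weak_starI continuous_map_normal_functional normal_functional_compose)

lemma continuous_map_adj_weak_star:
  "continuous_map weak_star weak_star (adj :: ('a::chilbert_space, 'b::chilbert_space) cblinfun \<Rightarrow> _)"
proof (rule continuous_map_weak_starI)
  fix \<omega> :: "('b, 'a) cblinfun \<Rightarrow> complex" assume "\<omega> \<in> normal_functionals"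
  then obtain \<omega>' where \<omega>': "\<omega>' \<in> normal_functionals" "\<And>T. \<omega> (adj T) = cnj (\<omega>' T)"
    using normal_functional_adj by blast
  have "continuous_map weak_star euclidean (cnj \<circ> \<omega>')"
    by (rule continuous_map_compose[OF continuous_map_normal_functional[OF \<omega>'(1)]])
      (simp add: continuous_on_cnj)
  then show "continuous_map weak_star euclidean (\<lambda>T. \<omega> (adj T))"
    by (simp add: \<omega>'(2) o_def)
qed

lemma continuous_map_add_weak_star:
  fixes S :: "('a::chilbert_space, 'b::chilbert_space) cblinfun"
  shows "continuous_map weak_star weak_star (\<lambda>T. T + S)"
proof (rule continuous_map_weak_starI)
  fix \<omega> :: "('a, 'b) cblinfun \<Rightarrow> complex" assume \<omega>: "\<omega> \<in> normal_functionals"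
  have "continuous_map weak_star euclidean ((\<lambda>z. z + \<omega> S) \<circ> \<omega>)"
    by (rule continuous_map_compose[OF continuous_map_normal_functional[OF \<omega>]])
      (simp add: continuous_intros)
  then show "continuous_map weak_star euclidean (\<lambda>T. \<omega> (T + S))"
    by (simp add: normal_functional_add[OF \<omega>] o_def)
qed

text \<open>On bounded sets strong convergence implies w*-convergence: c |x n| |y n| dominates the
  terms of a normal functional, so Tannery's theorem exchanges limit and series. A general filter is
  needed because both sequences of iterates and nets of finite subsets occur.\<close>

lemma limitin_weak_star:
  fixes S :: "('a::chilbert_space, 'b::chilbert_space) cblinfun"
  assumes bound: "\<And>i x. norm (T i *\<^sub>V x) \<le> c * norm x"
    and lim: "\<And>x. ((\<lambda>i. T i *\<^sub>V x) \<longlongrightarrow> S *\<^sub>V x) F" and F: "F \<noteq> bot"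
  shows "limitin weak_star T S F"
proof -
  have \<omega>_lim: "((\<lambda>i. \<omega> (T i)) \<longlongrightarrow> \<omega> S) F" if "\<omega> \<in> normal_functionals" for \<omega> :: "('a, 'b) cblinfun \<Rightarrow> complex"
  proof -
    obtain x y where \<omega>: "\<And>T. \<omega> T = (\<Sum>n. cinner (y n) (T *\<^sub>V x n))"
      and s: "summable (\<lambda>n. (norm (x n))\<^sup>2)" "summable (\<lambda>n. (norm (y n))\<^sup>2)"
      using normal_functional_repr[OF \<open>\<omega> \<in> normal_functionals\<close>] by blast
    show ?thesis
      unfolding \<omega>
    proof (rule tannerys_theorem[THEN conjunct2, THEN conjunct2])
      show "((\<lambda>i. cinner (y n) (T i *\<^sub>V x n)) \<longlongrightarrow> cinner (y n) (S *\<^sub>V x n)) F" for n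
        by (rule bounded_linear.tendsto[OF bounded_linear_cinner_right lim])
      show "\<forall>\<^sub>F (n, i) in at_top \<times>\<^sub>F F.
          norm (cinner (y n) (T i *\<^sub>V x n)) \<le> c * (norm (x n) * norm (y n))"
        by (intro always_eventually) (auto intro: norm_cinner_apply_le bound)
      show "summable (\<lambda>n. c * (norm (x n) * norm (y n)))"
        by (intro summable_mult summable_norm_mult s)
    qed (rule F)
  qed
  have "\<forall>\<^sub>F i in F. T i \<in> U"
    if "generate_topology_on {\<omega> -` G | \<omega> G. \<omega> \<in> normal_functionals \<and> open G} U" "S \<in> U" for U
    using that
  proof induction
    case (Int a b)
    then show ?case by (simp add: eventually_conj)
  next
    case (UN K)
    then obtain X where X: "X \<in> K" "S \<in> X" by blast
    then have "\<forall>\<^sub>F i in F. T i \<in> X" by (rule UN.IH)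
    then show ?case by (rule eventually_mono) (use X(1) in blast)
  next
    case (Basis s)
    then obtain \<omega> :: "('a, 'b) cblinfun \<Rightarrow> complex" and G where s: "s = \<omega> -` G" "\<omega> \<in> normal_functionals" "open G" by blast
    then show ?case
      using topological_tendstoD[OF \<omega>_lim[OF s(2)] s(3)] Basis by auto
  qed simp
  then show ?thesis
    by (simp add: limitin_def weak_star_def[symmetric])
      (simp add: weak_star_def openin_topology_generated_by_iff)
qed

section \<open>Subspaces closed in the w*-topology\<close>

definition wclosed_subspace ::
    "('a::chilbert_space, 'b::chilbert_space) cblinfun set \<Rightarrow> bool"
  where "wclosed_subspace A \<longleftrightarrow> csubspace A \<and> closedin weak_star A"

lemma wclosed_subspaceD:
  assumes "wclosed_subspace A"
  shows "0 \<in> A" "S \<in> A \<Longrightarrow> T \<in> A \<Longrightarrow> S + T \<in> A" "T \<in> A \<Longrightarrow> c *\<^sub>C T \<in> A"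
    "S \<in> A \<Longrightarrow> T \<in> A \<Longrightarrow> S - T \<in> A"
  using assms unfolding wclosed_subspace_def
  by (simp_all add: complex_vector.subspace_0 complex_vector.subspace_add
      complex_vector.subspace_scale complex_vector.subspace_diff)

lemma wclosed_subspace_sum:
  "wclosed_subspace A \<Longrightarrow> (\<And>i. i \<in> F \<Longrightarrow> f i \<in> A) \<Longrightarrow> sum f F \<in> A"
  by (induction F rule: infinite_finite_induct) (auto simp: wclosed_subspaceD)

lemma wclosed_subspace_limit:
  assumes A: "wclosed_subspace A"
    and bound: "\<And>i x. norm (T i *\<^sub>V x) \<le> c * norm x"
    and lim: "\<And>x. ((\<lambda>i. T i *\<^sub>V x) \<longlongrightarrow> S *\<^sub>V x) F" and F: "F \<noteq> bot"
    and mem: "\<forall>\<^sub>F i in F. T i \<in> A"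
  shows "S \<in> A"
  using limitin_closedin[OF limitin_weak_star[OF bound lim F] _ mem F] A
  unfolding wclosed_subspace_def by blast

text \<open>The scalar d may differ from c in order to cover the antilinear map \<open>adj\<close>,
  where d = cnj c.\<close>

lemma wclosed_subspace_preimage:
  assumes A: "wclosed_subspace A" and cont: "continuous_map weak_star weak_star \<phi>"
    and add: "\<And>S T. \<phi> (S + T) = \<phi> S + \<phi> T" and scale: "\<And>c T. \<exists>d. \<phi> (c *\<^sub>C T) = d *\<^sub>C \<phi> T"
  shows "wclosed_subspace {T. \<phi> T \<in> A}"
  unfolding wclosed_subspace_def
proof
  have "\<phi> 0 = 0" using add[of 0 0] by simp
  moreover have "\<phi> (c *\<^sub>C T) \<in> A" if "\<phi> T \<in> A" for c T
    using scale[of c T] wclosed_subspaceD(3)[OF A that] by auto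
  ultimately show "csubspace {T. \<phi> T \<in> A}"
    unfolding complex_vector.subspace_def mem_Collect_eq
    using wclosed_subspaceD(1,2)[OF A] by (simp add: add)
  show "closedin weak_star {T. \<phi> T \<in> A}"
    using closedin_continuous_map_preimage[OF cont, of A] A
    by (simp add: wclosed_subspace_def)
qed

lemma wclosed_subspace_compose_preimage:
  "wclosed_subspace A \<Longrightarrow> wclosed_subspace {T. P o\<^sub>C\<^sub>L T o\<^sub>C\<^sub>L Q \<in> A}"
proof (rule wclosed_subspace_preimage[OF _ continuous_map_compose_weak_star])
  show "P o\<^sub>C\<^sub>L (S + T) o\<^sub>C\<^sub>L Q = P o\<^sub>C\<^sub>L S o\<^sub>C\<^sub>L Q + P o\<^sub>C\<^sub>L T o\<^sub>C\<^sub>L Q" for S T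
    by (rule cblinfun_eqI) simp
  have "P o\<^sub>C\<^sub>L c *\<^sub>C T o\<^sub>C\<^sub>L Q = c *\<^sub>C (P o\<^sub>C\<^sub>L T o\<^sub>C\<^sub>L Q)" for c T
    by (rule cblinfun_eqI) simp
  then show "\<exists>d. P o\<^sub>C\<^sub>L c *\<^sub>C T o\<^sub>C\<^sub>L Q = d *\<^sub>C (P o\<^sub>C\<^sub>L T o\<^sub>C\<^sub>L Q)" for c T
    by blast
qed

lemma wclosed_subspace_adj_preimage:
  "wclosed_subspace A \<Longrightarrow> wclosed_subspace {T. adj T \<in> A}"
  by (rule wclosed_subspace_preimage[OF _ continuous_map_adj_weak_star])
    (simp, simp, use adj_scaleC in blast)

lemma wspan_superset: "S \<subseteq> wspan S"
  unfolding wspan_def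
  using complex_vector.span_superset[of S] closure_of_subset[of "cspan S" weak_star] by auto

text \<open>The induction principle behind the closure arguments below: a property of operators that
  defines a w*-closed subspace needs to be checked on generators only.\<close>

lemma wspan_induct:
  assumes "T \<in> wspan S" "wclosed_subspace A" "S \<subseteq> A"
  shows "T \<in> A"
proof -
  have "cspan S \<subseteq> A"
    using assms(2,3) unfolding wclosed_subspace_def
    by (intro complex_vector.span_minimal) auto
  then have "wspan S \<subseteq> A"
    using assms(2) unfolding wspan_def wclosed_subspace_def by (intro closure_of_minimal) auto
  then show ?thesis using assms(1) by auto
qed

lemma wclosed_subspace_wspan:
  fixes S :: "('a::chilbert_space, 'b::chilbert_space) cblinfun set"
  shows "wclosed_subspace (wspan S)"
proof -
  let ?V = "cspan S"
  have closed: "closedin weak_star (wspan S)" by (simp add: wspan_def)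
  have ext: "\<phi> T \<in> wspan S"
    if "continuous_map weak_star weak_star \<phi>" "\<And>T. T \<in> ?V \<Longrightarrow> \<phi> T \<in> wspan S" "T \<in> wspan S" for \<phi> T
  proof -
    have "closedin weak_star {T. \<phi> T \<in> wspan S}"
      using closedin_continuous_map_preimage[OF that(1) closed] by simp
    then have "wspan S \<subseteq> {T. \<phi> T \<in> wspan S}"
      using that(2) unfolding wspan_def[of S] by (intro closure_of_minimal) auto
    then show ?thesis using that(3) by auto
  qed
  have V: "?V \<subseteq> wspan S"
    unfolding wspan_def by (rule closure_of_subset) simp
  \<comment> \<open>Closure under sums takes two passes, using only translations by a fixed
    operator: first one summand is extended from the span to its closure, then the other.\<close>
  have add1: "T + R \<in> wspan S" if "R \<in> ?V" "T \<in> wspan S" for T R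
    by (rule ext[OF continuous_map_add_weak_star _ that(2)])
      (use V that(1) complex_vector.span_add in blast)
  have add2: "T + R \<in> wspan S" if "R \<in> wspan S" "T \<in> wspan S" for T R
    by (rule ext[OF continuous_map_add_weak_star _ that(2)])
      (use add1 that(1) in \<open>simp add: add.commute\<close>)
  have scale: "c *\<^sub>C T \<in> wspan S" if "T \<in> wspan S" for c T
  proof -
    define I where "I = Cblinfun (\<lambda>x :: 'b. c *\<^sub>C x)"
    define J where "J = Cblinfun (\<lambda>x :: 'a. x)"
    have I: "I *\<^sub>V x = c *\<^sub>C x" for x
      unfolding I_def by (rule Cblinfun_apply[where K = "cmod c"])
        (simp_all add: scaleC_add_right scaleC_scaleC mult.commute norm_scaleC)
    have J: "J *\<^sub>V x = x" for x
      unfolding J_def by (rule Cblinfun_apply[where K = 1]) simp_all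
    have eq: "I o\<^sub>C\<^sub>L T o\<^sub>C\<^sub>L J = c *\<^sub>C T" for T
      by (rule cblinfun_eqI) (simp add: I J)
    have "continuous_map weak_star weak_star (\<lambda>T. c *\<^sub>C T :: ('a, 'b) cblinfun)"
      using continuous_map_compose_weak_star[of I J] by (simp add: eq)
    then show ?thesis
      by (rule ext[OF _ _ that]) (use V complex_vector.span_scale in blast)
  qed
  have "0 \<in> wspan S" using V complex_vector.span_zero by blast
  then show ?thesis
    unfolding wclosed_subspace_def complex_vector.subspace_def using closed add2 scale by blast
qed

text \<open>Vanishing at x is detected by the normal functionals T |-> cinner y (T x), so the set is
  an intersection of w*-closed sets.\<close>

lemma wclosed_subspace_annihilator: "wclosed_subspace {T. T *\<^sub>V x = 0}"
proof -
  have eq: "{T. T *\<^sub>V x = 0} = (\<Inter>y. {T \<in> topspace weak_star. cinner y (T *\<^sub>V x) \<in> {0}})"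
    using cinner_eqI[of "_ *\<^sub>V x" 0] by (auto simp: cinner_commute[of _ "_ *\<^sub>V x"])
  have "closedin weak_star {T. T *\<^sub>V x = 0}"
    unfolding eq
    by (intro closedin_INT closedin_continuous_map_preimage[OF
          continuous_map_normal_functional[OF vector_functional_normal]]) auto
  then show ?thesis
    by (simp add: wclosed_subspace_def complex_vector.subspace_def)
qed

section \<open>Matrix entries\<close>

lemma wclosed_subspace_INT: "(\<And>i. wclosed_subspace (A i)) \<Longrightarrow> wclosed_subspace (\<Inter>i. A i)"
  unfolding wclosed_subspace_def complex_vector.subspace_def by (auto intro: closedin_INT)

definition id_op :: "('a::chilbert_space, 'a) cblinfun"
  where "id_op = Cblinfun (\<lambda>x. x)"

lemma id_op_apply [simp]: "id_op *\<^sub>V x = x"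
  unfolding id_op_def by (rule Cblinfun_apply[where K = 1]) simp_all

lemma id_op_compose [simp]: "id_op o\<^sub>C\<^sub>L T = T" "T o\<^sub>C\<^sub>L id_op = T"
  by (rule cblinfun_eqI; simp)+

lift_definition ell2_single :: "'j \<Rightarrow> 'a::chilbert_space \<Rightarrow> ('j, 'a) ell2"
  is "\<lambda>i h j. if j = i then h else 0"
  subgoal for i h
    by (rule finite_nonzero_values_imp_summable_on, rule finite_subset[of _ "{i}"]) auto
  done

lemma ell2_nth_single: "ell2_nth (ell2_single i h) j = (if j = i then h else 0)"
  by transfer simp

lemma cinner_single_right: "cinner \<xi> (ell2_single i h) = cinner (ell2_nth \<xi> i) h"
proof -
  have "cinner \<xi> (ell2_single i h) = (\<Sum>\<^sub>\<infinity>j\<in>{i}. cinner (ell2_nth \<xi> j) (ell2_nth (ell2_single i h) j))"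
    unfolding cinner_ell2_def by (rule infsum_cong_neutral) (auto simp: ell2_nth_single)
  then show ?thesis by (simp add: ell2_nth_single)
qed

lemma norm_single: "norm (ell2_single i h) = norm h"
proof -
  have "(norm (ell2_single i h))\<^sup>2 = (norm h)\<^sup>2"
    by (simp add: cinner_single_right ell2_nth_single flip: cinner_self_Re)
  then show ?thesis by (simp add: power2_eq_iff_nonneg)
qed

definition ell2_inj :: "'j \<Rightarrow> ('a::chilbert_space, ('j, 'a) ell2) cblinfun"
  where "ell2_inj i = Cblinfun (ell2_single i)"

definition ell2_proj :: "'j \<Rightarrow> (('j, 'a::chilbert_space) ell2, 'a) cblinfun"
  where "ell2_proj i = Cblinfun (\<lambda>\<xi>. ell2_nth \<xi> i)"

lemma ell2_inj_apply [simp]: "ell2_inj i *\<^sub>V h = ell2_single i h"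
  unfolding ell2_inj_def
  by (rule Cblinfun_apply[where K = 1])
    (auto intro!: ell2_eqI simp: ell2_nth_simps ell2_nth_single norm_single)

lemma ell2_proj_apply [simp]: "ell2_proj i *\<^sub>V \<xi> = ell2_nth \<xi> i"
  unfolding ell2_proj_def
  by (rule Cblinfun_apply[where K = 1]) (simp_all add: ell2_nth_simps ell2_nth_norm_le)

lemma adj_ell2_inj [simp]: "adj (ell2_inj i) = ell2_proj i"
  by (rule adjI) (simp add: cinner_single_right)

lemma adj_ell2_proj [simp]: "adj (ell2_proj i) = ell2_inj i"
  by (metis adj_adj adj_ell2_inj)

lemma ell2_norm_has_sum: "((\<lambda>j. (norm (ell2_nth \<xi> j))\<^sup>2) has_sum (norm \<xi>)\<^sup>2) UNIV"
  unfolding ell2_norm_power2 by (rule has_sum_infsum[OF ell2_nth_summable])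

definition ell2_trunc :: "'j set \<Rightarrow> ('j, 'a::chilbert_space) ell2 \<Rightarrow> ('j, 'a) ell2"
  where "ell2_trunc F \<xi> = (\<Sum>i\<in>F. ell2_single i (ell2_nth \<xi> i))"

lemma inner_single_right: "inner \<xi> (ell2_single i h) = inner (ell2_nth \<xi> i) h"
  by (simp add: inner_eq_Re_cinner cinner_single_right)

lemma norm_sum_single:
  assumes "finite F"
  shows "(norm (\<Sum>i\<in>F. ell2_single i (f i)))\<^sup>2 = (\<Sum>i\<in>F. (norm (f i))\<^sup>2)"
proof -
  have "ell2_nth (\<Sum>i\<in>F. ell2_single i (f i)) j = (if j \<in> F then f j else 0)" for j
  proof -
    have "ell2_proj j *\<^sub>V (\<Sum>i\<in>F. ell2_single i (f i)) = (\<Sum>i\<in>F. if i = j then f j else 0)"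
      by (simp only: cblinfun_apply_sum) (auto intro!: sum.cong simp: ell2_nth_single)
    then show ?thesis using assms by simp
  qed
  then have "inner (\<Sum>i\<in>F. ell2_single i (f i)) (\<Sum>i\<in>F. ell2_single i (f i))
      = (\<Sum>i\<in>F. inner (f i) (f i))"
    by (simp add: inner_sum_right inner_single_right)
  then show ?thesis by (simp add: power2_norm_eq_inner)
qed

lemma norm_trunc_diff:
  assumes "finite F"
  shows "(norm (\<xi> - ell2_trunc F \<xi>))\<^sup>2 = (norm \<xi>)\<^sup>2 - (\<Sum>i\<in>F. (norm (ell2_nth \<xi> i))\<^sup>2)"
proof -
  have "inner \<xi> (ell2_trunc F \<xi>) = (\<Sum>i\<in>F. (norm (ell2_nth \<xi> i))\<^sup>2)"
    by (simp add: ell2_trunc_def inner_sum_right inner_single_right power2_norm_eq_inner)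
  moreover have "inner (ell2_trunc F \<xi>) (ell2_trunc F \<xi>) = (\<Sum>i\<in>F. (norm (ell2_nth \<xi> i))\<^sup>2)"
    using norm_sum_single[OF assms, of "ell2_nth \<xi>"]
    by (simp add: ell2_trunc_def power2_norm_eq_inner)
  ultimately show ?thesis
    unfolding power2_norm_eq_inner[of "\<xi> - _"] power2_norm_eq_inner[of \<xi>]
    by (simp add: inner_diff_left inner_diff_right inner_commute)
qed

lemma norm_trunc_le: "norm (ell2_trunc F \<xi>) \<le> norm \<xi>"
proof (cases "finite F")
  case True
  have "(norm (ell2_trunc F \<xi>))\<^sup>2 \<le> (norm \<xi>)\<^sup>2"
    using ell2_sum_le[OF True, of \<xi>] norm_sum_single[OF True, of "ell2_nth \<xi>"]
    by (simp add: ell2_trunc_def)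
  then show ?thesis by (simp add: power2_le_iff_abs_le)
qed (simp add: ell2_trunc_def)

lemma ell2_trunc_tendsto: "((\<lambda>F. ell2_trunc F \<xi>) \<longlongrightarrow> \<xi>) (finite_subsets_at_top UNIV)"
proof -
  have "((\<lambda>F. (norm \<xi>)\<^sup>2 - (\<Sum>i\<in>F. (norm (ell2_nth \<xi> i))\<^sup>2)) \<longlongrightarrow> (norm \<xi>)\<^sup>2 - (norm \<xi>)\<^sup>2)
      (finite_subsets_at_top UNIV)"
    using ell2_norm_has_sum[of \<xi>] unfolding has_sum_def by (intro tendsto_intros)
  moreover have "\<forall>\<^sub>F F in finite_subsets_at_top UNIV.
      (norm \<xi>)\<^sup>2 - (\<Sum>i\<in>F. (norm (ell2_nth \<xi> i))\<^sup>2) = (norm (\<xi> - ell2_trunc F \<xi>))\<^sup>2"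
    by (rule eventually_finite_subsets_at_top_weakI) (simp add: norm_trunc_diff)
  ultimately have "((\<lambda>F. (norm (\<xi> - ell2_trunc F \<xi>))\<^sup>2) \<longlongrightarrow> 0) (finite_subsets_at_top UNIV)"
    using Lim_transform_eventually by fastforce
  then have "((\<lambda>F. sqrt ((norm (\<xi> - ell2_trunc F \<xi>))\<^sup>2)) \<longlongrightarrow> sqrt 0) (finite_subsets_at_top UNIV)"
    by (rule tendsto_real_sqrt)
  then show ?thesis
    by (simp add: tendsto_norm_zero_iff tendsto_iff dist_norm norm_minus_commute)
qed

lemma ell2_has_sum_single: "((\<lambda>i. ell2_single i (ell2_nth \<xi> i)) has_sum \<xi>) UNIV"
  using ell2_trunc_tendsto unfolding has_sum_def ell2_trunc_def .

lemma cblinfun_ell2_eqI: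
  fixes S T :: "(('j, 'a::chilbert_space) ell2, 'b::chilbert_space) cblinfun"
  assumes "\<And>i h. S *\<^sub>V ell2_single i h = T *\<^sub>V ell2_single i h"
  shows "S = T"
proof (rule cblinfun_eqI)
  fix \<xi>
  have lim: "((\<lambda>F. R *\<^sub>V ell2_trunc F \<xi>) \<longlongrightarrow> R *\<^sub>V \<xi>) (finite_subsets_at_top UNIV)"
    for R :: "(('j, 'a) ell2, 'b) cblinfun"
    by (rule bounded_linear.tendsto[OF bounded_linear_cblinfun_apply ell2_trunc_tendsto])
  have eq: "S *\<^sub>V ell2_trunc F \<xi> = T *\<^sub>V ell2_trunc F \<xi>" for F
    by (simp add: ell2_trunc_def cblinfun_apply_sum assms)
  show "S *\<^sub>V \<xi> = T *\<^sub>V \<xi>"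
    using tendsto_unique[OF _ lim[of S] lim[of T, folded eq]] by simp
qed

text \<open>Products over \<open>\<ell>\<^sup>2\<^sub>J\<close> are w*-limits of their finite partial sums.\<close>

lemma wclosed_subspace_compose_ell2:
  assumes Y: "wclosed_subspace Y"
    and mem: "\<And>i. R o\<^sub>C\<^sub>L (ell2_inj i o\<^sub>C\<^sub>L ell2_proj i) o\<^sub>C\<^sub>L V \<in> Y"
  shows "R o\<^sub>C\<^sub>L V \<in> Y"
proof -
  obtain r where r: "0 < r" "\<And>x. norm (R *\<^sub>V x) \<le> r * norm x"
    using cblinfun_bound[of R] by metis
  obtain v where v: "0 < v" "\<And>x. norm (V *\<^sub>V x) \<le> v * norm x"
    using cblinfun_bound[of V] by metis
  \<comment> \<open>These truncated products are bounded by r * v uniformly in F, which is what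
    allows their strong limit to be read as a w*-limit.\<close>
  define T where "T F = (\<Sum>i\<in>F. R o\<^sub>C\<^sub>L (ell2_inj i o\<^sub>C\<^sub>L ell2_proj i) o\<^sub>C\<^sub>L V)" for F
  have T: "T F *\<^sub>V x = R *\<^sub>V ell2_trunc F (V *\<^sub>V x)" for F x
    by (simp add: T_def ell2_trunc_def cblinfun_apply_sum)
  show ?thesis
  proof (rule wclosed_subspace_limit[OF Y, where T = T and c = "r * v"
        and F = "finite_subsets_at_top UNIV"])
    fix F x
    have "norm (T F *\<^sub>V x) \<le> r * norm (ell2_trunc F (V *\<^sub>V x))" unfolding T by (rule r)
    also have "\<dots> \<le> r * norm (V *\<^sub>V x)" using r(1) by (intro mult_left_mono norm_trunc_le) auto
    also have "\<dots> \<le> r * (v * norm x)" using r(1) by (intro mult_left_mono v) auto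
    finally show "norm (T F *\<^sub>V x) \<le> r * v * norm x" by simp
  next
    fix x
    show "((\<lambda>F. T F *\<^sub>V x) \<longlongrightarrow> (R o\<^sub>C\<^sub>L V) *\<^sub>V x) (finite_subsets_at_top UNIV)"
      unfolding T cblinfun_op_apply
      by (rule bounded_linear.tendsto[OF bounded_linear_cblinfun_apply ell2_trunc_tendsto])
  next
    show "\<forall>\<^sub>F F in finite_subsets_at_top UNIV. T F \<in> Y"
      unfolding T_def by (intro always_eventually allI wclosed_subspace_sum[OF Y] mem)
  qed simp
qed

definition entry ::
  "'i \<Rightarrow> 'j \<Rightarrow> (('j, 'a::chilbert_space) ell2, ('i, 'b::chilbert_space) ell2) cblinfun
    \<Rightarrow> ('a, 'b) cblinfun"
  where "entry i j z = ell2_proj i o\<^sub>C\<^sub>L z o\<^sub>C\<^sub>L ell2_inj j"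

lemma entry_apply [simp]: "entry i j z *\<^sub>V h = ell2_nth (z *\<^sub>V ell2_single j h) i"
  by (simp add: entry_def)

lemma entry_adj: "entry i j (adj z) = adj (entry j i z)"
  by (simp add: entry_def compose_assoc)

text \<open>The product is expanded over its two inner indices, l with k fixed and then k. Each
  expansion is a w*-limit of finite sums, so relations such as N2 X (adj N1) \<subseteq> Y pass from
  spaces of operators to matrices with entries in them.\<close>

lemma entry_triple_mem:
  assumes Y: "wclosed_subspace Y"
    and mem: "\<And>k l. entry i k u o\<^sub>C\<^sub>L entry k l z o\<^sub>C\<^sub>L entry l j w \<in> Y"
  shows "entry i j (u o\<^sub>C\<^sub>L z o\<^sub>C\<^sub>L w) \<in> Y"
proof -
  have 1: "(ell2_proj i o\<^sub>C\<^sub>L u o\<^sub>C\<^sub>L ell2_inj k o\<^sub>C\<^sub>L ell2_proj k o\<^sub>C\<^sub>L z) o\<^sub>C\<^sub>L (w o\<^sub>C\<^sub>L ell2_inj j) \<in> Y" for k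
    by (rule wclosed_subspace_compose_ell2[OF Y]) (use mem[of k] in \<open>simp add: entry_def compose_assoc\<close>)
  have "(ell2_proj i o\<^sub>C\<^sub>L u) o\<^sub>C\<^sub>L (z o\<^sub>C\<^sub>L w o\<^sub>C\<^sub>L ell2_inj j) \<in> Y"
    by (rule wclosed_subspace_compose_ell2[OF Y]) (use 1 in \<open>simp add: compose_assoc\<close>)
  then show ?thesis by (simp add: entry_def compose_assoc)
qed

lemma wclosed_subspace_entries:
  fixes X :: "('a::chilbert_space, 'b::chilbert_space) cblinfun set"
  assumes "wclosed_subspace X"
  shows "wclosed_subspace {z :: (('j, 'a) ell2, ('i, 'b) ell2) cblinfun. \<forall>i j. entry i j z \<in> X}"
proof -
  have "{z :: (('j, 'a) ell2, ('i, 'b) ell2) cblinfun. \<forall>i j. entry i j z \<in> X}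
      = (\<Inter>i. \<Inter>j. {z. ell2_proj i o\<^sub>C\<^sub>L z o\<^sub>C\<^sub>L ell2_inj j \<in> X})"
    by (auto simp: entry_def)
  then show ?thesis
    by (simp only: wclosed_subspace_INT wclosed_subspace_compose_preimage assms)
qed

section \<open>Tensor products\<close>

lemma ell2_nth_tensor_vec: "ell2_nth (tensor_vec h \<eta>) j = ell2_nth \<eta> j *\<^sub>C h"
  by transfer simp

lemma cinner_tensor_vec:
  "cinner (tensor_vec h \<eta>) (tensor_vec k \<zeta>) = cinner h k * cinner \<eta> \<zeta>"
proof -
  have "cinner (tensor_vec h \<eta>) (tensor_vec k \<zeta>)
      = (\<Sum>\<^sub>\<infinity>j. cinner h k * cinner (ell2_nth \<eta> j) (ell2_nth \<zeta> j))"
    unfolding cinner_ell2_def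
    by (simp add: ell2_nth_tensor_vec cinner_scaleC_left cinner_scaleC_right cinner_complex_def ac_simps)
  also have "\<dots> = cinner h k * cinner \<eta> \<zeta>"
    unfolding cinner_ell2_def by (rule infsum_cmult_right')
  finally show ?thesis .
qed

lemma norm_tensor_vec: "norm (tensor_vec h \<eta>) = norm h * norm \<eta>"
proof -
  have "complex_of_real ((norm (tensor_vec h \<eta>))\<^sup>2) = complex_of_real ((norm h * norm \<eta>)\<^sup>2)"
    using cinner_tensor_vec[of h \<eta> h \<eta>] unfolding cinner_self
    by (simp add: power_mult_distrib)
  then show ?thesis
    unfolding of_real_eq_iff by (simp add: power2_eq_iff_nonneg)
qed

lemma tensor_vec_linear:
  "tensor_vec (h + k) \<eta> = tensor_vec h \<eta> + tensor_vec k \<eta>"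
  "tensor_vec (h - k) \<eta> = tensor_vec h \<eta> - tensor_vec k \<eta>"
  "tensor_vec h (\<eta> + \<zeta>) = tensor_vec h \<eta> + tensor_vec h \<zeta>"
  "tensor_vec (c *\<^sub>C h) \<eta> = c *\<^sub>C tensor_vec h \<eta>"
  "tensor_vec h (c *\<^sub>C \<eta>) = c *\<^sub>C tensor_vec h \<eta>"
  by (rule ell2_eqI; simp add: ell2_nth_simps ell2_nth_tensor_vec scaleC_add_right scaleC_add_left
      scaleC_scaleC complex_vector.scale_right_diff_distrib scaleC_complex_def mult.commute)+

lemma tensor_vec_zero [simp]: "tensor_vec 0 \<eta> = 0" "tensor_vec h 0 = 0"
  by (rule ell2_eqI; simp add: ell2_nth_simps ell2_nth_tensor_vec)+

lemma tensor_vec_sum: "tensor_vec h (\<Sum>i\<in>F. f i) = (\<Sum>i\<in>F. tensor_vec h (f i))"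
  by (induction F rule: infinite_finite_induct) (simp_all add: tensor_vec_linear)

lemma bounded_linear_tensor_vec: "bounded_linear (tensor_vec h)"
  by (rule bounded_linear_intro[where K = "norm h"])
    (simp_all add: tensor_vec_linear scaleR_scaleC norm_tensor_vec mult.commute)

lemma norm_add_orthogonal:
  assumes "cinner x y = 0"
  shows "(norm (x + y))\<^sup>2 = (norm x)\<^sup>2 + (norm (y :: 'a::chilbert_space))\<^sup>2"
proof -
  have "inner x y = 0" using assms by (simp add: inner_eq_Re_cinner)
  then show ?thesis
    by (simp add: power2_norm_eq_inner inner_add_left inner_add_right inner_commute)
qed

text \<open>Splitting off the component along one of the vectors \<open>h j\<close> makes the two parts of the sum
  orthogonal, both before and after applying \<open>a\<close>.\<close>

lemma norm_tensor_sum_le: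
  assumes "finite F" and a: "\<And>\<eta>. norm (a *\<^sub>V \<eta>) \<le> c * norm \<eta>"
  shows "(norm (\<Sum>j\<in>F. tensor_vec (h j) (a *\<^sub>V \<eta> j)))\<^sup>2
    \<le> c\<^sup>2 * (norm (\<Sum>j\<in>F. tensor_vec (h j) (\<eta> j)))\<^sup>2"
  using assms(1)
proof (induction F arbitrary: h rule: finite_induct)
  case (insert n F)
  \<comment> \<open>The coefficient of the projection of h j onto h n. If h n = 0, division by zero
    gives 0 and orthogonality is trivial.\<close>
  define d where "d j = cinner (h n) (h j) / cinner (h n) (h n)" for j
  define h' where "h' j = h j - d j *\<^sub>C h n" for j
  define \<zeta> where "\<zeta> = \<eta> n + (\<Sum>j\<in>F. d j *\<^sub>C \<eta> j)"
  have orth: "cinner (h n) (h' j) = 0" for j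
    by (cases "h n = 0") (simp_all add: h'_def d_def cinner_diff cinner_scaleC_right cinner_self)
  have split: "(\<Sum>j\<in>insert n F. tensor_vec (h j) (b *\<^sub>V \<eta> j))
      = tensor_vec (h n) (b *\<^sub>V \<zeta>) + (\<Sum>j\<in>F. tensor_vec (h' j) (b *\<^sub>V \<eta> j))" for b
  proof -
    have "tensor_vec (h' j) (b *\<^sub>V \<eta> j)
        = tensor_vec (h j) (b *\<^sub>V \<eta> j) - tensor_vec (h n) (d j *\<^sub>C (b *\<^sub>V \<eta> j))" for j
      by (simp add: h'_def tensor_vec_linear)
    then show ?thesis
      using insert.hyps
      by (simp add: \<zeta>_def tensor_vec_linear tensor_vec_sum cblinfun_apply_sum sum_subtractf
          del: tensor_vec_linear(5))
  qed
  have norms: "(norm (\<Sum>j\<in>insert n F. tensor_vec (h j) (b *\<^sub>V \<eta> j)))\<^sup>2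
      = (norm (h n))\<^sup>2 * (norm (b *\<^sub>V \<zeta>))\<^sup>2
        + (norm (\<Sum>j\<in>F. tensor_vec (h' j) (b *\<^sub>V \<eta> j)))\<^sup>2" for b
    unfolding split
    by (subst norm_add_orthogonal)
      (simp_all add: cinner_sum_right cinner_tensor_vec orth norm_tensor_vec
        power_mult_distrib)
  have 1: "(norm (a *\<^sub>V \<zeta>))\<^sup>2 \<le> c\<^sup>2 * (norm \<zeta>)\<^sup>2"
    using power_mono[OF a[of \<zeta>], of 2] by (simp add: power_mult_distrib)
  have "(norm (h n))\<^sup>2 * (norm (a *\<^sub>V \<zeta>))\<^sup>2
        + (norm (\<Sum>j\<in>F. tensor_vec (h' j) (a *\<^sub>V \<eta> j)))\<^sup>2
      \<le> (norm (h n))\<^sup>2 * (c\<^sup>2 * (norm \<zeta>)\<^sup>2)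
        + c\<^sup>2 * (norm (\<Sum>j\<in>F. tensor_vec (h' j) (\<eta> j)))\<^sup>2"
    by (intro add_mono mult_left_mono 1 insert.IH) simp
  also have "\<dots> = c\<^sup>2 * (norm (\<Sum>j\<in>insert n F. tensor_vec (h j) (\<eta> j)))\<^sup>2"
    using norms[of id_op] by (simp add: algebra_simps)
  finally show ?case using norms[of a] by simp
qed simp

text \<open>Serves series whose terms are not orthogonal, where only finite sums are controlled. The
  difference of two partial sums is dominated by a tail of g, so the net of partial sums is
  Cauchy.\<close>

lemma summable_on_norm_square_le:
  fixes f :: "'i \<Rightarrow> 'a::banach"
  assumes g: "g summable_on UNIV"
    and le: "\<And>F. finite F \<Longrightarrow> (norm (sum f F))\<^sup>2 \<le> sum g F"
  shows "f summable_on UNIV"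
proof -
  obtain s where s: "(g has_sum s) UNIV" using g by (auto simp: summable_on_def)
  have "cauchy_filter (filtermap (sum f) (finite_subsets_at_top UNIV))"
    unfolding cauchy_filter_metric_filtermap
  proof (intro allI impI)
    fix e :: real assume e: "0 < e"
    define \<delta> where "\<delta> = (e / 2)\<^sup>2 / 2"
    have \<delta>: "0 < \<delta>" using e by (simp add: \<delta>_def)
    have "\<forall>\<^sub>F F in finite_subsets_at_top UNIV. dist (sum g F) s < \<delta>"
      using s \<delta> unfolding has_sum_def by (rule tendstoD)
    then obtain F0 where F0: "finite F0"
      "\<And>F. finite F \<Longrightarrow> F0 \<subseteq> F \<Longrightarrow> dist (sum g F) s < \<delta>"
      unfolding eventually_finite_subsets_at_top by auto
    have small: "norm (sum f F - sum f F0) < e / 2" if "finite F" "F0 \<subseteq> F" for F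
    proof -
      have "(norm (sum f F - sum f F0))\<^sup>2 = (norm (sum f (F - F0)))\<^sup>2"
        using that by (simp add: sum_diff)
      also have "\<dots> \<le> sum g (F - F0)" using that by (intro le) simp
      also have "\<dots> = sum g F - sum g F0" using that by (simp add: sum_diff)
      also have "\<dots> < \<delta> + \<delta>"
        using F0(2)[OF that] F0(2)[OF F0(1) order_refl] unfolding dist_real_def by arith
      also have "\<dots> = (e / 2)\<^sup>2" by (simp add: \<delta>_def)
      finally show ?thesis by (rule power2_less_imp_less) (use e in simp)
    qed
    show "\<exists>P. eventually P (finite_subsets_at_top UNIV) \<and>
        (\<forall>F G. P F \<and> P G \<longrightarrow> dist (sum f F) (sum f G) < e)"
    proof (intro exI[of _ "\<lambda>F. finite F \<and> F0 \<subseteq> F"] conjI allI impI)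
      show "\<forall>\<^sub>F F in finite_subsets_at_top UNIV. finite F \<and> F0 \<subseteq> F"
        unfolding eventually_finite_subsets_at_top using F0(1) by auto
      fix F G assume "(finite F \<and> F0 \<subseteq> F) \<and> finite G \<and> F0 \<subseteq> G"
      then have "dist (sum f F) (sum f F0) < e / 2" "dist (sum f G) (sum f F0) < e / 2"
        using small by (auto simp: dist_norm)
      then show "dist (sum f F) (sum f G) < e"
        by (rule dist_triangle_half_r[of "sum f F0", unfolded dist_commute[of "sum f F0"]])
    qed
  qed
  moreover have "complete (UNIV :: 'a set)"
    by (meson Cauchy_convergent UNIV_I complete_def convergent_def)
  ultimately obtain l where "filtermap (sum f) (finite_subsets_at_top UNIV) \<le> nhds l"
    unfolding complete_uniform
    by (metis filtermap_bot_iff finite_subsets_at_top_neq_bot principal_UNIV top_greatest)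
  then show ?thesis
    unfolding summable_on_def has_sum_def filterlim_def by blast
qed

text \<open>The operator sends \<xi> to the sum over j of x \<xi>_j \<otimes> a e_j. The terms are
  not orthogonal in general, but \<open>norm_tensor_sum_le\<close> bounds their finite sums by those
  with a = 1, which are orthogonal.\<close>

lemma tensor_op_exists:
  fixes x :: "('a::chilbert_space, 'b::chilbert_space) cblinfun"
    and a :: "(('j, complex) ell2, ('j, complex) ell2) cblinfun"
  shows "\<exists>T. \<forall>h \<eta>. T *\<^sub>V tensor_vec h \<eta> = tensor_vec (x *\<^sub>V h) (a *\<^sub>V \<eta>)"
proof -
  obtain c where c: "0 < c" "\<And>\<eta>. norm (a *\<^sub>V \<eta>) \<le> c * norm \<eta>"
    using cblinfun_bound[of a] by metis
  obtain d where d: "0 < d" "\<And>h. norm (x *\<^sub>V h) \<le> d * norm h"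
    using cblinfun_bound[of x] by metis
  define e :: "'j \<Rightarrow> ('j, complex) ell2" where "e j = ell2_single j 1" for j
  define f where "f \<xi> j = tensor_vec (x *\<^sub>V ell2_nth \<xi> j) (a *\<^sub>V e j)" for \<xi> j
  have te: "tensor_vec h (e j) = ell2_single j h" for h :: 'b and j
    by (rule ell2_eqI) (simp add: e_def ell2_nth_tensor_vec ell2_nth_single scaleC_one)
  have bound: "(norm (sum (f \<xi>) F))\<^sup>2 \<le> (\<Sum>j\<in>F. (c * d)\<^sup>2 * (norm (ell2_nth \<xi> j))\<^sup>2)"
    if "finite F" for \<xi> F
  proof -
    have "(norm (sum (f \<xi>) F))\<^sup>2 \<le> c\<^sup>2 * (norm (\<Sum>j\<in>F. tensor_vec (x *\<^sub>V ell2_nth \<xi> j) (e j)))\<^sup>2"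
      unfolding f_def by (rule norm_tensor_sum_le[OF that c(2)])
    also have "\<dots> = c\<^sup>2 * (\<Sum>j\<in>F. (norm (x *\<^sub>V ell2_nth \<xi> j))\<^sup>2)"
      by (simp add: te norm_sum_single[OF that])
    also have "\<dots> \<le> c\<^sup>2 * (\<Sum>j\<in>F. (d * norm (ell2_nth \<xi> j))\<^sup>2)"
      by (intro mult_left_mono sum_mono power_mono d) auto
    finally show ?thesis by (simp add: sum_distrib_left power_mult_distrib mult.assoc)
  qed
  have summ: "f \<xi> summable_on UNIV" for \<xi>
    by (rule summable_on_norm_square_le[OF _ bound])
      (intro summable_on_cmult_right ell2_nth_summable)
  define g where "g \<xi> = infsum (f \<xi>) UNIV" for \<xi>
  have hs: "(f \<xi> has_sum g \<xi>) UNIV" for \<xi> unfolding g_def by (rule has_sum_infsum[OF summ])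
  have app: "Cblinfun g *\<^sub>V \<xi> = g \<xi>" for \<xi>
  proof (rule Cblinfun_apply)
    fix \<xi> \<zeta> :: "('j, 'a) ell2" and r :: complex
    have "f (\<xi> + \<zeta>) = (\<lambda>j. f \<xi> j + f \<zeta> j)"
      by (simp add: f_def fun_eq_iff ell2_nth_simps tensor_vec_linear)
    then show "g (\<xi> + \<zeta>) = g \<xi> + g \<zeta>"
      by (simp add: g_def infsum_add summ)
    have "f (r *\<^sub>C \<xi>) = (\<lambda>j. r *\<^sub>C f \<xi> j)"
      by (simp add: f_def fun_eq_iff ell2_nth_simps tensor_vec_linear)
    then show "g (r *\<^sub>C \<xi>) = r *\<^sub>C g \<xi>"
      using infsumI[OF has_sum_bounded_linear[OF bounded_linear_scaleC hs[of \<xi>]]]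
      by (simp add: g_def o_def)
    have "norm (sum (f \<xi>) F) \<le> c * d * norm \<xi>" if "finite F" for F
    proof -
      have "(norm (sum (f \<xi>) F))\<^sup>2 \<le> (c * d)\<^sup>2 * (\<Sum>j\<in>F. (norm (ell2_nth \<xi> j))\<^sup>2)"
        using bound[OF that] by (simp add: sum_distrib_left)
      also have "\<dots> \<le> (c * d * norm \<xi>)\<^sup>2"
        unfolding power_mult_distrib[of _ "norm \<xi>"]
        by (intro mult_left_mono ell2_sum_le that) simp
      finally show ?thesis
        using c(1) d(1) by (simp add: power2_le_iff_abs_le)
    qed
    then have "norm (g \<xi>) \<le> c * d * norm \<xi>"
      by (intro tendsto_upperbound[OF tendsto_norm[OF hs[unfolded has_sum_def]]]
          eventually_finite_subsets_at_top_weakI) auto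
    then show "norm (g \<xi>) \<le> norm \<xi> * (c * d)" by (simp add: mult.commute)
  qed
  have "g (tensor_vec h \<eta>) = tensor_vec (x *\<^sub>V h) (a *\<^sub>V \<eta>)" for h \<eta>
  proof -
    have bl: "bounded_linear (\<lambda>\<zeta>. tensor_vec (x *\<^sub>V h) (a *\<^sub>V \<zeta>))"
      by (rule bounded_linear_compose[OF bounded_linear_tensor_vec bounded_linear_cblinfun_apply])
    have eq: "f (tensor_vec h \<eta>) j
        = tensor_vec (x *\<^sub>V h) (a *\<^sub>V ell2_single j (ell2_nth \<eta> j))" for j
    proof -
      have "ell2_single j (ell2_nth \<eta> j) = ell2_nth \<eta> j *\<^sub>C e j"
        by (rule ell2_eqI) (simp add: e_def ell2_nth_simps ell2_nth_single scaleC_complex_def)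
      then show ?thesis
        by (simp add: f_def ell2_nth_tensor_vec tensor_vec_linear)
    qed
    have "(f (tensor_vec h \<eta>) has_sum tensor_vec (x *\<^sub>V h) (a *\<^sub>V \<eta>)) UNIV"
      using has_sum_bounded_linear[OF bl ell2_has_sum_single[of \<eta>]]
      by (simp add: o_def flip: eq)
    then show ?thesis using hs by (rule has_sum_unique[rotated])
  qed
  then show ?thesis using app by metis
qed

lemma tensor_vec_single: "tensor_vec h (ell2_single i 1) = ell2_single i h"
  by (rule ell2_eqI) (simp add: ell2_nth_tensor_vec ell2_nth_single scaleC_one)

lemma tensor_op_eqI:
  assumes "\<And>h \<eta>. T *\<^sub>V tensor_vec h \<eta> = tensor_vec (x *\<^sub>V h) (a *\<^sub>V \<eta>)"
  shows "tensor_op x a = T"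
  unfolding tensor_op_def
proof (rule the_equality)
  fix T' assume T': "\<forall>h \<eta>. T' *\<^sub>V tensor_vec h \<eta> = tensor_vec (x *\<^sub>V h) (a *\<^sub>V \<eta>)"
  have "T' *\<^sub>V ell2_single i h = T *\<^sub>V ell2_single i h" for i h
    unfolding tensor_vec_single[of h i, symmetric] assms by (rule T'[rule_format])
  then show "T' = T" by (rule cblinfun_ell2_eqI)
qed (use assms in simp)

lemma tensor_op_apply: "tensor_op x a *\<^sub>V tensor_vec h \<eta> = tensor_vec (x *\<^sub>V h) (a *\<^sub>V \<eta>)"
proof -
  obtain T where T: "\<And>h \<eta>. T *\<^sub>V tensor_vec h \<eta> = tensor_vec (x *\<^sub>V h) (a *\<^sub>V \<eta>)"
    using tensor_op_exists[of x a] by blast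
  then have "tensor_op x a = T" by (rule tensor_op_eqI)
  then show ?thesis by (simp add: T)
qed

lemma entry_tensor_op: "entry i j (tensor_op x a) = ell2_nth (a *\<^sub>V ell2_single j 1) i *\<^sub>C x"
proof (rule cblinfun_eqI)
  fix h
  have "tensor_op x a *\<^sub>V ell2_single j h = tensor_vec (x *\<^sub>V h) (a *\<^sub>V ell2_single j 1)"
    unfolding tensor_vec_single[of h j, symmetric] by (rule tensor_op_apply)
  then show "entry i j (tensor_op x a) *\<^sub>V h = (ell2_nth (a *\<^sub>V ell2_single j 1) i *\<^sub>C x) *\<^sub>V h"
    by (simp add: ell2_nth_tensor_vec)
qed

lemma tensor_op_matrix_unit:
  "tensor_op x (ell2_inj i o\<^sub>C\<^sub>L ell2_proj j) = ell2_inj i o\<^sub>C\<^sub>L x o\<^sub>C\<^sub>L ell2_proj j"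
  by (rule tensor_op_eqI, rule ell2_eqI)
    (simp add: ell2_nth_tensor_vec ell2_nth_single ell2_nth_simps)

lemma matrix_ops_UNIV: "matrix_ops UNIV = UNIV"
proof -
  have "A *\<^sub>V x = 0" if "\<forall>y. cinner y x = 0" for A :: "(('j, complex) ell2, ('j, complex) ell2) cblinfun" and x
    using that cinner_self[of x] by simp
  then show ?thesis
    unfolding matrix_ops_def ops_between_def ell2_on_def by auto
qed

text \<open>The entries of x \<otimes> a are multiples of x, and conversely z is reassembled from
  the operators z_ij \<otimes> e_ij, with e_ij the matrix units.\<close>

lemma tensor_M_eq_entries:
  fixes X :: "('a::chilbert_space, 'b::chilbert_space) cblinfun set"
  assumes X: "wclosed_subspace X"
  shows "tensor_M X (UNIV :: 'j set) = {z. \<forall>i j. entry i j z \<in> X}"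
proof
  show "tensor_M X (UNIV :: 'j set) \<subseteq> {z. \<forall>i j. entry i j z \<in> X}"
  proof
    fix z assume "z \<in> tensor_M X (UNIV :: 'j set)"
    then have z: "z \<in> wspan {tensor_op x a |x a. x \<in> X \<and> a \<in> (UNIV :: (('j, complex) ell2, ('j, complex) ell2) cblinfun set)}"
      unfolding tensor_M_def matrix_ops_UNIV .
    show "z \<in> {z. \<forall>i j. entry i j z \<in> X}"
      by (rule wspan_induct[OF z wclosed_subspace_entries[OF X]])
        (auto simp: entry_tensor_op wclosed_subspaceD(3)[OF X])
  qed
next
  show "{z. \<forall>i j. entry i j z \<in> X} \<subseteq> tensor_M X (UNIV :: 'j set)"
  proof
    fix z :: "(('j, 'a) ell2, ('j, 'b) ell2) cblinfun"
    assume z: "z \<in> {z. \<forall>i j. entry i j z \<in> X}"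
    have sub: "wclosed_subspace (tensor_M X (UNIV :: 'j set))"
      unfolding tensor_M_def by (rule wclosed_subspace_wspan)
    have unit: "ell2_inj i o\<^sub>C\<^sub>L entry i j z o\<^sub>C\<^sub>L ell2_proj j \<in> tensor_M X (UNIV :: 'j set)" for i j
      unfolding tensor_M_def matrix_ops_UNIV tensor_op_matrix_unit[symmetric]
      by (rule subsetD[OF wspan_superset]) (use z in auto)
    \<comment> \<open>The rows are summed with column j fixed, and the columns afterwards; both sums
      are w*-limits inside the space.\<close>
    have "id_op o\<^sub>C\<^sub>L (z o\<^sub>C\<^sub>L ell2_inj j o\<^sub>C\<^sub>L ell2_proj j) \<in> tensor_M X (UNIV :: 'j set)" for j
      by (rule wclosed_subspace_compose_ell2[OF sub])
        (use unit[of _ j] in \<open>simp add: entry_def compose_assoc\<close>)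
    then have "z o\<^sub>C\<^sub>L (ell2_inj j o\<^sub>C\<^sub>L ell2_proj j) o\<^sub>C\<^sub>L id_op \<in> tensor_M X (UNIV :: 'j set)" for j
      by (simp add: compose_assoc)
    then have "z o\<^sub>C\<^sub>L id_op \<in> tensor_M X (UNIV :: 'j set)"
      by (rule wclosed_subspace_compose_ell2[OF sub])
    then show "z \<in> tensor_M X (UNIV :: 'j set)" by simp
  qed
qed

section \<open>Partitions of unity in a ternary ring of operators\<close>

text \<open>The operators index themselves: V is the column with entry a in position a, so that adj
  V V is the sum of the operators adj a a over M.\<close>

lemma column_operator:
  fixes M :: "('a::chilbert_space, 'b::chilbert_space) cblinfun set"
  assumes le: "\<And>F x. finite F \<Longrightarrow> F \<subseteq> M \<Longrightarrow> (\<Sum>a\<in>F. (norm (a *\<^sub>V x))\<^sup>2) \<le> (norm x)\<^sup>2"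
  obtains V :: "('a, (('a, 'b) cblinfun, 'b) ell2) cblinfun"
  where "\<And>x a. ell2_nth (V *\<^sub>V x) a = (if a \<in> M then a *\<^sub>V x else 0)"
    "\<And>x. norm (V *\<^sub>V x) \<le> norm x"
    "\<And>x. ((\<lambda>a. (norm (a *\<^sub>V x))\<^sup>2) has_sum (norm (V *\<^sub>V x))\<^sup>2) M"
proof -
  define w where "w x a = (if a \<in> M then a *\<^sub>V x else 0)" for x and a :: "('a, 'b) cblinfun"
  have summM: "(\<lambda>a. (norm (a *\<^sub>V x))\<^sup>2) summable_on M" for x
    by (rule nonneg_bdd_above_summable_on) (auto intro!: bdd_aboveI[where M = "(norm x)\<^sup>2"] le)
  have hs_iff: "((\<lambda>a. (norm (w x a))\<^sup>2) has_sum s) UNIV \<longleftrightarrow> ((\<lambda>a. (norm (a *\<^sub>V x))\<^sup>2) has_sum s) M" for x s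
    by (rule has_sum_cong_neutral) (auto simp: w_def)
  have summ: "(\<lambda>a. (norm (w x a))\<^sup>2) summable_on UNIV" for x
    using summM[of x] hs_iff[of x] unfolding summable_on_def by blast
  define v where "v x = Abs_ell2 (w x)" for x
  have v: "ell2_nth (v x) = w x" for x
    using summ[of x] by (simp add: v_def Abs_ell2_inverse)
  have hs: "((\<lambda>a. (norm (a *\<^sub>V x))\<^sup>2) has_sum (norm (v x))\<^sup>2) M" for x
    using ell2_norm_has_sum[of "v x"] by (simp add: v hs_iff)
  have vle: "norm (v x) \<le> norm x" for x
  proof -
    have "(norm (v x))\<^sup>2 \<le> (norm x)\<^sup>2"
      by (rule has_sum_le_finite_sums[OF hs]) (rule le)
    then show ?thesis by (simp add: power2_le_iff_abs_le)
  qed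
  have app: "Cblinfun v *\<^sub>V x = v x" for x
    by (rule Cblinfun_apply[where K = 1])
      (auto intro!: ell2_eqI simp: v w_def ell2_nth_simps vle)
  show thesis
    by (rule that[of "Cblinfun v"]) (simp_all add: app v w_def vle hs)
qed

text \<open>If \<open>P = 1 - \<Sum> a\<^sup>* a\<close> is nonzero, then the multiples \<open>t m P\<close> of \<open>m P\<close> for small \<open>t\<close> can be added to
  the family, so they all belong to a maximal family. Summing many of them yields a
  contradiction.\<close>

lemma partition_of_unity_exists:
  fixes N :: "('a::chilbert_space, 'b::chilbert_space) cblinfun set"
  assumes N: "wclosed_subspace N"
    and triple: "\<And>a b c. a \<in> N \<Longrightarrow> b \<in> N \<Longrightarrow> c \<in> N \<Longrightarrow> a o\<^sub>C\<^sub>L adj b o\<^sub>C\<^sub>L c \<in> N"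
    and ker: "\<And>x. (\<And>m. m \<in> N \<Longrightarrow> m *\<^sub>V x = 0) \<Longrightarrow> x = 0"
  shows "\<exists>A\<subseteq>N. \<forall>x. ((\<lambda>a. (norm (a *\<^sub>V x))\<^sup>2) has_sum (norm x)\<^sup>2) A"
proof -
  define \<A> where "\<A> = {A. A \<subseteq> N \<and>
    (\<forall>F x. finite F \<longrightarrow> F \<subseteq> A \<longrightarrow> (\<Sum>a\<in>F. (norm (a *\<^sub>V x))\<^sup>2) \<le> (norm x)\<^sup>2)}"
  have "\<exists>M\<in>\<A>. \<forall>B\<in>\<A>. M \<subseteq> B \<longrightarrow> B = M"
  proof (rule subset_Zorn_nonempty)
    show "\<A> \<noteq> {}" by (auto simp: \<A>_def intro!: exI[of _ "{}"])
    fix \<C> assume C: "\<C> \<noteq> {}" "subset.chain \<A> \<C>"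
    then have sub: "\<C> \<subseteq> \<A>" by (auto simp: subset.chain_def)
    have "(\<Sum>a\<in>F. (norm (a *\<^sub>V x))\<^sup>2) \<le> (norm x)\<^sup>2" if F: "finite F" "F \<subseteq> \<Union>\<C>" for F x
    proof -
      obtain B where "B \<in> \<C>" "F \<subseteq> B"
        using finite_subset_Union_chain[OF F C] by metis
      then show ?thesis using sub F(1) unfolding \<A>_def by blast
    qed
    moreover have "\<Union>\<C> \<subseteq> N" using sub unfolding \<A>_def by blast
    ultimately show "\<Union>\<C> \<in> \<A>" unfolding \<A>_def by blast
  qed
  then obtain M where M: "M \<in> \<A>" and max: "\<And>B. B \<in> \<A> \<Longrightarrow> M \<subseteq> B \<Longrightarrow> B = M" by blast
  have MN: "M \<subseteq> N" using M by (simp add: \<A>_def)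
  have Mle: "(\<Sum>a\<in>F. (norm (a *\<^sub>V x))\<^sup>2) \<le> (norm x)\<^sup>2" if "finite F" "F \<subseteq> M" for F x
    using M that by (simp add: \<A>_def)
  obtain V :: "('a, (('a, 'b) cblinfun, 'b) ell2) cblinfun"
    where Vnth: "\<And>x a. ell2_nth (V *\<^sub>V x) a = (if a \<in> M then a *\<^sub>V x else 0)"
    and Vle: "\<And>x. norm (V *\<^sub>V x) \<le> norm x"
    and Vsum: "\<And>x. ((\<lambda>a. (norm (a *\<^sub>V x))\<^sup>2) has_sum (norm (V *\<^sub>V x))\<^sup>2) M"
    using column_operator[of M, OF Mle] by metis
  have Vadj: "norm (adj V *\<^sub>V y) \<le> norm y" for y
    using norm_adj_le[of 1 V] Vle by simp
  define P where "P = id_op - adj V o\<^sub>C\<^sub>L V"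
  have P: "P *\<^sub>V x = x - adj V *\<^sub>V (V *\<^sub>V x)" for x by (simp add: P_def)
  have projV: "ell2_proj a o\<^sub>C\<^sub>L V = (if a \<in> M then a else 0)" for a
    by (rule cblinfun_eqI) (simp add: Vnth)
  \<comment> \<open>m adj V V is the w*-limit of the finite sums of m adj a a over a in M, and each
    summand is a triple product in N.\<close>
  have mP: "m o\<^sub>C\<^sub>L P \<in> N" if "m \<in> N" for m
  proof -
    have "m o\<^sub>C\<^sub>L adj V o\<^sub>C\<^sub>L V \<in> N"
    proof (rule wclosed_subspace_compose_ell2[OF N])
      fix a :: "('a, 'b) cblinfun"
      have "m o\<^sub>C\<^sub>L adj V o\<^sub>C\<^sub>L (ell2_inj a o\<^sub>C\<^sub>L ell2_proj a) o\<^sub>C\<^sub>L V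
          = m o\<^sub>C\<^sub>L adj (ell2_proj a o\<^sub>C\<^sub>L V) o\<^sub>C\<^sub>L (ell2_proj a o\<^sub>C\<^sub>L V)"
        by (simp add: compose_assoc)
      also have "\<dots> \<in> N"
        unfolding projV using MN wclosed_subspaceD(1)[OF N] that by (intro triple) auto
      finally show "m o\<^sub>C\<^sub>L adj V o\<^sub>C\<^sub>L (ell2_inj a o\<^sub>C\<^sub>L ell2_proj a) o\<^sub>C\<^sub>L V \<in> N" .
    qed
    moreover have "m o\<^sub>C\<^sub>L P = m - m o\<^sub>C\<^sub>L adj V o\<^sub>C\<^sub>L V"
      by (rule cblinfun_eqI) (simp add: P)
    ultimately show ?thesis using wclosed_subspaceD(4)[OF N] that by simp
  qed
  \<comment> \<open>This is P^2 \<le> P = 1 - adj V V; it leaves room in the family for any operator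
    dominated by P.\<close>
  have Ple: "(norm (P *\<^sub>V x))\<^sup>2 + (norm (V *\<^sub>V x))\<^sup>2 \<le> (norm x)\<^sup>2" for x
  proof -
    define s where "s = adj V *\<^sub>V (V *\<^sub>V x)"
    have "inner s x = (norm (V *\<^sub>V x))\<^sup>2"
      by (simp add: s_def inner_adj_left power2_norm_eq_inner)
    moreover have "(norm s)\<^sup>2 \<le> (norm (V *\<^sub>V x))\<^sup>2"
      unfolding s_def by (intro power_mono Vadj) simp
    moreover have "(norm (x - s))\<^sup>2 = (norm x)\<^sup>2 - 2 * inner s x + (norm s)\<^sup>2"
      unfolding power2_norm_eq_inner by (simp add: inner_diff_left inner_diff_right inner_commute)
    ultimately show ?thesis by (simp add: P s_def[symmetric])
  qed
  have "P *\<^sub>V x0 = 0" for x0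
  proof (rule ccontr)
    assume "P *\<^sub>V x0 \<noteq> 0"
    then obtain m where m: "m \<in> N" "m *\<^sub>V (P *\<^sub>V x0) \<noteq> 0" using ker by blast
    obtain c where c: "0 < c" "\<And>x. norm (m *\<^sub>V x) \<le> c * norm x"
      using cblinfun_bound[of m] by metis
    \<comment> \<open>The factor 1 / c gives |b x| \<le> |P x|, so adj b b fits into the gap left by
      M.\<close>
    define b where "b = complex_of_real (1 / c) *\<^sub>C (m o\<^sub>C\<^sub>L P)"
    have b: "b *\<^sub>V x = (1 / c) *\<^sub>R (m *\<^sub>V (P *\<^sub>V x))" for x
      by (simp add: b_def scaleR_scaleC)
    have bN: "b \<in> N" unfolding b_def by (intro wclosed_subspaceD(3)[OF N] mP m(1))
    have ble: "norm (b *\<^sub>V x) \<le> norm (P *\<^sub>V x)" for x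
      using c(1) c(2)[of "P *\<^sub>V x"] by (simp add: b field_simps)
    have b0: "b *\<^sub>V x0 \<noteq> 0" using m(2) c(1) by (simp add: b)
    \<comment> \<open>M is a set, so b may already belong to it and maximality is no contradiction
      for b alone. What maximality yields is the membership of all these multiples.\<close>
    have tb: "complex_of_real t *\<^sub>C b \<in> M" if t: "0 < t" "t \<le> 1" for t
    proof -
      define d where "d = complex_of_real t *\<^sub>C b"
      have dN: "d \<in> N" unfolding d_def by (rule wclosed_subspaceD(3)[OF N bN])
      have dle: "(norm (d *\<^sub>V x))\<^sup>2 \<le> (norm (P *\<^sub>V x))\<^sup>2" for x
      proof (rule power_mono)
        have "norm (d *\<^sub>V x) = t * norm (b *\<^sub>V x)"
          using t by (simp add: d_def norm_scaleC)
        also have "\<dots> \<le> 1 * norm (b *\<^sub>V x)" using t by (intro mult_right_mono) auto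
        finally show "norm (d *\<^sub>V x) \<le> norm (P *\<^sub>V x)" using ble[of x] by simp
      qed simp
      have Vsum_le: "(\<Sum>a\<in>G. (norm (a *\<^sub>V x))\<^sup>2) \<le> (norm (V *\<^sub>V x))\<^sup>2" if "finite G" "G \<subseteq> M" for G x
        by (rule finite_sum_le_has_sum[OF Vsum]) (use that in auto)
      have "(\<Sum>a\<in>F. (norm (a *\<^sub>V x))\<^sup>2) \<le> (norm x)\<^sup>2" if F: "finite F" "F \<subseteq> insert d M" for F x
      proof -
        have "(\<Sum>a\<in>F. (norm (a *\<^sub>V x))\<^sup>2) \<le> (\<Sum>a\<in>insert d (F - {d}). (norm (a *\<^sub>V x))\<^sup>2)"
          using F(1) by (intro sum_mono2) auto
        also have "\<dots> = (norm (d *\<^sub>V x))\<^sup>2 + (\<Sum>a\<in>F - {d}. (norm (a *\<^sub>V x))\<^sup>2)"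
          using F(1) by (subst sum.insert) auto
        also have "\<dots> \<le> (norm (P *\<^sub>V x))\<^sup>2 + (norm (V *\<^sub>V x))\<^sup>2"
          using F by (intro add_mono dle Vsum_le) auto
        finally show ?thesis using Ple[of x] by linarith
      qed
      then have "insert d M \<in> \<A>" using dN MN by (simp add: \<A>_def)
      then have "insert d M = M" by (rule max) auto
      then show ?thesis unfolding d_def by auto
    qed
    \<comment> \<open>Infinitely many distinct factors in (1/2, 1], so that each term at x0 is at
      least |b x0|^2 / 4.\<close>
    define r where "r k = (1 + 1 / real (Suc k)) / 2" for k
    have r: "1 / 2 \<le> r k" "0 < r k" "r k \<le> 1" for k by (simp_all add: r_def field_simps)
    define F where "F k = complex_of_real (r k) *\<^sub>C b" for k
    have "inj F"
    proof (rule injI)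
      fix k l assume "F k = F l"
      then have "F k *\<^sub>V x0 = F l *\<^sub>V x0" by simp
      then have "r k *\<^sub>R (b *\<^sub>V x0) = r l *\<^sub>R (b *\<^sub>V x0)" by (simp add: F_def scaleR_scaleC)
      then have "r k = r l" using b0 by simp
      then show "k = l" by (simp add: r_def)
    qed
    have FM: "F k \<in> M" for k unfolding F_def by (rule tb) (rule r)+
    define e where "e = (norm (b *\<^sub>V x0))\<^sup>2 / 4"
    have e: "0 < e" using b0 by (simp add: e_def)
    have Fe: "e \<le> (norm (F k *\<^sub>V x0))\<^sup>2" for k
    proof -
      have "(1 / 2 * norm (b *\<^sub>V x0))\<^sup>2 \<le> (r k * norm (b *\<^sub>V x0))\<^sup>2"
        using r[of k] by (intro power_mono mult_right_mono) auto
      then show ?thesis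
        using r[of k] by (simp add: F_def norm_scaleC e_def power_mult_distrib power_divide)
    qed
    have bd: "real n * e \<le> (norm x0)\<^sup>2" for n
    proof -
      have "real n * e = (\<Sum>k<n. e)" by simp
      also have "\<dots> \<le> (\<Sum>k<n. (norm (F k *\<^sub>V x0))\<^sup>2)" by (intro sum_mono Fe)
      also have "\<dots> = (\<Sum>a\<in>F ` {..<n}. (norm (a *\<^sub>V x0))\<^sup>2)"
        by (subst sum.reindex) (use \<open>inj F\<close> in \<open>auto intro: inj_on_subset\<close>)
      also have "\<dots> \<le> (norm x0)\<^sup>2" by (rule Mle) (use FM in auto)
      finally show ?thesis .
    qed
    obtain n where "(norm x0)\<^sup>2 < real n * e"
      using ex_less_of_nat_mult[OF e] by metis
    then show False using bd[of n] by linarith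
  qed
  then have "adj V *\<^sub>V (V *\<^sub>V x) = x" for x using P[of x] by simp
  then have "(norm (V *\<^sub>V x))\<^sup>2 = (norm x)\<^sup>2" for x
    by (metis inner_adj_left power2_norm_eq_inner)
  then show ?thesis using MN Vsum by metis
qed

section \<open>Reindexing a partition of unity by a given infinite type\<close>

lemma infinite_times_bij:
  assumes "infinite (UNIV :: 'j set)"
  shows "\<exists>d :: 'j \<times> 'j \<Rightarrow> 'j. bij d" "\<exists>e :: nat \<times> 'j \<Rightarrow> 'j. bij e"
proof -
  show "\<exists>d :: 'j \<times> 'j \<Rightarrow> 'j. bij d"
    using card_of_Times_same_infinite[OF assms] unfolding card_of_ordIso[symmetric] by simp
  have "\<exists>f. bij_betw f ((UNIV :: nat set) \<times> (UNIV :: 'j set)) (UNIV :: 'j set)"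
    unfolding card_of_ordIso
    using card_of_Times_infinite[OF assms UNIV_not_empty] assms infinite_iff_card_of_nat by blast
  then show "\<exists>e :: nat \<times> 'j \<Rightarrow> 'j. bij e" by simp
qed

text \<open>The size of the family must be bounded. A nonzero member a is coded by a vector
  \<open>w a\<close> on which it does not vanish and by its number among the members nonzero there;
  these are countably many because their squared norms are summable. The remaining indices are
  filled with 0.\<close>

lemma partition_of_unity_family:
  fixes N :: "('a::chilbert_space, 'b::chilbert_space) cblinfun set" and f :: "'a \<Rightarrow> 'j"
  assumes N: "wclosed_subspace N"
    and triple: "\<And>a b c. a \<in> N \<Longrightarrow> b \<in> N \<Longrightarrow> c \<in> N \<Longrightarrow> a o\<^sub>C\<^sub>L adj b o\<^sub>C\<^sub>L c \<in> N"
    and ker: "\<And>x. (\<And>m. m \<in> N \<Longrightarrow> m *\<^sub>V x = 0) \<Longrightarrow> x = 0"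
    and inf: "infinite (UNIV :: 'j set)" and f: "inj f"
  shows "\<exists>a :: 'j \<Rightarrow> _. (\<forall>i. a i \<in> N) \<and> (\<forall>x. ((\<lambda>i. (norm (a i *\<^sub>V x))\<^sup>2) has_sum (norm x)\<^sup>2) UNIV)"
proof -
  obtain A where AN: "A \<subseteq> N"
    and A: "\<And>x. ((\<lambda>a. (norm (a *\<^sub>V x))\<^sup>2) has_sum (norm x)\<^sup>2) A"
    using partition_of_unity_exists[OF N triple ker] by blast
  have "\<exists>x. a *\<^sub>V x \<noteq> 0" if "a \<in> A - {0}" for a
    using that cblinfun_eqI[of a 0] by auto
  then obtain w where w: "\<And>a. a \<in> A - {0} \<Longrightarrow> a *\<^sub>V w a \<noteq> 0" by metis
  have count: "countable {a \<in> A. a *\<^sub>V x \<noteq> 0}" for x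
    using summable_countable_real[OF has_sum_imp_summable[OF A[of x]]] by simp
  define n where "n x = to_nat_on {a \<in> A. a *\<^sub>V x \<noteq> 0}" for x
  obtain e :: "nat \<times> 'j \<Rightarrow> 'j" where e: "bij e" using infinite_times_bij(2)[OF inf] by blast
  define g where "g a = e (n (w a) a, f (w a))" for a
  have g: "inj_on g (A - {0})"
  proof (rule inj_onI)
    fix a b assume ab: "a \<in> A - {0}" "b \<in> A - {0}" "g a = g b"
    then have "n (w a) a = n (w b) b" "f (w a) = f (w b)"
      using bij_is_inj[OF e] unfolding g_def by (auto dest: injD)
    then have wab: "w a = w b" "n (w a) a = n (w a) b" using f by (auto dest: injD)
    show "a = b"
      using inj_on_to_nat_on[OF count[of "w a"]] w[OF ab(1)] w[OF ab(2)] wab ab(1,2)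
      unfolding n_def inj_on_def by auto
  qed
  define a where "a i = (if i \<in> g ` (A - {0}) then inv_into (A - {0}) g i else 0)" for i
  have ag: "a (g b) = b" if "b \<in> A - {0}" for b
    using that g by (simp add: a_def)
  have "a i \<in> N" for i
    unfolding a_def using wclosed_subspaceD(1)[OF N] AN inv_into_into[of i g "A - {0}"] by auto
  moreover have "((\<lambda>i. (norm (a i *\<^sub>V x))\<^sup>2) has_sum (norm x)\<^sup>2) UNIV" for x
  proof -
    have "((\<lambda>b. (norm (b *\<^sub>V x))\<^sup>2) has_sum (norm x)\<^sup>2) (A - {0})"
      using A[of x] by (rule has_sum_cong_neutral[THEN iffD1, rotated -1]) auto
    then have "(((\<lambda>i. (norm (a i *\<^sub>V x))\<^sup>2) \<circ> g) has_sum (norm x)\<^sup>2) (A - {0})"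
      by (rule has_sum_cong[THEN iffD1, rotated]) (simp add: ag)
    then have "((\<lambda>i. (norm (a i *\<^sub>V x))\<^sup>2) has_sum (norm x)\<^sup>2) (g ` (A - {0}))"
      by (simp add: has_sum_reindex[OF g])
    then show ?thesis
      by (rule has_sum_cong_neutral[THEN iffD1, rotated -1]) (auto simp: a_def)
  qed
  ultimately show ?thesis by blast
qed

section \<open>The unitary\<close>

text \<open>Row k has at most one nonzero entry, a k in column s k, so column i carries a partition
  of unity along the fibre of s over i. Summing fibre by fibre preserves norms.\<close>

lemma monomial_isometry_exists:
  fixes a :: "'k \<Rightarrow> ('a::chilbert_space, 'b::chilbert_space) cblinfun" and s :: "'k \<Rightarrow> 'i"
  assumes "\<And>i h. ((\<lambda>k. (norm (a k *\<^sub>V h))\<^sup>2) has_sum (norm h)\<^sup>2) {k. s k = i}"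
  shows "\<exists>V :: (('i, 'a) ell2, ('k, 'b) ell2) cblinfun.
    (\<forall>\<xi> k. ell2_nth (V *\<^sub>V \<xi>) k = a k *\<^sub>V ell2_nth \<xi> (s k)) \<and> (\<forall>\<xi>. norm (V *\<^sub>V \<xi>) = norm \<xi>)"
proof -
  define w where "w \<xi> k = a k *\<^sub>V ell2_nth \<xi> (s k)" for \<xi> k
  have hs: "((\<lambda>k. (norm (w \<xi> k))\<^sup>2) has_sum (norm \<xi>)\<^sup>2) UNIV" for \<xi>
  proof -
    let ?f = "\<lambda>(i, k). (norm (a k *\<^sub>V ell2_nth \<xi> i))\<^sup>2"
    have inner: "((\<lambda>k. ?f (i, k)) has_sum (norm (ell2_nth \<xi> i))\<^sup>2) {k. s k = i}" for i
      using assms by simp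
    have "?f summable_on Sigma UNIV (\<lambda>i. {k. s k = i})"
      by (rule summable_on_SigmaI[OF inner ell2_nth_summable]) auto
    then have sig: "(?f has_sum (norm \<xi>)\<^sup>2) (Sigma UNIV (\<lambda>i. {k. s k = i}))"
      by (rule has_sum_SigmaI[OF inner ell2_norm_has_sum])
    have bij: "bij_betw (\<lambda>k. (s k, k)) UNIV (Sigma UNIV (\<lambda>i. {k. s k = i}))"
      by (auto simp: bij_betw_def inj_on_def)
    have "((\<lambda>k. ?f (s k, k)) has_sum (norm \<xi>)\<^sup>2) UNIV"
      using has_sum_reindex_bij_betw[OF bij, of ?f] sig by (rule iffD2)
    then show ?thesis by (simp add: w_def)
  qed
  define v where "v \<xi> = Abs_ell2 (w \<xi>)" for \<xi>
  have v: "ell2_nth (v \<xi>) = w \<xi>" for \<xi>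
    using has_sum_imp_summable[OF hs[of \<xi>]] by (simp add: v_def Abs_ell2_inverse)
  have norm_v: "norm (v \<xi>) = norm \<xi>" for \<xi>
  proof -
    have "(norm (v \<xi>))\<^sup>2 = (norm \<xi>)\<^sup>2"
      using has_sum_unique[OF ell2_norm_has_sum[of "v \<xi>", unfolded v] hs[of \<xi>]] .
    then show ?thesis by (simp add: power2_eq_iff_nonneg)
  qed
  have app: "Cblinfun v *\<^sub>V \<xi> = v \<xi>" for \<xi>
    by (rule Cblinfun_apply[where K = 1])
      (auto intro!: ell2_eqI simp: v w_def ell2_nth_simps norm_v)
  show ?thesis
    by (rule exI[of _ "Cblinfun v"]) (simp add: app v w_def norm_v)
qed

text \<open>|y - V (adj V) y|^2 = |y|^2 - |adj V y|^2, so a vector whose norm is preserved by adj V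
  lies in the range of V.\<close>

lemma isometry_adj_fixed:
  assumes iso: "\<And>x. norm (V *\<^sub>V x) = norm x" and eq: "norm (adj V *\<^sub>V y) = norm y"
  shows "V *\<^sub>V (adj V *\<^sub>V y) = y"
proof -
  let ?z = "adj V *\<^sub>V y"
  have "(norm (y - V *\<^sub>V ?z))\<^sup>2 = (norm y)\<^sup>2 - 2 * inner y (V *\<^sub>V ?z) + (norm (V *\<^sub>V ?z))\<^sup>2"
    unfolding power2_norm_eq_inner by (simp add: inner_diff_left inner_diff_right inner_commute)
  also have "inner y (V *\<^sub>V ?z) = (norm ?z)\<^sup>2"
    by (simp add: power2_norm_eq_inner inner_adj_left)
  finally show ?thesis by (simp add: iso eq)
qed

text \<open>Both \<open>V\<close> and \<open>C\<close> are isometries, \<open>V\<close> preserves the degree and \<open>C\<close> raises it by one. A vector in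
  the kernel of \<open>V + C\<^sup>*\<close> or of its adjoint is fixed by \<open>-C V\<close> or \<open>-V C\<close>, so that its components
  vanish by induction on the degree.\<close>

lemma graded_sum_injective:
  fixes V :: "(('j, 'a::chilbert_space) ell2, ('j, 'b::chilbert_space) ell2) cblinfun"
    and C :: "(('j, 'b) ell2, ('j, 'a) ell2) cblinfun" and deg :: "'j \<Rightarrow> nat"
  assumes V: "\<And>\<xi> k. ell2_nth (V *\<^sub>V \<xi>) k = a k *\<^sub>V ell2_nth \<xi> (s k)" "\<And>\<xi>. norm (V *\<^sub>V \<xi>) = norm \<xi>"
    and C: "\<And>\<eta> k. ell2_nth (C *\<^sub>V \<eta>) k = b k *\<^sub>V ell2_nth \<eta> (s' k)" "\<And>\<eta>. norm (C *\<^sub>V \<eta>) = norm \<eta>"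
    and deg: "\<And>k. deg (s k) = deg k" "\<And>k. deg k = 0 \<Longrightarrow> b k = 0" "\<And>k. deg (s' k) = deg k - 1"
  shows "V *\<^sub>V \<xi> + adj C *\<^sub>V \<xi> = 0 \<Longrightarrow> \<xi> = 0" "adj V *\<^sub>V \<eta> + C *\<^sub>V \<eta> = 0 \<Longrightarrow> \<eta> = 0"
proof -
  assume "V *\<^sub>V \<xi> + adj C *\<^sub>V \<xi> = 0"
  then have eq: "adj C *\<^sub>V \<xi> = - (V *\<^sub>V \<xi>)" by (simp add: add_eq_0_iff)
  \<comment> \<open>Since V is isometric, |adj C \<xi>| = |V \<xi>| = |\<xi>|, which is the case of
    equality for the isometry C.\<close>
  then have "C *\<^sub>V (adj C *\<^sub>V \<xi>) = \<xi>" by (intro isometry_adj_fixed C(2)) (simp add: V(2))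
  then have fixed: "\<xi> = - (C *\<^sub>V (V *\<^sub>V \<xi>))" by (simp add: eq)
  have nth: "ell2_nth \<xi> k = - (b k *\<^sub>V (a (s' k) *\<^sub>V ell2_nth \<xi> (s (s' k))))" for k
    by (subst fixed) (simp add: ell2_nth_simps C(1) V(1))
  \<comment> \<open>The formula for component k refers to degree deg k - 1. In degree 0 the
    truncated subtraction stays at 0, but there the factor b k vanishes.\<close>
  have "ell2_nth \<xi> k = 0" if "deg k = n" for n k
    using that
  proof (induction n arbitrary: k)
    case 0
    then show ?case by (simp add: nth[of k] deg)
  next
    case (Suc n)
    then show ?case by (simp add: nth[of k] deg)
  qed
  then show "\<xi> = 0" by (intro ell2_eqI) (simp add: ell2_nth_simps)
next
  assume "adj V *\<^sub>V \<eta> + C *\<^sub>V \<eta> = 0"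
  then have eq: "adj V *\<^sub>V \<eta> = - (C *\<^sub>V \<eta>)" by (simp add: eq_neg_iff_add_eq_0)
  then have "V *\<^sub>V (adj V *\<^sub>V \<eta>) = \<eta>" by (intro isometry_adj_fixed V(2)) (simp add: C(2))
  then have fixed: "\<eta> = - (V *\<^sub>V (C *\<^sub>V \<eta>))" by (simp add: eq)
  have nth: "ell2_nth \<eta> k = - (a k *\<^sub>V (b (s k) *\<^sub>V ell2_nth \<eta> (s' (s k))))" for k
    by (subst fixed) (simp add: ell2_nth_simps C(1) V(1))
  \<comment> \<open>Since s keeps the degree, in degree 0 it is the inner factor b (s k) that
    vanishes.\<close>
  have "ell2_nth \<eta> k = 0" if "deg k = n" for n k
    using that
  proof (induction n arbitrary: k)
    case 0
    then show ?case by (simp add: nth[of k] deg)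
  next
    case (Suc n)
    then show ?case by (simp add: nth[of k] deg)
  qed
  then show "\<eta> = 0" by (intro ell2_eqI) (simp add: ell2_nth_simps)
qed

text \<open>Expanding T (adj T) T entrywise produces triple products of entries of T, under which N
  is closed.\<close>

lemma entries_polar_step:
  fixes T :: "(('j, 'a::chilbert_space) ell2, ('j, 'b::chilbert_space) ell2) cblinfun"
  assumes N: "wclosed_subspace N"
    and triple: "\<And>a b c. a \<in> N \<Longrightarrow> b \<in> N \<Longrightarrow> c \<in> N \<Longrightarrow> a o\<^sub>C\<^sub>L adj b o\<^sub>C\<^sub>L c \<in> N"
    and T: "\<And>i j. entry i j T \<in> N"
  shows "entry i j (polar_step T) \<in> N"
proof -
  have "entry i j (T o\<^sub>C\<^sub>L adj T o\<^sub>C\<^sub>L T) \<in> N"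
    by (rule entry_triple_mem[OF N]) (simp add: entry_adj triple T)
  moreover have "entry i j (polar_step T)
      = entry i j T + (1 / 2) *\<^sub>C (entry i j T - entry i j (T o\<^sub>C\<^sub>L adj T o\<^sub>C\<^sub>L T))"
    by (rule cblinfun_eqI) (simp add: polar_step_def ell2_nth_simps)
  ultimately show ?thesis
    by (simp add: wclosed_subspaceD[OF N] T)
qed

text \<open>An index k is decoded as e (n, d (j, i)): n is the degree, e (n, j) the column met by
  row k of V, and i the member of the partition placed there. Hence one infinite type serves for
  rows, columns and partitions at once.\<close>

lemma unitary_with_entries_exists:
  fixes N :: "('a::chilbert_space, 'b::chilbert_space) cblinfun set"
    and f :: "'a \<Rightarrow> 'j" and g :: "'b \<Rightarrow> 'j"
  assumes N: "wclosed_subspace N"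
    and triple: "\<And>a b c. a \<in> N \<Longrightarrow> b \<in> N \<Longrightarrow> c \<in> N \<Longrightarrow> a o\<^sub>C\<^sub>L adj b o\<^sub>C\<^sub>L c \<in> N"
    and ker: "\<And>x. (\<And>m. m \<in> N \<Longrightarrow> m *\<^sub>V x = 0) \<Longrightarrow> x = 0"
    and ker_adj: "\<And>y. (\<And>m. m \<in> N \<Longrightarrow> adj m *\<^sub>V y = 0) \<Longrightarrow> y = 0"
    and inf: "infinite (UNIV :: 'j set)" and f: "inj f" and g: "inj g"
  shows "\<exists>U :: (('j, 'a) ell2, ('j, 'b) ell2) cblinfun. (\<forall>i j. entry i j U \<in> N) \<and>
    (\<forall>x. adj U *\<^sub>V (U *\<^sub>V x) = x) \<and> (\<forall>y. U *\<^sub>V (adj U *\<^sub>V y) = y)"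
proof -
  obtain a :: "'j \<Rightarrow> ('a, 'b) cblinfun" where aN: "\<And>i. a i \<in> N"
    and a: "\<And>x. ((\<lambda>i. (norm (a i *\<^sub>V x))\<^sup>2) has_sum (norm x)\<^sup>2) UNIV"
    using partition_of_unity_family[OF N triple ker inf f] by blast
  have "\<exists>b :: 'j \<Rightarrow> ('b, 'a) cblinfun. (\<forall>i. b i \<in> {b. adj b \<in> N}) \<and>
      (\<forall>x. ((\<lambda>i. (norm (b i *\<^sub>V x))\<^sup>2) has_sum (norm x)\<^sup>2) UNIV)"
  \<comment> \<open>The second partition is taken in the space of adjoints of N, a w*-closed TRO in
    the opposite direction.\<close>
  proof (rule partition_of_unity_family[OF wclosed_subspace_adj_preimage[OF N] _ _ inf g])
    fix p q r :: "('b, 'a) cblinfun"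
    assume "p \<in> {b. adj b \<in> N}" "q \<in> {b. adj b \<in> N}" "r \<in> {b. adj b \<in> N}"
    then have "adj r o\<^sub>C\<^sub>L adj (adj q) o\<^sub>C\<^sub>L adj p \<in> N" by (intro triple) auto
    then show "p o\<^sub>C\<^sub>L adj q o\<^sub>C\<^sub>L r \<in> {b. adj b \<in> N}" by (simp add: compose_assoc)
  next
    fix y assume "\<And>m. m \<in> {b. adj b \<in> N} \<Longrightarrow> m *\<^sub>V y = 0"
    then show "y = 0" by (intro ker_adj) simp
  qed
  then obtain b :: "'j \<Rightarrow> ('b, 'a) cblinfun" where bN: "\<And>i. adj (b i) \<in> N"
    and b: "\<And>x. ((\<lambda>i. (norm (b i *\<^sub>V x))\<^sup>2) has_sum (norm x)\<^sup>2) UNIV"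
    by auto
  obtain d :: "'j \<times> 'j \<Rightarrow> 'j" where d: "bij d" using infinite_times_bij(1)[OF inf] by blast
  obtain e :: "nat \<times> 'j \<Rightarrow> 'j" where e: "bij e" using infinite_times_bij(2)[OF inf] by blast
  define deg where "deg k = fst (inv e k)" for k
  define s where "s k = e (deg k, fst (inv d (snd (inv e k))))" for k
  define s' where "s' k = e (deg k - 1, fst (inv d (snd (inv e k))))" for k
  define t where "t k = snd (inv d (snd (inv e k)))" for k
  have inv_e: "inv e (e p) = p" for p by (rule inv_f_f[OF bij_is_inj[OF e]])
  have inv_d: "inv d (d p) = p" for p by (rule inv_f_f[OF bij_is_inj[OF d]])
  have surj: "\<exists>n j i. k = e (n, d (j, i))" for k
    using bij_is_surj[OF e] bij_is_surj[OF d] by (metis surjD surj_pair)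
  have code: "deg (e (n, d (j, i))) = n" "s (e (n, d (j, i))) = e (n, j)"
    "s' (e (n, d (j, i))) = e (n - 1, j)" "t (e (n, d (j, i))) = i" for n j i
    by (simp_all add: deg_def s_def s'_def t_def inv_e inv_d)
  have e_eq: "e p = e q \<longleftrightarrow> p = q" and d_eq: "d p' = d q' \<longleftrightarrow> p' = q'" for p q p' q'
    using bij_is_inj[OF e] bij_is_inj[OF d] by (auto dest: injD)
  have degs: "deg (s k) = deg k" "deg (s' k) = deg k - 1" for k
    by (simp_all add: s_def s'_def deg_def inv_e)
  \<comment> \<open>Rows of degree 0 are left empty in C, which makes the value 0 - 1 = 0 in s'
    harmless.\<close>
  define b' where "b' k = (if deg k = 0 then 0 else b (t k))" for k
  have bij1: "bij_betw (\<lambda>i. e (n, d (j, i))) UNIV {k. s k = e (n, j)}" for n j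
    unfolding bij_betw_def
  proof
    show "inj (\<lambda>i. e (n, d (j, i)))" by (rule injI) (simp add: e_eq d_eq)
    show "range (\<lambda>i. e (n, d (j, i))) = {k. s k = e (n, j)}"
    proof (intro equalityI subsetI)
      fix k assume "k \<in> {k. s k = e (n, j)}"
      moreover obtain n' j' i where k: "k = e (n', d (j', i))" using surj by blast
      ultimately have "n' = n" "j' = j" by (auto simp: code e_eq)
      then show "k \<in> range (\<lambda>i. e (n, d (j, i)))" using k by blast
    qed (auto simp: code)
  qed
  have "\<exists>V :: (('j, 'a) ell2, ('j, 'b) ell2) cblinfun.
    (\<forall>\<xi> k. ell2_nth (V *\<^sub>V \<xi>) k = a (t k) *\<^sub>V ell2_nth \<xi> (s k)) \<and> (\<forall>\<xi>. norm (V *\<^sub>V \<xi>) = norm \<xi>)"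
  proof (rule monomial_isometry_exists)
    fix q h
    obtain n j where q: "q = e (n, j)" using bij_is_surj[OF e] by (metis surjD surj_pair)
    show "((\<lambda>k. (norm (a (t k) *\<^sub>V h))\<^sup>2) has_sum (norm h)\<^sup>2) {k. s k = q}"
      unfolding q has_sum_reindex_bij_betw[OF bij1, symmetric] code by (rule a)
  qed
  then obtain V :: "(('j, 'a) ell2, ('j, 'b) ell2) cblinfun"
    where V: "\<And>\<xi> k. ell2_nth (V *\<^sub>V \<xi>) k = a (t k) *\<^sub>V ell2_nth \<xi> (s k)" "\<And>\<xi>. norm (V *\<^sub>V \<xi>) = norm \<xi>"
    by blast
  have "\<exists>C :: (('j, 'b) ell2, ('j, 'a) ell2) cblinfun.
    (\<forall>\<eta> k. ell2_nth (C *\<^sub>V \<eta>) k = b' k *\<^sub>V ell2_nth \<eta> (s' k)) \<and> (\<forall>\<eta>. norm (C *\<^sub>V \<eta>) = norm \<eta>)"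
  proof (rule monomial_isometry_exists)
    fix q h
    obtain n j where q: "q = e (n, j)" using bij_is_surj[OF e] by (metis surjD surj_pair)
    \<comment> \<open>The fibre of s' over e (n, j) is that of s over e (Suc n, j), enlarged when n
      = 0 by rows of degree 0, on which b' vanishes.\<close>
    have "((\<lambda>k. (norm (b (t k) *\<^sub>V h))\<^sup>2) has_sum (norm h)\<^sup>2) {k. s k = e (Suc n, j)}"
      unfolding has_sum_reindex_bij_betw[OF bij1, symmetric] code by (rule b)
    then show "((\<lambda>k. (norm (b' k *\<^sub>V h))\<^sup>2) has_sum (norm h)\<^sup>2) {k. s' k = q}"
    proof (rule has_sum_cong_neutral[THEN iffD1, rotated -1])
      fix k
      obtain n' j' i where k: "k = e (n', d (j', i))" using surj by blast
      show "(norm (b' k *\<^sub>V h))\<^sup>2 = 0" if "k \<in> {k. s' k = q} - {k. s k = e (Suc n, j)}"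
        using that by (cases n') (auto simp: k q code e_eq b'_def)
      show "(norm (b (t k) *\<^sub>V h))\<^sup>2 = 0" if "k \<in> {k. s k = e (Suc n, j)} - {k. s' k = q}"
        using that by (auto simp: k q code e_eq)
      show "(norm (b (t k) *\<^sub>V h))\<^sup>2 = (norm (b' k *\<^sub>V h))\<^sup>2"
        if "k \<in> {k. s k = e (Suc n, j)} \<inter> {k. s' k = q}"
        using that by (auto simp: k q code e_eq b'_def)
    qed
  qed
  then obtain C :: "(('j, 'b) ell2, ('j, 'a) ell2) cblinfun"
    where C: "\<And>\<eta> k. ell2_nth (C *\<^sub>V \<eta>) k = b' k *\<^sub>V ell2_nth \<eta> (s' k)" "\<And>\<eta>. norm (C *\<^sub>V \<eta>) = norm \<eta>"
    by blast
  \<comment> \<open>The factor 1/2 turns the sum of two contractions into a contraction, as the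
    polar iteration requires.\<close>
  define T where "T = (1 / 2) *\<^sub>C (V + adj C)"
  have half: "(1 / 2 :: complex) *\<^sub>C x = (1 / 2) *\<^sub>R x" for x :: "('j, 'c::chilbert_space) ell2"
    by (simp add: scaleR_scaleC)
  note inj = graded_sum_injective[OF V C degs(1) _ degs(2)]
  have b'0: "b' k = 0" if "deg k = 0" for k using that by (simp add: b'_def)
  have inj1: "x = 0" if "T *\<^sub>V x = 0" for x
    using that inj(1)[OF b'0, of x] by (simp add: T_def half)
  have inj2: "y = 0" if "adj T *\<^sub>V y = 0" for y
    using that inj(2)[OF b'0, of y] by (simp add: T_def half)
  have con: "contraction T"
    unfolding contraction_def
  proof
    fix x
    have "norm (V *\<^sub>V x + adj C *\<^sub>V x) \<le> norm x + norm x"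
      using norm_triangle_ineq[of "V *\<^sub>V x" "adj C *\<^sub>V x"] norm_adj_le[of 1 C x] by (simp add: V C)
    then show "norm (T *\<^sub>V x) \<le> norm x" by (simp add: T_def half)
  qed
  have entryV: "entry i j V \<in> N" for i j
  proof -
    have "entry i j V = (if s i = j then a (t i) else 0)"
      by (rule cblinfun_eqI) (simp add: V ell2_nth_single)
    then show ?thesis using aN wclosed_subspaceD(1)[OF N] by simp
  qed
  have entryC: "entry i j (adj C) \<in> N" for i j
  proof -
    have "entry j i C = (if s' j = i then b' j else 0)"
      by (rule cblinfun_eqI) (simp add: C ell2_nth_single)
    then show ?thesis
      unfolding entry_adj using bN wclosed_subspaceD(1)[OF N] by (simp add: b'_def)
  qed
  have "entry i j T = (1 / 2) *\<^sub>C (entry i j V + entry i j (adj C))" for i j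
    unfolding T_def by (rule cblinfun_eqI) (simp add: ell2_nth_simps)
  then have entryT: "entry i j T \<in> N" for i j
    using entryV entryC wclosed_subspaceD[OF N] by simp
  have iter: "entry i j ((polar_step ^^ n) T) \<in> N" for n i j
    by (induction n arbitrary: i j) (simp_all add: entryT entries_polar_step[OF N triple])
  obtain U where U: "\<And>x. (\<lambda>n. (polar_step ^^ n) T *\<^sub>V x) \<longlonglongrightarrow> U *\<^sub>V x"
    "\<And>x. adj U *\<^sub>V (U *\<^sub>V x) = x" "\<And>y. U *\<^sub>V (adj U *\<^sub>V y) = y"
    using polar_iter_limit_unitary[OF con inj1 inj2] by metis
  have "U \<in> {z. \<forall>i j. entry i j z \<in> N}"
  \<comment> \<open>All iterates are contractions, so their strong limit is also a w*-limit and the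
    condition on entries survives.\<close>
  proof (rule wclosed_subspace_limit[OF wclosed_subspace_entries[OF N] _ U(1)])
    show "norm ((polar_step ^^ n) T *\<^sub>V x) \<le> 1 * norm x" for n x
      using contraction_polar_iter[OF con] by (simp add: contraction_def)
    show "\<forall>\<^sub>F n in sequentially. (polar_step ^^ n) T \<in> {z. \<forall>i j. entry i j z \<in> N}"
      using iter by simp
  qed simp
  then show ?thesis using U by blast
qed

section \<open>TRO-equivalent spaces\<close>

lemma wspan_compose_mem:
  assumes Y: "wclosed_subspace Y"
    and mem: "\<And>a c. a \<in> A \<Longrightarrow> c \<in> C \<Longrightarrow> a o\<^sub>C\<^sub>L b o\<^sub>C\<^sub>L c \<in> Y"
    and a: "a \<in> wspan A" and c: "c \<in> wspan C"
  shows "a o\<^sub>C\<^sub>L b o\<^sub>C\<^sub>L c \<in> Y"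
proof -
  have 1: "a o\<^sub>C\<^sub>L b o\<^sub>C\<^sub>L c' \<in> Y" if "c' \<in> C" for c'
  proof -
    have "A \<subseteq> {a. id_op o\<^sub>C\<^sub>L a o\<^sub>C\<^sub>L (b o\<^sub>C\<^sub>L c') \<in> Y}"
      using mem that by (auto simp: compose_assoc)
    from wspan_induct[OF a wclosed_subspace_compose_preimage[OF Y] this]
    show ?thesis by (simp add: compose_assoc)
  qed
  then have "C \<subseteq> {c. (a o\<^sub>C\<^sub>L b) o\<^sub>C\<^sub>L c o\<^sub>C\<^sub>L id_op \<in> Y}" by auto
  from wspan_induct[OF c wclosed_subspace_compose_preimage[OF Y] this]
  show ?thesis by simp
qed

lemma adj_wspan: "a \<in> wspan A \<Longrightarrow> adj a \<in> wspan (adj ` A)"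
proof -
  assume a: "a \<in> wspan A"
  have "A \<subseteq> {a. adj a \<in> wspan (adj ` A)}" using wspan_superset[of "adj ` A"] by auto
  from wspan_induct[OF a wclosed_subspace_adj_preimage[OF wclosed_subspace_wspan] this]
  show "adj a \<in> wspan (adj ` A)" by simp
qed

text \<open>The outer factors are extended to the closure with the middle one fixed in M; the middle
  one follows through the w*-continuity of \<open>adj\<close>.\<close>

lemma wspan_TRO:
  fixes M :: "('a::chilbert_space, 'b::chilbert_space) cblinfun set"
  assumes M: "TRO M" and abc: "a \<in> wspan M" "b \<in> wspan M" "c \<in> wspan M"
  shows "a o\<^sub>C\<^sub>L adj b o\<^sub>C\<^sub>L c \<in> wspan M"
proof -
  have 1: "a o\<^sub>C\<^sub>L adj b' o\<^sub>C\<^sub>L c \<in> wspan M" if "b' \<in> M" for b'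
  proof (rule wspan_compose_mem[OF wclosed_subspace_wspan _ abc(1,3)])
    show "a' o\<^sub>C\<^sub>L adj b' o\<^sub>C\<^sub>L c' \<in> wspan M" if "a' \<in> M" "c' \<in> M" for a' c'
      using M that \<open>b' \<in> M\<close> wspan_superset[of M] unfolding TRO_def by blast
  qed
  have "wclosed_subspace {b. adj b \<in> {d. a o\<^sub>C\<^sub>L d o\<^sub>C\<^sub>L c \<in> wspan M}}"
    by (rule wclosed_subspace_adj_preimage[OF
          wclosed_subspace_compose_preimage[OF wclosed_subspace_wspan]])
  from wspan_induct[OF abc(2) this] show ?thesis using 1 by auto
qed

lemma orthogonal_dense_zero:
  assumes "closure (cspan S) = (UNIV :: 'a::chilbert_space set)"
    and "\<And>y. y \<in> S \<Longrightarrow> cinner x y = 0"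
  shows "x = 0"
proof -
  have "csubspace {y. cinner x y = 0}"
    by (simp add: complex_vector.subspace_def cinner_add_right cinner_scaleC_right)
  then have "cspan S \<subseteq> {y. cinner x y = 0}"
    using assms(2) by (intro complex_vector.span_minimal) auto
  moreover have "closed {y. cinner x y = 0}"
    using continuous_closed_preimage_constant[OF
        linear_continuous_on[OF bounded_linear_cinner_right[of x]] closed_UNIV, of 0] by simp
  ultimately have "closure (cspan S) \<subseteq> {y. cinner x y = 0}"
    by (rule closure_minimal)
  then have "cinner x x = 0" using assms(1) by auto
  then show ?thesis by (simp add: cinner_self)
qed

text \<open>The operators vanishing at x form a w*-closed subspace, so if the generators vanish
  there, all of wspan S does, and x is orthogonal to the dense span of the ranges of the
  adjoints.\<close>

lemma nondegenerate_wspan_ker: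
  assumes "nondegenerate (wspan S)"
  shows "(\<And>T. T \<in> S \<Longrightarrow> T *\<^sub>V x = 0) \<Longrightarrow> x = 0" "(\<And>T. T \<in> S \<Longrightarrow> adj T *\<^sub>V y = 0) \<Longrightarrow> y = 0"
proof -
  assume 0: "\<And>T. T \<in> S \<Longrightarrow> T *\<^sub>V x = 0"
  have "T *\<^sub>V x = 0" if "T \<in> wspan S" for T
    using wspan_induct[OF that wclosed_subspace_annihilator[of x]] 0 by blast
  then show "x = 0"
    using assms unfolding nondegenerate_def
    by (intro orthogonal_dense_zero[of "{adj T *\<^sub>V k |T k. T \<in> wspan S}"])
      (auto simp: cinner_adj_right)
next
  assume 0: "\<And>T. T \<in> S \<Longrightarrow> adj T *\<^sub>V y = 0"
  have "adj T *\<^sub>V y = 0" if "T \<in> wspan S" for T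
    using wspan_induct[OF that
        wclosed_subspace_adj_preimage[OF wclosed_subspace_annihilator[of y]]] 0 by blast
  then show "y = 0"
    using assms unfolding nondegenerate_def
    by (intro orthogonal_dense_zero[of "{T *\<^sub>V h |T h. T \<in> wspan S}"])
      (auto simp flip: cinner_adj_left)
qed

section \<open>Conjugation by unitaries and the stable isomorphism\<close>

lemma unitary_betweenI:
  fixes U :: "(('i, 'a::chilbert_space) ell2, ('j, 'b::chilbert_space) ell2) cblinfun"
  assumes "\<And>x. adj U *\<^sub>V (U *\<^sub>V x) = x" "\<And>y. U *\<^sub>V (adj U *\<^sub>V y) = y"
  shows "unitary_between (ell2_on UNIV) (ell2_on UNIV) U"
proof -
  have "U *\<^sub>V x = 0" if "\<forall>y. cinner y x = 0" for x
    using that cinner_self[of x] by simp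
  then show ?thesis
    using assms unfolding unitary_between_def ops_between_def ell2_on_def by auto
qed

lemma unitary_conj_dual_operator_space_iso:
  fixes U1 :: "('a::chilbert_space, 'c::chilbert_space) cblinfun"
    and U2 :: "('b::chilbert_space, 'd::chilbert_space) cblinfun"
  assumes U1: "\<And>x. adj U1 *\<^sub>V (U1 *\<^sub>V x) = x" "\<And>y. U1 *\<^sub>V (adj U1 *\<^sub>V y) = y"
    and U2: "\<And>x. adj U2 *\<^sub>V (U2 *\<^sub>V x) = x" "\<And>y. U2 *\<^sub>V (adj U2 *\<^sub>V y) = y"
    and W: "W = {U2 o\<^sub>C\<^sub>L z o\<^sub>C\<^sub>L adj U1 | z. z \<in> V}"
  shows "dual_operator_space_iso V W (\<lambda>z. U2 o\<^sub>C\<^sub>L z o\<^sub>C\<^sub>L adj U1)"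
proof -
  let ?\<phi> = "\<lambda>z. U2 o\<^sub>C\<^sub>L z o\<^sub>C\<^sub>L adj U1" and ?\<psi> = "\<lambda>w. adj U2 o\<^sub>C\<^sub>L w o\<^sub>C\<^sub>L U1"
  have norm1: "norm (U1 *\<^sub>V x) = norm x" for x
    by (simp add: norm_eq_sqrt_inner U1 flip: inner_adj_right)
  have norm1': "norm (adj U1 *\<^sub>V y) = norm y" for y
    by (simp add: norm_eq_sqrt_inner U1 inner_adj_left)
  have norm2: "norm (U2 *\<^sub>V x) = norm x" for x
    by (simp add: norm_eq_sqrt_inner U2 flip: inner_adj_right)
  have \<psi>\<phi>: "?\<psi> (?\<phi> z) = z" for z by (rule cblinfun_eqI) (simp add: U1 U2)
  have \<phi>\<psi>: "?\<phi> (?\<psi> w) = w" for w by (rule cblinfun_eqI) (simp add: U1 U2)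
  have VW: "?\<phi> z \<in> W" if "z \<in> V" for z using that W by blast
  have WV: "?\<psi> w \<in> V" if "w \<in> W" for w using that \<psi>\<phi> unfolding W by auto
  have "mat_norm n (\<lambda>i j. ?\<phi> (A i j)) = mat_norm n A" for n A
  proof -
    have eq: "(\<Sum>i<n. (norm (\<Sum>j<n. ?\<phi> (A i j) *\<^sub>V v j))\<^sup>2)
        = (\<Sum>i<n. (norm (\<Sum>j<n. A i j *\<^sub>V (adj U1 *\<^sub>V v j)))\<^sup>2)" for v
    proof (rule sum.cong[OF refl])
      fix i
      have "(\<Sum>j<n. ?\<phi> (A i j) *\<^sub>V v j) = U2 *\<^sub>V (\<Sum>j<n. A i j *\<^sub>V (adj U1 *\<^sub>V v j))"
        by (simp add: cblinfun_apply_sum)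
      then show "(norm (\<Sum>j<n. ?\<phi> (A i j) *\<^sub>V v j))\<^sup>2
          = (norm (\<Sum>j<n. A i j *\<^sub>V (adj U1 *\<^sub>V v j)))\<^sup>2"
        by (simp only: norm2)
    qed
    \<comment> \<open>Applying adj U1 to each coordinate carries one unit ball onto the other, so
      the sets themselves agree, not only their suprema.\<close>
    have "{sqrt (\<Sum>i<n. (norm (\<Sum>j<n. ?\<phi> (A i j) *\<^sub>V v j))\<^sup>2) | v. (\<Sum>j<n. (norm (v j))\<^sup>2) \<le> 1}
        = {sqrt (\<Sum>i<n. (norm (\<Sum>j<n. A i j *\<^sub>V v j))\<^sup>2) | v. (\<Sum>j<n. (norm (v j))\<^sup>2) \<le> 1}"
      (is "?L = ?R")
    proof (intro equalityI subsetI)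
      fix r assume "r \<in> ?L"
      then obtain v where "r = sqrt (\<Sum>i<n. (norm (\<Sum>j<n. A i j *\<^sub>V (adj U1 *\<^sub>V v j)))\<^sup>2)"
        "(\<Sum>j<n. (norm (v j))\<^sup>2) \<le> 1" unfolding eq by blast
      then show "r \<in> ?R" by (intro CollectI exI[of _ "\<lambda>j. adj U1 *\<^sub>V v j"]) (simp add: norm1')
    next
      fix r assume "r \<in> ?R"
      then obtain v where "r = sqrt (\<Sum>i<n. (norm (\<Sum>j<n. A i j *\<^sub>V v j))\<^sup>2)"
        "(\<Sum>j<n. (norm (v j))\<^sup>2) \<le> 1" by blast
      then show "r \<in> ?L"
        unfolding eq by (intro CollectI exI[of _ "\<lambda>j. U1 *\<^sub>V v j"]) (simp add: norm1 U1)
    qed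
    then show ?thesis unfolding mat_norm_def by simp
  qed
  then have "completely_isometric_on V ?\<phi>"
    by (simp add: completely_isometric_on_def)
  moreover have "homeomorphic_map (subtopology weak_star V) (subtopology weak_star W) ?\<phi>"
    unfolding homeomorphic_map_maps homeomorphic_maps_def
  proof (intro exI[of _ ?\<psi>] conjI)
    show "continuous_map (subtopology weak_star V) (subtopology weak_star W) ?\<phi>"
      unfolding continuous_map_in_subtopology
      using continuous_map_from_subtopology[OF continuous_map_compose_weak_star[of U2 "adj U1"]] VW
      by auto
    show "continuous_map (subtopology weak_star W) (subtopology weak_star V) ?\<psi>"
      unfolding continuous_map_in_subtopology
      using continuous_map_from_subtopology[OF continuous_map_compose_weak_star[of "adj U2" U1]] WV
      by auto
  qed (use \<psi>\<phi> \<phi>\<psi> in auto)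
  moreover have "?\<phi> (x + y) = ?\<phi> x + ?\<phi> y" "?\<phi> (c *\<^sub>C x) = c *\<^sub>C ?\<phi> x" for x y c
    by (rule cblinfun_eqI; simp)+
  ultimately show ?thesis by (simp add: dual_operator_space_iso_def)
qed

theorem theorem4p3:
  fixes X :: "('h1::chilbert_space, 'h2::chilbert_space) cblinfun set"
    and Y :: "('k1::chilbert_space, 'k2::chilbert_space) cblinfun set"
  assumes "csubspace X" and "closedin weak_star X" and "nondegenerate X"
    and "csubspace Y" and "closedin weak_star Y" and "nondegenerate Y"
    and "TRO_equivalent X Y"
  shows "(\<exists>J :: ('h1, 'h2, 'k1, 'k2) index set. J \<noteq> {} \<and>
      (\<exists>(U1 :: ((('h1, 'h2, 'k1, 'k2) index, 'h1) ell2, (('h1, 'h2, 'k1, 'k2) index, 'k1) ell2) cblinfun)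
        (U2 :: ((('h1, 'h2, 'k1, 'k2) index, 'h2) ell2, (('h1, 'h2, 'k1, 'k2) index, 'k2) ell2) cblinfun).
        unitary_between (ell2_on J) (ell2_on J) U1 \<and>
        unitary_between (ell2_on J) (ell2_on J) U2 \<and>
        tensor_M Y J = {U2 o\<^sub>C\<^sub>L z o\<^sub>C\<^sub>L adj U1 | z. z \<in> tensor_M X J})) \<and>
    stably_isomorphic X Y"
proof -
  \<comment> \<open>Both unitaries must share one index set. The whole type is infinite through its
    summand nat and receives all four Hilbert spaces injectively.\<close>
  let ?J = "UNIV :: ('h1, 'h2, 'k1, 'k2) index set"
  have X: "wclosed_subspace X" and Y: "wclosed_subspace Y"
    using assms by (simp_all add: wclosed_subspace_def)
  obtain M1 :: "('h1, 'k1) cblinfun set" and M2 :: "('h2, 'k2) cblinfun set"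
    where M1: "TRO M1" and M2: "TRO M2"
    and Yeq: "Y = wspan {m2 o\<^sub>C\<^sub>L x o\<^sub>C\<^sub>L adj m1 | m2 x m1. m2 \<in> M2 \<and> x \<in> X \<and> m1 \<in> M1}"
    and Xeq: "X = wspan {adj m2 o\<^sub>C\<^sub>L y o\<^sub>C\<^sub>L m1 | m2 y m1. m2 \<in> M2 \<and> y \<in> Y \<and> m1 \<in> M1}"
    using assms(7) unfolding TRO_equivalent_def by blast
  define N1 where "N1 = wspan M1"
  define N2 where "N2 = wspan M2"
  have N: "wclosed_subspace N1" "wclosed_subspace N2"
    by (simp_all add: N1_def N2_def wclosed_subspace_wspan)
  have MN: "M1 \<subseteq> N1" "M2 \<subseteq> N2" unfolding N1_def N2_def by (rule wspan_superset)+
  have triple1: "a o\<^sub>C\<^sub>L adj b o\<^sub>C\<^sub>L c \<in> N1" if "a \<in> N1" "b \<in> N1" "c \<in> N1" for a b c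
    using that unfolding N1_def by (rule wspan_TRO[OF M1])
  have triple2: "a o\<^sub>C\<^sub>L adj b o\<^sub>C\<^sub>L c \<in> N2" if "a \<in> N2" "b \<in> N2" "c \<in> N2" for a b c
    using that unfolding N2_def by (rule wspan_TRO[OF M2])
  \<comment> \<open>Since Y is w*-closed, the containment extends from M1 and M2 to their
    w*-closures, one factor at a time.\<close>
  have toY: "n2 o\<^sub>C\<^sub>L x o\<^sub>C\<^sub>L adj n1 \<in> Y" if "n2 \<in> N2" "x \<in> X" "n1 \<in> N1" for n2 x n1
  proof (rule wspan_compose_mem[OF Y])
    show "n2 \<in> wspan M2" "adj n1 \<in> wspan (adj ` M1)"
      using that adj_wspan by (auto simp: N1_def N2_def)
    fix a c assume "a \<in> M2" "c \<in> adj ` M1"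
    then show "a o\<^sub>C\<^sub>L x o\<^sub>C\<^sub>L c \<in> Y"
      unfolding Yeq using \<open>x \<in> X\<close> by (intro subsetD[OF wspan_superset]) blast
  qed
  have toX: "adj n2 o\<^sub>C\<^sub>L y o\<^sub>C\<^sub>L n1 \<in> X" if "n2 \<in> N2" "y \<in> Y" "n1 \<in> N1" for n2 y n1
  proof (rule wspan_compose_mem[OF X])
    show "adj n2 \<in> wspan (adj ` M2)" "n1 \<in> wspan M1"
      using that adj_wspan by (auto simp: N1_def N2_def)
    fix a c assume "a \<in> adj ` M2" "c \<in> M1"
    then show "a o\<^sub>C\<^sub>L y o\<^sub>C\<^sub>L c \<in> X"
      unfolding Xeq using \<open>y \<in> Y\<close> by (intro subsetD[OF wspan_superset]) blast
  qed
  note kerX = nondegenerate_wspan_ker[OF assms(3)[unfolded Xeq]]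
  note kerY = nondegenerate_wspan_ker[OF assms(6)[unfolded Yeq]]
  \<comment> \<open>Generators of X apply an operator of M1 first, and their adjoints one of M2; a
    vector killed by all of M1 or M2 is therefore killed by X or by its adjoints. The generators of
    Y settle the adjoints of M1 and M2 in the same way.\<close>
  have ker1: "x = 0" if "\<And>m. m \<in> N1 \<Longrightarrow> m *\<^sub>V x = 0" for x
    by (rule kerX(1)) (use that MN(1) in fastforce)
  have ker1': "y = 0" if "\<And>m. m \<in> N1 \<Longrightarrow> adj m *\<^sub>V y = 0" for y
    by (rule kerY(1)) (use that MN(1) in fastforce)
  have ker2: "x = 0" if "\<And>m. m \<in> N2 \<Longrightarrow> m *\<^sub>V x = 0" for x
    by (rule kerX(2)) (use that MN(2) in fastforce)
  have ker2': "y = 0" if "\<And>m. m \<in> N2 \<Longrightarrow> adj m *\<^sub>V y = 0" for y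
    by (rule kerY(2)) (use that MN(2) in fastforce)
  have inf: "infinite ?J"
  proof
    have inj: "inj (\<lambda>n :: nat. Inr (Inr (Inr (Inr n))) :: ('h1, 'h2, 'k1, 'k2) index)"
      by (auto intro: injI)
    assume "finite ?J"
    then have "finite (range (\<lambda>n :: nat. Inr (Inr (Inr (Inr n))) :: ('h1, 'h2, 'k1, 'k2) index))"
      by (rule rev_finite_subset) simp
    then show False using finite_imageD[OF _ inj] by simp
  qed
  have inj: "inj (\<lambda>x. Inl x :: ('h1, 'h2, 'k1, 'k2) index)"
    "inj (\<lambda>x. Inr (Inl x) :: ('h1, 'h2, 'k1, 'k2) index)"
    "inj (\<lambda>x. Inr (Inr (Inl x)) :: ('h1, 'h2, 'k1, 'k2) index)"
    "inj (\<lambda>x. Inr (Inr (Inr (Inl x))) :: ('h1, 'h2, 'k1, 'k2) index)"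
    by (auto intro: injI)
  obtain U1 :: "((('h1, 'h2, 'k1, 'k2) index, 'h1) ell2, (('h1, 'h2, 'k1, 'k2) index, 'k1) ell2) cblinfun"
    where U1N: "\<And>i j. entry i j U1 \<in> N1"
    and U1: "\<And>x. adj U1 *\<^sub>V (U1 *\<^sub>V x) = x" "\<And>y. U1 *\<^sub>V (adj U1 *\<^sub>V y) = y"
    using unitary_with_entries_exists[OF N(1) triple1 ker1 ker1' inf inj(1) inj(3)] by blast
  obtain U2 :: "((('h1, 'h2, 'k1, 'k2) index, 'h2) ell2, (('h1, 'h2, 'k1, 'k2) index, 'k2) ell2) cblinfun"
    where U2N: "\<And>i j. entry i j U2 \<in> N2"
    and U2: "\<And>x. adj U2 *\<^sub>V (U2 *\<^sub>V x) = x" "\<And>y. U2 *\<^sub>V (adj U2 *\<^sub>V y) = y"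
    using unitary_with_entries_exists[OF N(2) triple2 ker2 ker2' inf inj(2) inj(4)] by blast
  \<comment> \<open>Entries of U2 z (adj U1) are w*-limits of sums of products in N2 X (adj N1), and
    those of adj U2 w U1 of products in (adj N2) Y N1.\<close>
  have eq: "tensor_M Y ?J = {U2 o\<^sub>C\<^sub>L z o\<^sub>C\<^sub>L adj U1 | z. z \<in> tensor_M X ?J}"
    unfolding tensor_M_eq_entries[OF X] tensor_M_eq_entries[OF Y]
  proof (intro equalityI subsetI)
    fix w :: "((('h1, 'h2, 'k1, 'k2) index, 'k1) ell2, (('h1, 'h2, 'k1, 'k2) index, 'k2) ell2) cblinfun"
    assume w: "w \<in> {z. \<forall>i j. entry i j z \<in> Y}"
    have "entry i j (adj U2 o\<^sub>C\<^sub>L w o\<^sub>C\<^sub>L U1) \<in> X" for i j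
      by (rule entry_triple_mem[OF X]) (use w in \<open>simp add: entry_adj toX U1N U2N\<close>)
    moreover have "w = U2 o\<^sub>C\<^sub>L (adj U2 o\<^sub>C\<^sub>L w o\<^sub>C\<^sub>L U1) o\<^sub>C\<^sub>L adj U1"
      by (rule cblinfun_eqI) (simp add: U1 U2)
    ultimately show "w \<in> {U2 o\<^sub>C\<^sub>L z o\<^sub>C\<^sub>L adj U1 | z. z \<in> {z. \<forall>i j. entry i j z \<in> X}}"
      by blast
  next
    fix w :: "((('h1, 'h2, 'k1, 'k2) index, 'k1) ell2, (('h1, 'h2, 'k1, 'k2) index, 'k2) ell2) cblinfun"
    assume "w \<in> {U2 o\<^sub>C\<^sub>L z o\<^sub>C\<^sub>L adj U1 | z. z \<in> {z. \<forall>i j. entry i j z \<in> X}}"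
    then obtain z where z: "\<And>i j. entry i j z \<in> X" and w: "w = U2 o\<^sub>C\<^sub>L z o\<^sub>C\<^sub>L adj U1" by blast
    have "entry i j w \<in> Y" for i j
      unfolding w by (rule entry_triple_mem[OF Y]) (simp add: entry_adj toY U1N U2N z)
    then show "w \<in> {z. \<forall>i j. entry i j z \<in> Y}" by blast
  qed
  have "stably_isomorphic X Y"
    unfolding stably_isomorphic_def
    using unitary_conj_dual_operator_space_iso[OF U1 U2 eq]
    by (intro exI[of _ ?J] conjI) auto
  moreover note unitary_betweenI[OF U1] unitary_betweenI[OF U2] eq
  ultimately show ?thesis
    by (intro conjI exI[of _ ?J] exI[of _ U1] exI[of _ U2]) auto
qed

end
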